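(* Let $n\ge1$, $0<\alpha\le1$, and let $S\subset\mathbb{H}^n$ be a $C^{1,\alpha}_{\mathbb{H}}$-surface. Then $S$ is LI rectifiable.
   Context: **Heisenberg group.** $\mathbb{H}^n=\mathbb{R}^{2n}\times\mathbb{R}$ with group law $(x,t)\cdot(x',t')=\bigl(x+x',\,t+t'+\tfrac12\sum_{i=1}^n(x_ix'_{n+i}-x_{n+i}x'_i)\bigr)$, norm $\|(x,t)\|=(|x|^4+16t^2)^{1/4}$ and metric $d_{\mathbb{H}}(p,q)=\|q^{-1}\cdot p\|$. All metric notions in $\mathbb{H}^n$ (balls, Lipschitz maps, Hausdorff measures $\mathcal{H}^s$) are with respect to $d_{\mathbb{H}}$. **Horizontal derivatives.** $X_i=\partial_{x_i}-\tfrac{x_{n+i}}2\partial_t$, $X_{n+i}=\partial_{x_{n+i}}+\tfrac{x_i}2\partial_t$ ($1\le i\le n$), and $\nabla_{\mathbb{H}}f=(X_1f,\dots,X_{2n}f)$. For $U\subset\mathbb{H}^n$ open, $C^1_{\mathbb{H}}(U)$ is the set of continuous $f\colon U\to\mathbb{R}$ whose distributional horizontal gradient is continuous. **$C^{1,\alpha}_{\mathbb{H}}$-surfaces.** For $0<\alpha\le1$, $S\subset\mathbb{H}^n$ is a $C^{1,\alpha}_{\mathbb{H}}$-surface if for every $p\in S$ there are an open ball $B(p,r)$, a function $f\in C^1_{\mathbb{H}}(B(p,r))$ with $\nabla_{\mathbb{H}}f(p)\ne0$, and a constant $H=H_p\ge1$ such that $S\cap B(p,r)=\{q\in B(p,r):f(q)=0\}$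 and $|\nabla_{\mathbb{H}}f(q_1)-\nabla_{\mathbb{H}}f(q_2)|\le H\,d_{\mathbb{H}}(q_1,q_2)^\alpha$ for all $q_1,q_2\in S\cap B(p,r)$. **LI rectifiability.** A codimension-1 vertical subgroup is a codimension-1 linear subspace of $\mathbb{R}^{2n+1}$ containing the $t$-axis, with the metric $d_{\mathbb{H}}$. An $\mathcal{H}^{2n+1}$-measurable $E\subset\mathbb{H}^n$ is LI rectifiable if $\mathcal{H}^{2n+1}$ almost all of $E$ can be covered by countably many Lipschitz images of closed subsets of codimension-1 vertical subgroups. *)

theory Defs
  imports "HOL-Analysis.Analysis"
begin

section \<open>The Heisenberg group as a metric space\<close>

text \<open>
  The dimension \<open>n \<ge> 1\<close> is \<open>CARD('n)\<close>. Coordinates of \<open>\<real>\<^sup>2\<^sup>n\<close> are indexed by \<open>'n + 'n\<close>: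
  for \<open>i :: 'n\<close> the coordinate \<open>x\<^sub>i\<close> is \<open>x $ Inl i\<close> and \<open>x\<^sub>n\<^sub>+\<^sub>i\<close> is \<open>x $ Inr i\<close>.
  The type is a copy of \<open>\<real>\<^sup>2\<^sup>n \<times> \<real>\<close>, so that the metric-space class instance below is the
  Heisenberg metric rather than the Euclidean one.
\<close>

typedef (overloaded) 'n heis = "UNIV :: ((real ^ ('n::finite + 'n)) \<times> real) set"
  morphisms coords Heis
  by simp

definition hor :: "'n::finite heis \<Rightarrow> real ^ ('n + 'n)" where
  "hor p = fst (coords p)"

definition vert :: "'n::finite heis \<Rightarrow> real" where
  "vert p = snd (coords p)"

lemma coords_Heis [simp]: "coords (Heis z) = z"
  by (simp add: Heis_inverse)

lemma Heis_coords [simp]: "Heis (coords p) = p"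
  by (simp add: coords_inverse)

lemma hor_Heis [simp]: "hor (Heis (x, t)) = x"
  and vert_Heis [simp]: "vert (Heis (x, t)) = t"
  by (simp_all add: hor_def vert_def)

lemma heis_eqI: "hor p = hor q \<Longrightarrow> vert p = vert q \<Longrightarrow> p = q"
  by (metis hor_def vert_def prod.expand Heis_coords)

definition heis_mult :: "'n::finite heis \<Rightarrow> 'n heis \<Rightarrow> 'n heis" (infixl \<open>\<cdot>\<close> 70) where
  "p \<cdot> q = Heis (hor p + hor q,
     vert p + vert q +
     1/2 * (\<Sum>i\<in>UNIV. hor p $ Inl i * hor q $ Inr i - hor p $ Inr i * hor q $ Inl i))"

definition heis_inv :: "'n::finite heis \<Rightarrow> 'n heis" where
  "heis_inv p = Heis (- hor p, - vert p)"

definition heis_norm :: "'n::finite heis \<Rightarrow> real" where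
  "heis_norm p = root 4 (norm (hor p) ^ 4 + 16 * (vert p)\<^sup>2)"

lemma heis_assoc: "(p \<cdot> q) \<cdot> r = p \<cdot> (q \<cdot> r)"
  by (rule heis_eqI)
    (simp_all add: heis_mult_def algebra_simps sum.distrib sum_subtractf)

lemma heis_unit [simp]: "Heis (0, 0) \<cdot> p = p" "p \<cdot> Heis (0, 0) = p"
  by (rule heis_eqI; simp add: heis_mult_def)+

lemma heis_inv [simp]: "heis_inv p \<cdot> p = Heis (0, 0)" "p \<cdot> heis_inv p = Heis (0, 0)"
  by (rule heis_eqI; simp add: heis_mult_def heis_inv_def mult.commute)+

lemma heis_norm_inv [simp]: "heis_norm (heis_inv p) = heis_norm p"
  by (simp add: heis_norm_def heis_inv_def)

lemma heis_inv_mult: "heis_inv (p \<cdot> q) = heis_inv q \<cdot> heis_inv p"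
proof -
  have "(heis_inv q \<cdot> heis_inv p) \<cdot> (p \<cdot> q) = heis_inv q \<cdot> ((heis_inv p \<cdot> p) \<cdot> q)"
    by (simp only: heis_assoc)
  then have "(heis_inv q \<cdot> heis_inv p) \<cdot> (p \<cdot> q) = Heis (0, 0)"
    by simp
  then show ?thesis
    by (metis heis_assoc heis_inv(2) heis_unit)
qed

lemma heis_inv_inv [simp]: "heis_inv (heis_inv p) = p"
  by (rule heis_eqI) (simp_all add: heis_inv_def)

lemma heis_norm_nonneg: "0 \<le> heis_norm p"
  by (simp add: heis_norm_def)

lemma heis_norm_eq_0_iff: "heis_norm p = 0 \<longleftrightarrow> p = Heis (0, 0)"
proof -
  have "heis_norm p = 0 \<longleftrightarrow> hor p = 0 \<and> vert p = 0"
    by (simp add: heis_norm_def add_nonneg_eq_0_iff)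
  then show ?thesis
    by (metis heis_eqI hor_Heis vert_Heis)
qed

lemma heis_norm_power2: "(heis_norm p)\<^sup>2 = cmod (Complex ((norm (hor p))\<^sup>2) (4 * vert p))"
proof -
  have "((heis_norm p)\<^sup>2)\<^sup>2 = heis_norm p ^ 4"
    by (simp add: power_mult[symmetric])
  also have "\<dots> = norm (hor p) ^ 4 + 16 * (vert p)\<^sup>2"
    by (simp add: heis_norm_def)
  also have "\<dots> = (cmod (Complex ((norm (hor p))\<^sup>2) (4 * vert p)))\<^sup>2"
    by (simp add: cmod_power2 power_mult_distrib flip: power_mult)
  finally show ?thesis
    by (rule power2_eq_imp_eq) simp_all
qed

lemma norm_hor_le: "norm (hor p) \<le> heis_norm p"
proof -
  have "(norm (hor p))\<^sup>2 \<le> (heis_norm p)\<^sup>2"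
    unfolding heis_norm_power2 using complex_Re_le_cmod by (metis complex.sel(1))
  then show ?thesis
    using heis_norm_nonneg power2_le_imp_le by blast
qed

lemma inner_symplectic_bound:
  fixes x y :: "real ^ ('n::finite + 'n)"
  defines "w \<equiv> \<Sum>i\<in>UNIV. x $ Inl i * y $ Inr i - x $ Inr i * y $ Inl i"
  shows "cmod (Complex (x \<bullet> y) w) \<le> norm x * norm y"
proof -
  define z :: "real ^ ('n + 'n)"
    where "z = (\<chi> j. case j of Inl i \<Rightarrow> y $ Inr i | Inr i \<Rightarrow> - y $ Inl i)"
  have split: "sum g UNIV = (\<Sum>i\<in>UNIV. g (Inl i)) + (\<Sum>i\<in>UNIV. g (Inr i))"
    for g :: "'n + 'n \<Rightarrow> real"
    using sum.Plus[of UNIV UNIV g] by simp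
  have xz: "x \<bullet> z = w"
    by (simp add: inner_vec_def split z_def w_def sum_subtractf sum_negf)
  have yz: "y \<bullet> z = 0"
    by (simp add: inner_vec_def split z_def sum_negf mult.commute)
  have zz: "z \<bullet> z = y \<bullet> y"
    by (simp add: inner_vec_def split z_def)
  define c where "c = x \<bullet> y"
  define v where "v = c *\<^sub>R y + w *\<^sub>R z"
  have xv: "x \<bullet> v = c\<^sup>2 + w\<^sup>2"
    by (simp add: v_def inner_add_right xz power2_eq_square c_def)
  have "v \<bullet> v = (c\<^sup>2 + w\<^sup>2) * (y \<bullet> y)"
    using yz by (simp add: v_def inner_add_left inner_add_right zz inner_commute[of z y]
        power2_eq_square algebra_simps)
  then have nv: "norm v = cmod (Complex c w) * norm y"
    by (simp add: norm_eq_sqrt_inner[of v] norm_eq_sqrt_inner[of y] real_sqrt_mult cmod_def)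
  have "(cmod (Complex c w))\<^sup>2 \<le> norm x * norm y * cmod (Complex c w)"
    using norm_cauchy_schwarz[of x v] by (simp add: xv nv cmod_power2 mult_ac)
  then show ?thesis
    by (cases "cmod (Complex c w) = 0") (auto simp: power2_eq_square c_def)
qed

lemma heis_norm_triangle: "heis_norm (p \<cdot> q) \<le> heis_norm p + heis_norm q"
proof -
  define w where "w = (\<Sum>i\<in>UNIV. hor p $ Inl i * hor q $ Inr i - hor p $ Inr i * hor q $ Inl i)"
  have "Complex ((norm (hor (p \<cdot> q)))\<^sup>2) (4 * vert (p \<cdot> q))
      = Complex ((norm (hor p))\<^sup>2) (4 * vert p) + Complex ((norm (hor q))\<^sup>2) (4 * vert q)
        + 2 * Complex (hor p \<bullet> hor q) w"
    by (simp add: complex_eq_iff heis_mult_def w_def power2_norm_eq_inner inner_add_left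
        inner_add_right inner_commute[of "hor q" "hor p"])
  then have "(heis_norm (p \<cdot> q))\<^sup>2
      \<le> (heis_norm p)\<^sup>2 + (heis_norm q)\<^sup>2 + 2 * cmod (Complex (hor p \<bullet> hor q) w)"
    unfolding heis_norm_power2
    by (metis (no_types, lifting) add_right_mono norm_triangle_ineq norm_mult norm_numeral
        order_trans)
  also have "\<dots> \<le> (heis_norm p)\<^sup>2 + (heis_norm q)\<^sup>2 + 2 * (heis_norm p * heis_norm q)"
    using inner_symplectic_bound[of "hor p" "hor q"]
      mult_mono[OF norm_hor_le[of p] norm_hor_le[of q] heis_norm_nonneg norm_ge_zero]
    by (simp add: w_def)
  also have "\<dots> = (heis_norm p + heis_norm q)\<^sup>2"
    by (simp add: power2_sum)
  finally show ?thesis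
    using heis_norm_nonneg by (metis add_nonneg_nonneg power2_le_imp_le)
qed

instantiation heis :: (finite) metric_space
begin

definition dist_heis :: "'a heis \<Rightarrow> 'a heis \<Rightarrow> real" where
  "dist_heis p q = heis_norm (heis_inv q \<cdot> p)"

definition uniformity_heis :: "('a heis \<times> 'a heis) filter" where
  "uniformity_heis = (INF e\<in>{0<..}. principal {(p, q). dist p q < e})"

definition open_heis :: "'a heis set \<Rightarrow> bool" where
  "open_heis U \<longleftrightarrow> (\<forall>p\<in>U. \<forall>\<^sub>F (p', q) in uniformity. p' = p \<longrightarrow> q \<in> U)"

instance
proof
  fix p q r :: "'a heis"
  show "dist p q = 0 \<longleftrightarrow> p = q"
    unfolding dist_heis_def heis_norm_eq_0_iff
    by (metis heis_assoc heis_inv heis_unit)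
  have "heis_inv q \<cdot> p = heis_inv (heis_inv r \<cdot> q) \<cdot> (heis_inv r \<cdot> p)"
    by (metis heis_assoc heis_inv(2) heis_inv_inv heis_inv_mult heis_unit(2))
  then show "dist p q \<le> dist p r + dist q r"
    unfolding dist_heis_def
    by (metis add.commute heis_norm_inv heis_norm_triangle)
qed (simp_all add: uniformity_heis_def open_heis_def)

end


section \<open>Horizontal derivatives\<close>

definition partial_x :: "'n::finite + 'n \<Rightarrow> ('n heis \<Rightarrow> real) \<Rightarrow> 'n heis \<Rightarrow> real" where
  "partial_x j \<phi> p = frechet_derivative (\<lambda>z. \<phi> (Heis z)) (at (coords p)) (axis j 1, 0)"

definition partial_t :: "('n::finite heis \<Rightarrow> real) \<Rightarrow> 'n heis \<Rightarrow> real" where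
  "partial_t \<phi> p = frechet_derivative (\<lambda>z. \<phi> (Heis z)) (at (coords p)) (0, 1)"

primrec X_field :: "'n::finite + 'n \<Rightarrow> ('n heis \<Rightarrow> real) \<Rightarrow> 'n heis \<Rightarrow> real" where
  "X_field (Inl i) = (\<lambda>\<phi> p. partial_x (Inl i) \<phi> p - hor p $ Inr i / 2 * partial_t \<phi> p)"
| "X_field (Inr i) = (\<lambda>\<phi> p. partial_x (Inr i) \<phi> p + hor p $ Inl i / 2 * partial_t \<phi> p)"

text \<open>Iterated directional derivatives in arbitrary directions; in finite dimension
  \<open>Ck k f\<close> is the usual \<open>C\<^sup>k\<close> condition on the whole space.\<close>

primrec Ck :: "nat \<Rightarrow> ('a::euclidean_space \<Rightarrow> real) \<Rightarrow> bool" where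
  "Ck 0 = (\<lambda>f. continuous_on UNIV f)"
| "Ck (Suc k) = (\<lambda>f. (\<forall>x. f differentiable (at x)) \<and>
     (\<forall>v. Ck k (\<lambda>x. frechet_derivative f (at x) v)))"

definition test_function :: "'n::finite heis set \<Rightarrow> ('n heis \<Rightarrow> real) \<Rightarrow> bool" where
  "test_function U \<phi> \<longleftrightarrow> (\<forall>k. Ck k (\<lambda>z. \<phi> (Heis z))) \<and>
     compact (closure {p. \<phi> p \<noteq> 0}) \<and> closure {p. \<phi> p \<noteq> 0} \<subseteq> U"

text \<open>The fields \<open>X\<^sub>j\<close> are divergence free with respect to Lebesgue measure on \<open>\<real>\<^sup>2\<^sup>n\<^sup>+\<^sup>1\<close>, hence
  the formal adjoint of \<open>X\<^sub>j\<close> is \<open>-X\<^sub>j\<close>. The integrals extend over the whole space, but the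
  integrands vanish off the support of \<open>\<phi>\<close>.\<close>

definition weak_hgrad ::
  "'n::finite heis set \<Rightarrow> ('n heis \<Rightarrow> real) \<Rightarrow> ('n heis \<Rightarrow> real ^ ('n + 'n)) \<Rightarrow> bool" where
  "weak_hgrad U f g \<longleftrightarrow> (\<forall>\<phi> j. test_function U \<phi> \<longrightarrow>
     (\<integral>z. f (Heis z) * X_field j \<phi> (Heis z) \<partial>lborel) =
     - (\<integral>z. g (Heis z) $ j * \<phi> (Heis z) \<partial>lborel))"

definition C1H :: "'n::finite heis set \<Rightarrow> ('n heis \<Rightarrow> real) set" where
  "C1H U = {f. continuous_on U f \<and> (\<exists>g. continuous_on U g \<and> weak_hgrad U f g)}"

text \<open>For open \<open>U\<close> and \<open>f \<in> C1H U\<close> the continuous representative of the distributional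
  horizontal gradient is unique on \<open>U\<close>; its values off \<open>U\<close> are immaterial.\<close>

definition hgrad :: "'n::finite heis set \<Rightarrow> ('n heis \<Rightarrow> real) \<Rightarrow> 'n heis \<Rightarrow> real ^ ('n + 'n)" where
  "hgrad U f = (SOME g. continuous_on U g \<and> weak_hgrad U f g)"

definition C1H_surface :: "real \<Rightarrow> 'n::finite heis set \<Rightarrow> bool" where
  "C1H_surface \<alpha> S \<longleftrightarrow>
     (\<forall>p\<in>S. \<exists>r>0. \<exists>f\<in>C1H (ball p r). \<exists>H\<ge>1.
        hgrad (ball p r) f p \<noteq> 0 \<and>
        S \<inter> ball p r = {q \<in> ball p r. f q = 0} \<and>
        (\<forall>q1\<in>S \<inter> ball p r. \<forall>q2\<in>S \<inter> ball p r.
           norm (hgrad (ball p r) f q1 - hgrad (ball p r) f q2) \<le> H * dist q1 q2 powr \<alpha>))"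


section \<open>Hausdorff measure and LI rectifiability\<close>

text \<open>Hausdorff outer measure in dimension \<open>s > 0\<close>, without normalising constant (which affects
  neither null sets nor measurability). Boundedness is required because \<open>diameter\<close> is real-valued
  and carries no information for unbounded sets.\<close>

definition hausdorff_outer :: "real \<Rightarrow> 'a::metric_space set \<Rightarrow> ennreal" where
  "hausdorff_outer s A =
     (SUP \<delta>\<in>{0<..}.
        INF C\<in>{C :: nat \<Rightarrow> 'a set.
                  (\<forall>i. bounded (C i) \<and> diameter (C i) \<le> \<delta>) \<and> A \<subseteq> (\<Union>i. C i)}.
          \<Sum>i. ennreal (diameter (C i) powr s))"

text \<open>Measurability in the sense of Caratheodory.\<close>

definition hausdorff_measurable :: "real \<Rightarrow> 'a::metric_space set \<Rightarrow> bool" where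
  "hausdorff_measurable s E \<longleftrightarrow> E \<in> lambda_system UNIV UNIV (hausdorff_outer s)"

definition vertical_subgroup_codim1 :: "'n::finite heis set \<Rightarrow> bool" where
  "vertical_subgroup_codim1 W \<longleftrightarrow>
     subspace (coords ` W) \<and> dim (coords ` W) = 2 * CARD('n) \<and> (\<forall>t. Heis (0, t) \<in> W)"

definition LI_rectifiable :: "'n::finite heis set \<Rightarrow> bool" where
  "LI_rectifiable E \<longleftrightarrow>
     hausdorff_measurable (2 * CARD('n) + 1) E \<and>
     (\<exists>(W :: nat \<Rightarrow> 'n heis set) (F :: nat \<Rightarrow> 'n heis set) (g :: nat \<Rightarrow> 'n heis \<Rightarrow> 'n heis).
        (\<forall>i. vertical_subgroup_codim1 (W i) \<and>
             closedin (top_of_set (W i)) (F i) \<and>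
             (\<exists>L. L-lipschitz_on (F i) (g i))) \<and>
        hausdorff_outer (2 * CARD('n) + 1) (E - (\<Union>i. g i ` F i)) = 0)"

end

theory Submission
  imports Defs
begin

text \<open>
  Near a point of the surface let \<open>e\<close> be the direction of the horizontal gradient \<open>G\<close> of the defining
  function \<open>f\<close>, and let \<open>N = G / (G \<bullet> e)\<close>, which is Hoelder continuous along \<open>S\<close> with exponent \<open>\<alpha>\<close>. Two
  facts combine to the theorem.

  The first is a flatness estimate (\<open>flatness\<close>): if \<open>x\<close> and \<open>y\<close> in \<open>S\<close> are at distance \<open>r\<close>, then \<open>y\<close> lies
  within a multiple of \<open>r powr (1 + \<beta>)\<close> of the vertical plane through \<open>x\<close> with normal \<open>N x\<close>, where
  \<open>\<beta> > 0\<close> depends on \<open>\<alpha>\<close>. Since \<open>N\<close> is controlled only along \<open>S\<close>, a Taylor expansion of \<open>f\<close> does not give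
  this. Instead one walks inside \<open>S\<close>: step in a direction orthogonal to \<open>e\<close>, then return to \<open>S\<close> along \<open>e\<close>.
  Along such a discrete horizontal curve the direction changes at the Hoelder rate, which settles the
  case where \<open>y\<close> is the end of such a curve. What remains is the case \<open>y = x \<cdot> (D e, \<tau>)\<close> of a
  displacement along \<open>e\<close> and the centre. The walks from \<open>x\<close> and from \<open>y\<close> in the direction
  conjugate to \<open>e\<close> satisfy a discrete Burgers equation: the difference of their central coordinates
  changes at the rate \<open>D\<close>, and \<open>D\<close> changes slowly. If \<open>D\<close> were large compared with \<open>r powr (1 + \<beta>)\<close>, the central
  difference would vanish at some time while \<open>D\<close> is still positive, which is impossible because \<open>f\<close> is
  strictly increasing along \<open>e\<close>.

  The second is a gluing construction (locale \<open>coding\<close>). Flatness means that the projection of \<open>S\<close> to the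
  tangent plane at \<open>q\<close>, followed by a symplectic shear of that plane to the fixed vertical plane orthogonal to
  \<open>e\<close>, is bilipschitz at scale \<open>r\<close> about \<open>q\<close> up to an error \<open>r powr (1 + \<gamma>)\<close>, and that the projections at
  nearby base points agree up to left translations and errors of this order (\<open>proj_estimates\<close>).
  Cut \<open>S\<close> at every dyadic scale into cells, by balls about a maximal separated set, and discard the points
  that lie at some fine scale in a thin shell about the boundaries of the cells. Points of different cells that are
  left are apart by almost the scale, so the projections based in nested cells converge to one
  bilipschitz map into the vertical plane; its inverse is the required Lipschitz map. With radii chosen by
  the pigeonhole principle (\<open>thin_shells\<close>) the discarded sets have summable measure, and by the Borel-Cantelli
  lemma almost every point is kept from some scale on. This uses that the surface has locally finite measure,
  which follows from disjointness of translates along \<open>e\<close> (\<open>separated_surface_card\<close>).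

  Two foundations are laid first. A function with continuous distributional horizontal gradient is
  differentiable along horizontal lines (\<open>horizontal_derivative\<close>), and Borel sets are measurable for
  Hausdorff measure (\<open>closed_lambda_hausdorff\<close>).
\<close>


section \<open>The group structure and the homogeneous norm\<close>

definition sympl :: "real ^ ('n::finite + 'n) \<Rightarrow> real ^ ('n + 'n) \<Rightarrow> real" where
  "sympl x y = (\<Sum>i\<in>UNIV. x $ Inl i * y $ Inr i - x $ Inr i * y $ Inl i)"

definition hexp :: "real ^ ('n::finite + 'n) \<Rightarrow> 'n::finite heis" where
  "hexp v = Heis (v, 0)"

lemma sympl_bound: "\<bar>sympl x y\<bar> \<le> norm x * norm y"
proof -
  have "\<bar>sympl x y\<bar> \<le> cmod (Complex (x \<bullet> y) (sympl x y))"
    using abs_Im_le_cmod[of "Complex (x \<bullet> y) (sympl x y)"] by simp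
  also have "\<dots> \<le> norm x * norm y"
    unfolding sympl_def by (rule inner_symplectic_bound)
  finally show ?thesis .
qed

lemma bounded_bilinear_sympl: "bounded_bilinear sympl"
proof
  show "\<exists>K. \<forall>a b. norm (sympl a b) \<le> norm a * norm b * K"
    by (rule exI[of _ 1]) (simp add: sympl_bound)
qed (simp_all add: sympl_def algebra_simps sum.distrib sum_distrib_left sum_subtractf)

interpretation sympl: bounded_bilinear sympl
  by (rule bounded_bilinear_sympl)

lemmas sympl_simps = sympl.add_left sympl.add_right sympl.diff_left sympl.diff_right
  sympl.scaleR_left sympl.scaleR_right sympl.minus_left sympl.minus_right
  sympl.zero_left sympl.zero_right

lemma sympl_self [simp]: "sympl x x = 0"
  by (simp add: sympl_def mult.commute)

lemma sympl_commute: "sympl x y = - sympl y x"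
  by (simp add: sympl_def mult.commute flip: sum_negf)

lemma hor_mult [simp]: "hor (p \<cdot> q) = hor p + hor q"
  and vert_mult [simp]: "vert (p \<cdot> q) = vert p + vert q + sympl (hor p) (hor q) / 2"
  by (simp_all add: heis_mult_def sympl_def)

lemma hor_inv [simp]: "hor (heis_inv p) = - hor p"
  and vert_inv [simp]: "vert (heis_inv p) = - vert p"
  by (simp_all add: heis_inv_def)

lemma hor_hexp [simp]: "hor (hexp v) = v"
  and vert_hexp [simp]: "vert (hexp v) = 0"
  by (simp_all add: hexp_def)

lemma hexp_0 [simp]: "hexp 0 = Heis (0, 0)"
  by (simp add: hexp_def)

lemma inv_mult_cancel [simp]:
  "heis_inv p \<cdot> (p \<cdot> q) = q" "p \<cdot> (heis_inv p \<cdot> q) = q"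
  by (simp_all flip: heis_assoc)

lemma hexp_add: "hexp (s *\<^sub>R v) \<cdot> hexp (t *\<^sub>R v) = hexp ((s + t) *\<^sub>R v)"
  by (rule heis_eqI) (simp_all add: algebra_simps sympl_simps)

lemma heis_norm_le: "heis_norm p \<le> norm (hor p) + 2 * sqrt \<bar>vert p\<bar>"
proof -
  let ?a = "norm (hor p)" and ?b = "2 * sqrt \<bar>vert p\<bar>"
  have b: "?b ^ 4 = 16 * (vert p)\<^sup>2"
  proof -
    have "?b ^ 4 = 16 * ((sqrt \<bar>vert p\<bar>)\<^sup>2)\<^sup>2"
      by (simp only: power_mult_distrib power_mult[symmetric]) simp
    also have "(sqrt \<bar>vert p\<bar>)\<^sup>2 = \<bar>vert p\<bar>" by simp
    also have "16 * \<bar>vert p\<bar>\<^sup>2 = 16 * (vert p)\<^sup>2" by simp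
    finally show ?thesis .
  qed
  have "?a ^ 4 + ?b ^ 4 \<le> (?a + ?b) ^ 4"
  proof -
    have nn: "0 \<le> ?a" "0 \<le> ?b" by auto
    have "(x + y) ^ 4 - (x ^ 4 + y ^ 4) = 4 * x^3 * y + 6 * x\<^sup>2 * y\<^sup>2 + 4 * x * y ^ 3" for x y :: real
      by algebra
    moreover have "0 \<le> 4 * ?a^3 * ?b + 6 * ?a\<^sup>2 * ?b\<^sup>2 + 4 * ?a * ?b ^ 3"
      using nn by simp
    ultimately show ?thesis by (metis diff_ge_0_iff_ge)
  qed
  then have "root 4 (?a ^ 4 + 16 * (vert p)\<^sup>2) \<le> root 4 ((?a + ?b) ^ 4)"
    by (simp only: b[symmetric] real_root_le_iff zero_less_numeral)
  then show ?thesis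
    by (simp add: heis_norm_def real_root_power_cancel)
qed

lemma vert_le: "\<bar>vert p\<bar> \<le> (heis_norm p)\<^sup>2 / 4"
proof -
  have "\<bar>4 * vert p\<bar> \<le> (heis_norm p)\<^sup>2"
    unfolding heis_norm_power2 using abs_Im_le_cmod by (metis complex.sel(2))
  then show ?thesis by (simp add: abs_mult)
qed

lemma sqrt_vert_le: "2 * sqrt \<bar>vert p\<bar> \<le> heis_norm p"
proof -
  have "sqrt (4 * \<bar>vert p\<bar>) \<le> sqrt ((heis_norm p)\<^sup>2)"
    using vert_le[of p] by (intro real_sqrt_le_mono) simp
  then show ?thesis
    by (simp add: real_sqrt_mult heis_norm_nonneg)
qed

lemma heis_norm_hexp [simp]: "heis_norm (hexp v) = norm v"
  by (simp add: heis_norm_def real_root_power_cancel)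

lemma dist_heis: "dist p q = heis_norm (heis_inv p \<cdot> q)"
  by (metis dist_heis_def dist_commute)

lemma dist_left [simp]: "dist (a \<cdot> p) (a \<cdot> q) = dist p q"
  by (simp add: dist_heis heis_inv_mult heis_assoc)

lemma dist_mult_right_self [simp]: "dist p (p \<cdot> v) = heis_norm v" "dist (p \<cdot> v) p = heis_norm v"
proof -
  show "dist p (p \<cdot> v) = heis_norm v" by (simp add: dist_heis)
  then show "dist (p \<cdot> v) p = heis_norm v" by (simp add: dist_commute)
qed

text \<open>Right multiplication is not an isometry; the defect is the vertical part of a commutator,
  which enters the homogeneous norm through a square root.\<close>

lemma heis_norm_conj_le:
  "heis_norm (heis_inv b \<cdot> (c \<cdot> b)) \<le> 2 * heis_norm c + 2 * sqrt (heis_norm c * heis_norm b)"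
proof -
  let ?z = "heis_inv b \<cdot> (c \<cdot> b)"
  have h: "hor ?z = hor c" by simp
  have v: "vert ?z = vert c + sympl (hor c) (hor b)"
    by (simp add: sympl_simps sympl_commute[of "hor b" "hor c"])
  have "\<bar>sympl (hor c) (hor b)\<bar> \<le> heis_norm c * heis_norm b"
    using sympl_bound[of "hor c" "hor b"] mult_mono[OF norm_hor_le[of c] norm_hor_le[of b]]
    by (meson heis_norm_nonneg norm_ge_zero order_trans)
  then have "sqrt \<bar>vert ?z\<bar> \<le> sqrt (\<bar>vert c\<bar> + heis_norm c * heis_norm b)"
    unfolding v by (intro real_sqrt_le_mono) linarith
  also have "\<dots> \<le> sqrt \<bar>vert c\<bar> + sqrt (heis_norm c * heis_norm b)"
    by (intro sqrt_add_le_add_sqrt) (simp_all add: heis_norm_nonneg)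
  finally show ?thesis
    using heis_norm_le[of ?z] norm_hor_le[of c] sqrt_vert_le[of c] unfolding h by linarith
qed

lemma dist_mult_le:
  "dist (a \<cdot> b) (a' \<cdot> b) \<le> 2 * dist a a' + 2 * sqrt (dist a a' * heis_norm b)"
proof -
  have "heis_inv (a \<cdot> b) \<cdot> (a' \<cdot> b) = heis_inv b \<cdot> ((heis_inv a \<cdot> a') \<cdot> b)"
    by (simp add: heis_inv_mult heis_assoc)
  then show ?thesis
    using heis_norm_conj_le[of b "heis_inv a \<cdot> a'"] by (simp add: dist_heis)
qed


section \<open>Comparison with the Euclidean topology\<close>

lemma continuous_on_Heis:
  "continuous_on A (Heis :: (real ^ ('n::finite + 'n)) \<times> real \<Rightarrow> 'n heis)"
proof (rule continuous_on_subset)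
  show "continuous_on UNIV (Heis :: (real ^ ('n::finite + 'n)) \<times> real \<Rightarrow> 'n heis)"
    unfolding continuous_on_def
  proof
    fix z :: "(real ^ ('n::finite + 'n)) \<times> real"
    have "((\<lambda>w. root 4 (norm (fst z - fst w) ^ 4
          + 16 * (snd z - snd w - sympl (fst w) (fst z) / 2)\<^sup>2)) \<longlongrightarrow>
        root 4 (norm (fst z - fst z) ^ 4 + 16 * (snd z - snd z - sympl (fst z) (fst z) / 2)\<^sup>2)) (at z)"
      by (intro tendsto_intros sympl.tendsto) simp_all
    moreover have "(\<lambda>w. dist (Heis w) (Heis z)) = (\<lambda>w. root 4 (norm (fst z - fst w) ^ 4
          + 16 * (snd z - snd w - sympl (fst w) (fst z) / 2)\<^sup>2))"
      by (simp add: dist_heis heis_norm_def hor_def[of "Heis _"] vert_def[of "Heis _"] sympl_simps)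
    ultimately have "((\<lambda>w. dist (Heis w) (Heis z)) \<longlongrightarrow> 0) (at z)"
      by simp
    then show "(Heis \<longlongrightarrow> Heis z) (at z within UNIV)"
      using tendsto_dist_iff by blast
  qed
qed simp

lemma continuous_on_hor: "continuous_on A (hor :: 'n::finite heis \<Rightarrow> _)"
proof -
  have "dist (hor p) (hor q) \<le> dist p q" for p q :: "'n::finite heis"
    using norm_hor_le[of "heis_inv q \<cdot> p"] by (simp add: dist_heis_def dist_norm)
  then have "1-lipschitz_on A hor"
    by (intro lipschitz_onI) auto
  then show ?thesis
    by (rule lipschitz_on_continuous_on)
qed

lemma continuous_on_vert: "continuous_on A (vert :: 'n::finite heis \<Rightarrow> _)"
proof (rule continuous_on_subset)
  show "continuous_on UNIV (vert :: 'n::finite heis \<Rightarrow> real)"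
    unfolding continuous_on_def
  proof
    fix p :: "'n::finite heis"
    have d: "((\<lambda>q. dist q p) \<longlongrightarrow> 0) (at p)"
      by (rule tendsto_dist_iff[THEN iffD1]) (rule tendsto_ident_at)
    have 1: "\<bar>vert q - vert p\<bar> \<le> (dist q p)\<^sup>2 / 4 + norm (hor p) * dist q p" for q
    proof -
      have "vert (heis_inv p \<cdot> q) = vert q - vert p - sympl (hor p) (hor q - hor p) / 2"
        by (simp add: sympl_simps)
      moreover have "\<bar>sympl (hor p) (hor q - hor p)\<bar> \<le> norm (hor p) * dist q p"
        using sympl_bound[of "hor p" "hor q - hor p"] norm_hor_le[of "heis_inv p \<cdot> q"]
        by (smt (verit, ccfv_threshold) dist_heis_def hor_inv hor_mult mult_left_mono norm_ge_zero
            uminus_add_conv_diff)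
      moreover have "\<bar>vert (heis_inv p \<cdot> q)\<bar> \<le> (dist q p)\<^sup>2 / 4"
        unfolding dist_heis_def by (rule vert_le)
      moreover have "0 \<le> norm (hor p) * dist q p" by simp
      ultimately show ?thesis by linarith
    qed
    have 2: "((\<lambda>q. (dist q p)\<^sup>2 / 4 + norm (hor p) * dist q p) \<longlongrightarrow> 0) (at p)"
      using tendsto_add[OF tendsto_divide[OF tendsto_power[OF d, of 2] tendsto_const[of 4]]
          tendsto_mult_left[OF d, of "norm (hor p)"]] by simp
    have "((\<lambda>q. vert q - vert p) \<longlongrightarrow> 0) (at p)"
      by (rule Lim_null_comparison[OF always_eventually 2]) (simp only: real_norm_def 1 simp_thms)
    then show "(vert \<longlongrightarrow> vert p) (at p within UNIV)"
      by (simp add: LIM_zero_iff)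
  qed
qed simp

lemma coords_eq: "coords = (\<lambda>p. (hor p, vert p))"
  by (simp add: fun_eq_iff hor_def vert_def)

lemma Heis_hor_vert [simp]: "Heis (hor p, vert p) = p"
  by (simp add: hor_def vert_def)

lemma continuous_on_coords: "continuous_on A coords"
  unfolding coords_eq by (intro continuous_intros continuous_on_hor continuous_on_vert)

lemma continuous_on_heis_mult [continuous_intros]:
  assumes "continuous_on A a" "continuous_on A b"
  shows "continuous_on A (\<lambda>x. a x \<cdot> b x)"
proof -
  have eq: "(\<lambda>x. a x \<cdot> b x) = (\<lambda>x. Heis (hor (a x) + hor (b x),
      vert (a x) + vert (b x) + sympl (hor (a x)) (hor (b x)) / 2))"
    by (auto intro!: ext heis_eqI)
  show ?thesis
    unfolding eq
    by (intro continuous_on_compose2[OF continuous_on_Heis] continuous_intros sympl.continuous_on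
        continuous_on_compose2[OF continuous_on_hor] continuous_on_compose2[OF continuous_on_vert]
        assms subset_UNIV)
      auto
qed

lemma open_coords_image: "open (coords ` U) \<longleftrightarrow> open U"
proof -
  have "open (Heis -` U)" if "open U"
    by (intro open_vimage that continuous_on_Heis)
  moreover have "open (coords -` (Heis -` U))" if "open (Heis -` U)"
    by (intro open_vimage that continuous_on_coords)
  moreover have "coords ` U = Heis -` U"
    by (rule set_eqI) (metis Heis_coords coords_Heis image_iff vimage_eq)
  moreover have "coords -` (Heis -` U) = U" by (simp add: vimage_def)
  ultimately show ?thesis by auto
qed

lemma bounded_heis_subset_box:
  "coords ` ball p r \<subseteq> cball (hor p) r \<times> cball (vert p) (r\<^sup>2 + norm (hor p) * r)"
proof (rule image_subsetI)
  fix q assume "q \<in> ball p r"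
  then have q: "dist p q < r" by simp
  then have r: "0 < r" using zero_le_dist[of p q] by linarith
  have h: "norm (hor q - hor p) \<le> dist p q"
    using norm_hor_le[of "heis_inv p \<cdot> q"] by (simp add: dist_heis)
  have "vert (heis_inv p \<cdot> q) = vert q - vert p - sympl (hor p) (hor q - hor p) / 2"
    by (simp add: sympl_simps)
  moreover have "\<bar>vert (heis_inv p \<cdot> q)\<bar> \<le> (dist p q)\<^sup>2 / 4"
    unfolding dist_heis by (rule vert_le)
  moreover have "\<bar>sympl (hor p) (hor q - hor p)\<bar> \<le> norm (hor p) * r"
    using sympl_bound[of "hor p" "hor q - hor p"] h q
    by (smt (verit) mult_left_mono norm_ge_zero)
  moreover have "(dist p q)\<^sup>2 \<le> r\<^sup>2" using q by (intro power_mono) auto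
  moreover have "0 \<le> norm (hor p) * r" "0 \<le> r\<^sup>2" using r by auto
  ultimately have "\<bar>vert q - vert p\<bar> \<le> r\<^sup>2 + norm (hor p) * r"
    by linarith
  then show "coords q \<in> cball (hor p) r \<times> cball (vert p) (r\<^sup>2 + norm (hor p) * r)"
    using h q by (auto simp: mem_Times_iff hor_def vert_def dist_norm norm_minus_commute)
qed

lemma compact_cball_heis: "compact (cball (p :: 'n::finite heis) r)"
proof -
  let ?B = "cball (hor p) (r + 1) \<times> cball (vert p) ((r + 1)\<^sup>2 + norm (hor p) * (r + 1))"
  have "cball p r \<subseteq> ball p (r + 1)" by auto
  then have "coords ` cball p r \<subseteq> ?B"
    using bounded_heis_subset_box[of p "r + 1"] by blast
  then have sub: "cball p r \<subseteq> Heis ` ?B"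
    by (metis (no_types) Heis_coords image_eqI image_subset_iff subsetI)
  have "compact (Heis ` ?B)"
    by (intro compact_continuous_image continuous_on_Heis compact_Times compact_cball)
  then show ?thesis
    using sub closed_cball by (metis compact_Int_closed inf.absorb_iff2)
qed

lemma complete_heis: "complete (UNIV :: 'n::finite heis set)"
  unfolding complete_def
proof safe
  fix s :: "nat \<Rightarrow> 'n::finite heis" assume c: "Cauchy s"
  then have "bounded (range s)" by (rule cauchy_imp_bounded)
  then obtain r where "range s \<subseteq> cball (s 0) r"
    by (metis bounded_subset_cball[of "range s"] bounded_any_center subset_eq mem_cball rangeI)
  moreover have "complete (cball (s 0) r)"
    by (intro compact_imp_complete compact_cball_heis)
  ultimately show "\<exists>l\<in>UNIV. s \<longlonglongrightarrow> l"
    using c unfolding complete_def by (metis UNIV_I range_subsetD)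
qed


section \<open>Lebesgue measure and volumes of balls\<close>

lemma emeasure_lborel_translate:
  fixes A :: "'a::euclidean_space set"
  assumes "A \<in> sets borel"
  shows "emeasure lborel ((\<lambda>x. c + x) -` A) = emeasure lborel A"
proof -
  have "emeasure (distr lborel borel (\<lambda>x. c + x)) A = emeasure lborel ((\<lambda>x. c + x) -` A)"
    using assms by (subst emeasure_distr) auto
  then show ?thesis by (simp add: lborel_distr_plus)
qed

text \<open>Both left and right translations of the group are shears in coordinates, so that by
  Fubini's theorem Lebesgue measure is a two-sided Haar measure.\<close>

lemma lborel_distr_shear:
  fixes a :: "'a::euclidean_space" and l :: "'a \<Rightarrow> real"
  assumes l: "continuous_on UNIV l"
  shows "distr lborel lborel (\<lambda>z. (a + fst z, l (fst z) + snd z)) = lborel"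
proof (rule measure_eqI)
  let ?T = "\<lambda>z. (a + fst z, l (fst z) + snd z)"
  have T: "?T \<in> borel_measurable borel"
    by (intro borel_measurable_continuous_onI continuous_intros continuous_on_compose2[OF l]) auto
  fix A assume "A \<in> sets (distr lborel lborel ?T)"
  then have A: "A \<in> sets borel" by simp
  then have A': "A \<in> sets (lborel \<Otimes>\<^sub>M lborel)" unfolding lborel_prod by simp
  have TA: "?T -` A \<in> sets borel"
    using measurable_sets[OF T A] by simp
  have P: "Pair x -` A \<in> sets borel" for x
    using sets_Pair1[OF A', of x] by simp
  have m: "(\<lambda>x. emeasure lborel (Pair x -` A)) \<in> borel_measurable borel"
    using lborel.measurable_emeasure_Pair[of A lborel] A by (simp add: lborel_prod)
  have "emeasure (distr lborel lborel ?T) A = emeasure (lborel \<Otimes>\<^sub>M lborel) (?T -` A)"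
    using A T by (subst emeasure_distr) (auto simp: lborel_prod)
  also have "\<dots> = (\<integral>\<^sup>+x. emeasure lborel (Pair x -` (?T -` A)) \<partial>lborel)"
    by (rule lborel.emeasure_pair_measure_alt) (unfold lborel_prod, simp add: TA)
  also have "\<dots> = (\<integral>\<^sup>+x. emeasure lborel (Pair (a + x) -` A) \<partial>lborel)"
  proof (intro nn_integral_cong)
    fix x
    have "Pair x -` (?T -` A) = (\<lambda>t. l x + t) -` (Pair (a + x) -` A)" by auto
    then show "emeasure lborel (Pair x -` (?T -` A)) = emeasure lborel (Pair (a + x) -` A)"
      using emeasure_lborel_translate[OF P] by simp
  qed
  also have "\<dots> = (\<integral>\<^sup>+x. emeasure lborel (Pair x -` A) \<partial>(distr lborel borel (\<lambda>x. a + x)))"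
    using m by (subst nn_integral_distr) auto
  also have "\<dots> = emeasure (lborel \<Otimes>\<^sub>M lborel) A"
    unfolding lborel_distr_plus by (rule lborel.emeasure_pair_measure_alt[OF A', symmetric])
  finally show "emeasure (distr lborel lborel ?T) A = emeasure lborel A"
    by (simp add: lborel_prod)
qed simp

lemma coords_mult_left:
  "coords (p \<cdot> Heis z) = (hor p + fst z, (vert p + sympl (hor p) (fst z) / 2) + snd z)"
  by (cases z) (simp add: coords_eq)

lemma coords_mult_right:
  "coords (Heis z \<cdot> p) = (hor p + fst z, (vert p + sympl (fst z) (hor p) / 2) + snd z)"
  by (cases z) (simp add: coords_eq)

lemma lborel_distr_left: "distr lborel lborel (\<lambda>z. coords (p \<cdot> Heis z)) = lborel"
  unfolding coords_mult_left
  by (intro lborel_distr_shear continuous_intros sympl.continuous_on) auto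

lemma lborel_distr_right: "distr lborel lborel (\<lambda>z. coords (Heis z \<cdot> p)) = lborel"
  unfolding coords_mult_right
  by (intro lborel_distr_shear continuous_intros sympl.continuous_on) auto

lemma open_translate:
  assumes "open A" shows "open ((\<lambda>q. p \<cdot> q) ` A)" "open ((\<lambda>q. q \<cdot> p) ` A)"
proof -
  have c: "x \<cdot> p \<cdot> heis_inv p = x" "x \<cdot> heis_inv p \<cdot> p = x" for x by (simp_all add: heis_assoc)
  have l: "(\<lambda>q. p \<cdot> q) ` A = (\<lambda>q. heis_inv p \<cdot> q) -` A"
  proof (rule set_eqI)
    fix x show "x \<in> (\<lambda>q. p \<cdot> q) ` A \<longleftrightarrow> x \<in> (\<lambda>q. heis_inv p \<cdot> q) -` A"
      using inv_mult_cancel(2)[of p x] by (auto intro: image_eqI[of _ _ "heis_inv p \<cdot> x"])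
  qed
  show "open ((\<lambda>q. p \<cdot> q) ` A)"
    unfolding l by (intro open_vimage assms continuous_intros)
  have r: "(\<lambda>q. q \<cdot> p) ` A = (\<lambda>q. q \<cdot> heis_inv p) -` A"
  proof (rule set_eqI)
    fix x show "x \<in> (\<lambda>q. q \<cdot> p) ` A \<longleftrightarrow> x \<in> (\<lambda>q. q \<cdot> heis_inv p) -` A"
      using c(2)[of x] by (auto simp: c(1) intro: image_eqI[of _ _ "x \<cdot> heis_inv p"])
  qed
  show "open ((\<lambda>q. q \<cdot> p) ` A)"
    unfolding r by (intro open_vimage assms continuous_intros)
qed

definition hvol :: "'n::finite heis set \<Rightarrow> real" where
  "hvol A = measure lborel (coords ` A)"

lemma emeasure_shift:
  assumes d: "distr lborel lborel T = lborel" and "inj T" "T \<in> borel_measurable borel"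
    and "T ` B \<in> sets borel"
  shows "emeasure lborel (T ` B) = emeasure lborel B"
proof -
  have "emeasure lborel (T ` B) = emeasure (distr lborel lborel T) (T ` B)" by (simp add: d)
  also have "\<dots> = emeasure lborel (T -` (T ` B))"
    using assms by (subst emeasure_distr) auto
  finally show ?thesis using \<open>inj T\<close> by (simp add: inj_vimage_image_eq)
qed

lemma hvol_translate:
  assumes A: "open A"
  shows "hvol ((\<lambda>q. p \<cdot> q) ` A) = hvol A" "hvol ((\<lambda>q. q \<cdot> p) ` A) = hvol A"
proof -
  let ?L = "\<lambda>z. coords (p \<cdot> Heis z)" and ?R = "\<lambda>z. coords (Heis z \<cdot> p)"
  have inj: "inj ?L" "inj ?R"
    by (auto intro!: injI simp: coords_mult_left coords_mult_right prod_eq_iff)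
  have im: "coords ` (\<lambda>q. p \<cdot> q) ` A = ?L ` (coords ` A)" "coords ` (\<lambda>q. q \<cdot> p) ` A = ?R ` (coords ` A)"
    by (auto simp: image_image)
  have meas: "?L \<in> borel_measurable borel" "?R \<in> borel_measurable borel"
    by (intro borel_measurable_continuous_onI continuous_on_compose2[OF continuous_on_coords]
        continuous_intros continuous_on_Heis; auto)+
  have o: "coords ` (\<lambda>q. p \<cdot> q) ` A \<in> sets borel" "coords ` (\<lambda>q. q \<cdot> p) ` A \<in> sets borel"
    using open_translate[OF A] by (auto simp: open_coords_image)
  show "hvol ((\<lambda>q. p \<cdot> q) ` A) = hvol A" "hvol ((\<lambda>q. q \<cdot> p) ` A) = hvol A"
    using emeasure_shift[OF lborel_distr_left inj(1) meas(1)] o(1)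
      emeasure_shift[OF lborel_distr_right inj(2) meas(2)] o(2)
    by (simp_all add: hvol_def measure_def im)
qed

lemma ball_heis_translate: "ball (p :: 'n::finite heis) r = (\<lambda>q. p \<cdot> q) ` ball (Heis (0, 0)) r"
proof (rule set_eqI)
  fix x
  have "dist p x = dist (Heis (0,0)) (heis_inv p \<cdot> x)"
    using dist_left[of p "Heis (0,0)" "heis_inv p \<cdot> x"] by simp
  then show "x \<in> ball p r \<longleftrightarrow> x \<in> (\<lambda>q. p \<cdot> q) ` ball (Heis (0, 0)) r"
    by (metis (no_types, lifting) image_iff inv_mult_cancel mem_ball)
qed

lemma measure_cube_interval:
  fixes \<rho> \<tau> :: real
  assumes "0 \<le> \<rho>" "0 \<le> \<tau>"
  shows "measure lborel (cbox (- (\<rho> *\<^sub>R One)) (\<rho> *\<^sub>R One :: 'a::euclidean_space) \<times> cbox (- \<tau>) \<tau>)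
    = (2 * \<rho>) ^ DIM('a) * (2 * \<tau>)"
proof -
  have b: "(\<rho> *\<^sub>R One :: 'a) \<bullet> i = \<rho>" if "i \<in> Basis" for i
    using that by (simp add: inner_sum_left_Basis)
  have "measure lborel (cbox (- (\<rho> *\<^sub>R One), - \<tau>) (\<rho> *\<^sub>R One :: 'a, \<tau>))
      = (\<Prod>i\<in>Basis. ((\<rho> *\<^sub>R One :: 'a, \<tau>) - (- (\<rho> *\<^sub>R One), - \<tau>)) \<bullet> i)"
    by (rule measure_lborel_cbox) (auto simp: Basis_prod_def b assms)
  also have "\<dots> = (\<Prod>i\<in>(Basis :: 'a set). 2 * \<rho>) * (2 * \<tau>)"
    unfolding Basis_prod_def
    by (subst prod.union_disjoint)
      (auto simp: prod.reindex inj_on_def b inner_diff_left inner_add_left simp del: inner_scaleR_left prod_constant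
        intro!: prod.cong)
  finally show ?thesis by (simp add: cbox_Pair_eq)
qed

text \<open>Balls contain and are contained in boxes with horizontal sides comparable to \<open>r\<close> and vertical
  side comparable to \<open>r\<^sup>2\<close>; hence the homogeneous dimension \<open>2n + 2\<close>.\<close>

lemma ball_volume:
  obtains c1 c2 where "c1 > 0" "c2 > 0"
    "\<And>(p :: 'n::finite heis) r. 0 < r \<Longrightarrow> c1 * r ^ (2 * CARD('n) + 2) \<le> hvol (ball p r)"
    "\<And>(p :: 'n heis) r. 0 < r \<Longrightarrow> hvol (ball p r) \<le> c2 * r ^ (2 * CARD('n) + 2)"
proof -
  define D where "D = DIM(real ^ ('n + 'n))"
  have D: "D = 2 * CARD('n)" "0 < D" by (simp_all add: D_def)
  let ?Q = "\<lambda>\<rho> \<tau>. cbox (- (\<rho> *\<^sub>R One)) (\<rho> *\<^sub>R One :: real ^ ('n + 'n)) \<times> cbox (- \<tau>) (\<tau> :: real)"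
  have inQ: "(x, t) \<in> ?Q \<rho> \<tau> \<longleftrightarrow> (\<forall>i\<in>Basis. \<bar>x \<bullet> i\<bar> \<le> \<rho>) \<and> \<bar>t\<bar> \<le> \<tau>" for x t \<rho> \<tau>
  proof -
    have b: "(\<rho> *\<^sub>R One :: real ^ ('n + 'n)) \<bullet> i = \<rho>" if "i \<in> Basis" for i
      using that by (simp add: inner_sum_left_Basis)
    show ?thesis by (force simp: mem_box b abs_le_iff)
  qed
  have fin: "?Q \<rho> \<tau> \<in> fmeasurable lborel" for \<rho> \<tau>
    unfolding cbox_Pair_eq[symmetric] by (rule fmeasurable_cbox)
  have Q: "0 \<le> \<rho> \<Longrightarrow> 0 \<le> \<tau> \<Longrightarrow> measure lborel (?Q \<rho> \<tau>) = (2 * \<rho>) ^ D * (2 * \<tau>)" for \<rho> \<tau>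
    unfolding D_def by (rule measure_cube_interval)
  have vol: "hvol (ball p r) = hvol (ball (Heis (0,0) :: 'n heis) r)" for p :: "'n heis" and r
    by (subst ball_heis_translate) (simp add: hvol_translate)
  have meas: "coords ` ball (Heis (0,0) :: 'n heis) r \<in> sets lborel" for r
    by (simp add: open_coords_image)
  have up: "coords ` ball (Heis (0,0) :: 'n heis) r \<subseteq> ?Q r (r\<^sup>2)" if "0 < r" for r
  proof (rule image_subsetI)
    fix q :: "'n heis" assume "q \<in> ball (Heis (0,0)) r"
    then have n: "heis_norm q < r" by (simp add: dist_heis heis_inv_def)
    then have "\<bar>hor q \<bullet> i\<bar> \<le> r" if "i \<in> Basis" for i
      using that norm_hor_le[of q] Basis_le_norm[of i "hor q"] by linarith
    moreover have "(heis_norm q)\<^sup>2 \<le> r\<^sup>2"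
      using n heis_norm_nonneg[of q] by (intro power_mono) auto
    then have "\<bar>vert q\<bar> \<le> r\<^sup>2" using vert_le[of q] zero_le_power2[of "heis_norm q"] by linarith
    ultimately show "coords q \<in> ?Q r (r\<^sup>2)" by (simp only: coords_eq inQ) blast
  qed
  have lo: "?Q (r / (4 * D)) (r\<^sup>2 / 64) \<subseteq> coords ` ball (Heis (0,0) :: 'n heis) r" if r: "0 < r" for r
  proof
    fix z assume z: "z \<in> ?Q (r / (4 * D)) (r\<^sup>2 / 64)"
    obtain x t where zxt: "z = (x, t)" by force
    have "norm x \<le> (\<Sum>i\<in>Basis. \<bar>x \<bullet> i\<bar>)" by (rule norm_le_l1)
    also have "\<dots> \<le> (\<Sum>i\<in>(Basis :: (real ^ ('n + 'n)) set). r / (4 * D))"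
      using z unfolding zxt inQ by (intro sum_mono) auto
    also have "\<dots> = r / 4" using D by (simp add: D_def[symmetric])
    finally have "norm x \<le> r / 4" .
    moreover have "sqrt \<bar>t\<bar> \<le> sqrt (r\<^sup>2 / 64)"
      using z unfolding zxt inQ by (intro real_sqrt_le_mono) auto
    then have "sqrt \<bar>t\<bar> \<le> r / 8" using r by (simp add: real_sqrt_divide)
    ultimately have "heis_norm (Heis (x, t)) < r"
      using heis_norm_le[of "Heis (x, t)"] r by simp
    then show "z \<in> coords ` ball (Heis (0,0) :: 'n heis) r"
      unfolding zxt by (intro image_eqI[of _ _ "Heis (x, t)"]) (auto simp: dist_heis heis_inv_def)
  qed
  show thesis
  proof (rule that[of "(1 / (2 * D)) ^ D / 32" "2 ^ D * 2"])
    fix p :: "'n heis" and r :: real assume r: "0 < r"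
    have "(2 * (r / (4 * D))) ^ D * (2 * (r\<^sup>2 / 64)) \<le> hvol (ball p r)"
      using measure_mono_fmeasurable[OF lo[OF r] fmeasurableD[OF fin] fmeasurableI2[OF fin up[OF r] meas]]
        Q[of "r / (4 * D)" "r\<^sup>2 / 64"] r
      by (simp only: vol[of p] hvol_def[of "ball (Heis (0,0)) r"]) simp
    then show "(1 / (2 * D)) ^ D / 32 * r ^ (2 * CARD('n) + 2) \<le> hvol (ball p r)"
      unfolding D(1)[symmetric] by (simp add: power_add power_divide power_mult_distrib field_simps power2_eq_square)
    have "hvol (ball p r) \<le> (2 * r) ^ D * (2 * r\<^sup>2)"
      using measure_mono_fmeasurable[OF up[OF r] meas fin] Q[of r "r\<^sup>2"] r
      by (simp only: vol[of p] hvol_def[of "ball (Heis (0,0)) r"]) simp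
    then show "hvol (ball p r) \<le> 2 ^ D * 2 * r ^ (2 * CARD('n) + 2)"
      unfolding D(1)[symmetric] by (simp add: power_add power_mult_distrib mult_ac power2_eq_square)
  qed (use D in auto)
qed

lemma fmeasurable_ball: "coords ` ball p r \<in> fmeasurable lborel"
proof (rule fmeasurableI2)
  show "cbox (hor p - r *\<^sub>R One) (hor p + r *\<^sub>R One) \<times> cbox (vert p - (r\<^sup>2 + norm (hor p) * r)) (vert p + (r\<^sup>2 + norm (hor p) * r)) \<in> fmeasurable lborel"
    unfolding cbox_Pair_eq[symmetric] by (rule fmeasurable_cbox)
  have b: "(r *\<^sub>R One :: real ^ ('a + 'a)) \<bullet> i = r" if "i \<in> Basis" for i
    using that by (simp add: inner_sum_left_Basis)
  have "cball (hor p) r \<subseteq> cbox (hor p - r *\<^sub>R One) (hor p + r *\<^sub>R One)"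
  proof
    fix x assume "x \<in> cball (hor p) r"
    then have "\<bar>(x - hor p) \<bullet> i\<bar> \<le> r" if "i \<in> Basis" for i
      using Basis_le_norm[OF that, of "x - hor p"] by (simp add: dist_norm norm_minus_commute)
    then show "x \<in> cbox (hor p - r *\<^sub>R One) (hor p + r *\<^sub>R One)"
      unfolding mem_box inner_diff_left inner_add_left abs_le_iff using b by fastforce
  qed
  moreover have "cball (vert p) s \<subseteq> cbox (vert p - s) (vert p + s)" for s
    by (auto simp: dist_real_def abs_le_iff)
  ultimately show "coords ` ball p r \<subseteq> cbox (hor p - r *\<^sub>R One) (hor p + r *\<^sub>R One) \<times> cbox (vert p - (r\<^sup>2 + norm (hor p) * r)) (vert p + (r\<^sup>2 + norm (hor p) * r))"
    using bounded_heis_subset_box[of p r] by (meson Sigma_mono order_trans)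
qed (simp add: open_coords_image)

lemma packing:
  assumes fin: "finite I" and o: "\<And>i. i \<in> I \<Longrightarrow> open (A i)"
    and dis: "\<And>i j. i \<in> I \<Longrightarrow> j \<in> I \<Longrightarrow> i \<noteq> j \<Longrightarrow> A i \<inter> A j = {}"
    and sub: "\<And>i. i \<in> I \<Longrightarrow> A i \<subseteq> ball p R"
    and v: "\<And>i. i \<in> I \<Longrightarrow> v \<le> hvol (A i)"
  shows "real (card I) * v \<le> hvol (ball p R)"
proof -
  have fm: "coords ` A i \<in> fmeasurable lborel" if "i \<in> I" for i
    by (rule fmeasurableI2[OF fmeasurable_ball[of p R]]) (use sub[OF that] o[OF that] in \<open>auto simp: open_coords_image\<close>)
  have "real (card I) * v \<le> (\<Sum>i\<in>I. hvol (A i))"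
    using sum_mono[of I "\<lambda>_. v" "\<lambda>i. hvol (A i)"] v by simp
  also have "\<dots> = measure lborel (\<Union>i\<in>I. coords ` A i)"
    unfolding hvol_def
  proof (rule measure_finite_Union[symmetric])
    show "disjoint_family_on (\<lambda>i. coords ` A i) I"
      unfolding disjoint_family_on_def using dis
      by (auto simp: coords_inject) blast
  qed (use fin o fmeasurableD2[OF fm] in \<open>auto simp: open_coords_image\<close>)
  also have "\<dots> \<le> hvol (ball p R)"
    unfolding hvol_def
  proof (rule measure_mono_fmeasurable[OF _ _ fmeasurable_ball])
    show "(\<Union>i\<in>I. coords ` A i) \<subseteq> coords ` ball p R" using sub by blast
    show "(\<Union>i\<in>I. coords ` A i) \<in> sets lborel"
      unfolding sets_lborel by (intro borel_open open_UN ballI) (simp add: o open_coords_image)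
  qed
  finally show ?thesis .
qed

text \<open>The Heisenberg metric is doubling.\<close>

lemma separated_card_le:
  obtains N :: nat where "0 < N"
    "\<And>(X :: 'n::finite heis set) z r. finite X \<Longrightarrow> 0 < r \<Longrightarrow>
       (\<And>x y. x \<in> X \<Longrightarrow> y \<in> X \<Longrightarrow> x \<noteq> y \<Longrightarrow> r \<le> dist x y) \<Longrightarrow>
       (\<And>x. x \<in> X \<Longrightarrow> dist z x < 2 * r) \<Longrightarrow> card X \<le> N"
proof -
  obtain c1 c2 where c: "c1 > 0" "c2 > 0"
    "\<And>(p :: 'n heis) r. 0 < r \<Longrightarrow> c1 * r ^ (2 * CARD('n) + 2) \<le> hvol (ball p r)"
    "\<And>(p :: 'n heis) r. 0 < r \<Longrightarrow> hvol (ball p r) \<le> c2 * r ^ (2 * CARD('n) + 2)"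
    using ball_volume by blast
  let ?d = "2 * CARD('n) + 2"
  let ?N = "nat \<lceil>c2 / c1 * 6 ^ ?d\<rceil> + 1"
  show thesis
  proof (rule that[of ?N])
    fix X :: "'n heis set" and z and r :: real
    assume X: "finite X" and r: "0 < r"
      and sep: "\<And>x y. x \<in> X \<Longrightarrow> y \<in> X \<Longrightarrow> x \<noteq> y \<Longrightarrow> r \<le> dist x y"
      and zX: "\<And>x. x \<in> X \<Longrightarrow> dist z x < 2 * r"
    have "real (card X) * (c1 * (r / 2) ^ ?d) \<le> hvol (ball z (3 * r))"
    proof (rule packing[OF X])
      fix x y assume xy: "x \<in> X" "y \<in> X" "x \<noteq> y"
      show "ball x (r / 2) \<inter> ball y (r / 2) = {}"
        using sep[OF xy] disjoint_ballI[of "r/2" "r/2" x y] by simp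
    next
      fix x assume x: "x \<in> X"
      show "ball x (r / 2) \<subseteq> ball z (3 * r)"
      proof
        fix y assume "y \<in> ball x (r / 2)"
        then show "y \<in> ball z (3 * r)"
          using dist_triangle[of z y x] zX[OF x] r by (simp add: dist_commute)
      qed
      show "c1 * (r / 2) ^ ?d \<le> hvol (ball x (r / 2))" by (rule c(3)) (use r in simp)
    qed simp
    also have "\<dots> \<le> c2 * (3 * r) ^ ?d" by (rule c(4)) (use r in simp)
    also have "\<dots> = (c2 / c1 * 6 ^ ?d) * (c1 * (r / 2) ^ ?d)"
    proof -
      have "3 * r = 6 * (r / 2)" by simp
      then have "(3 * r) ^ ?d = 6 ^ ?d * (r / 2) ^ ?d" by (metis power_mult_distrib)
      moreover have "c2 * (a * b) = c2 / c1 * a * (c1 * b)" for a b using c(1) by simp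
      ultimately show ?thesis by metis
    qed
    finally have "real (card X) \<le> c2 / c1 * 6 ^ ?d"
      using c(1) r by (subst (asm) mult_le_cancel_right) auto
    then show "card X \<le> ?N" by linarith
  qed simp
qed


section \<open>Smooth bump functions\<close>

lemma Ck_SucI:
  assumes "\<And>x. (f has_derivative f' x) (at x)" "\<And>v. Ck k (\<lambda>x. f' x v)"
  shows "Ck (Suc k) f"
proof -
  have "frechet_derivative f (at x) = f' x" for x
    by (rule frechet_derivative_at[OF assms(1), symmetric])
  then show ?thesis
    using assms by (auto simp: differentiable_def)
qed

lemma Ck_SucD:
  assumes "Ck (Suc k) f"
  shows "(f has_derivative frechet_derivative f (at x)) (at x)"
    and "Ck k (\<lambda>x. frechet_derivative f (at x) v)"
  using assms by (auto simp flip: frechet_derivative_works)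

lemma Ck_Suc_imp: "Ck (Suc k) f \<Longrightarrow> Ck k f"
proof (induction k arbitrary: f)
  case 0
  then show ?case
    by (auto intro!: continuous_at_imp_continuous_on differentiable_imp_continuous_within)
next
  case (Suc k)
  then show ?case by simp
qed

lemma Ck_const: "Ck k (\<lambda>x. c)"
proof (induction k arbitrary: c)
  case (Suc k)
  show ?case by (rule Ck_SucI[where f' = "\<lambda>_ _. 0"]) (auto intro: Suc.IH)
qed simp

lemma Ck_affine: "Ck k (\<lambda>x. x \<bullet> u + c)"
proof (cases k)
  case (Suc l)
  show ?thesis unfolding Suc
    by (rule Ck_SucI[where f' = "\<lambda>_ v. v \<bullet> u"]) (auto intro!: derivative_eq_intros Ck_const)
qed (auto intro!: continuous_intros)

lemma Ck_add: "Ck k f \<Longrightarrow> Ck k g \<Longrightarrow> Ck k (\<lambda>x. f x + g x)"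
proof (induction k arbitrary: f g)
  case (Suc k)
  show ?case
    by (rule Ck_SucI[OF has_derivative_add[OF Ck_SucD(1)[OF Suc.prems(1)] Ck_SucD(1)[OF Suc.prems(2)]]])
      (intro Suc.IH Ck_SucD(2) Suc.prems)
qed (auto intro!: continuous_intros)

lemma Ck_mult: "Ck k f \<Longrightarrow> Ck k g \<Longrightarrow> Ck k (\<lambda>x. f x * g x)"
proof (induction k arbitrary: f g)
  case (Suc k)
  show ?case
    by (rule Ck_SucI[OF has_derivative_mult[OF Ck_SucD(1)[OF Suc.prems(1)] Ck_SucD(1)[OF Suc.prems(2)]]])
      (intro Ck_add Suc.IH Ck_SucD(2) Suc.prems Ck_Suc_imp)
qed (auto intro!: continuous_intros)

lemma Ck_compose_affine:
  fixes f :: "'a::euclidean_space \<Rightarrow> real" and A :: "'b::euclidean_space \<Rightarrow> 'a"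
  assumes "bounded_linear A"
  shows "Ck k f \<Longrightarrow> Ck k (\<lambda>x. f (A x + c))"
proof (induction k arbitrary: f)
  case 0
  then show ?case
    by (auto intro!: continuous_on_compose2[of UNIV f] continuous_intros bounded_linear.continuous_on[OF assms])
next
  case (Suc k)
  have "((\<lambda>x. f (A x + c)) has_derivative (\<lambda>v. frechet_derivative f (at (A x + c)) (A v))) (at x)" for x
    by (rule has_derivative_compose[OF _ Ck_SucD(1)[OF Suc.prems]])
      (auto intro!: derivative_eq_intros bounded_linear_imp_has_derivative assms)
  then show ?case
    by (rule Ck_SucI) (rule Suc.IH, rule Ck_SucD(2)[OF Suc.prems])
qed

text \<open>The case \<open>m = 0\<close> is the standard smooth function that is flat at the origin. The derivative of each member
  of the family is a combination of two others, so that smoothness follows by induction over the order of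
  differentiation, simultaneously for all \<open>m\<close>.\<close>

definition flat_exp :: "nat \<Rightarrow> real \<Rightarrow> real" where
  "flat_exp m x = (if 0 < x then exp (- inverse x) * inverse x ^ m else 0)"

lemma flat_exp_tendsto_0: "(flat_exp m \<longlongrightarrow> 0) (at_right 0)"
proof -
  have "((\<lambda>x::real. inverse x ^ m / exp (inverse x)) \<longlongrightarrow> 0) (at_right 0)"
    by (rule filterlim_compose[OF tendsto_power_div_exp_0 filterlim_inverse_at_top_right])
  then show ?thesis
    by (rule tendsto_cong[THEN iffD1, rotated])
      (auto simp: flat_exp_def exp_minus field_simps eventually_at_filter)
qed

lemma flat_exp_deriv:
  "(flat_exp m has_real_derivative - real m * flat_exp (Suc m) x + flat_exp (Suc (Suc m)) x) (at x)"
proof -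
  consider "x < 0" | "x = 0" | "0 < x" by linarith
  then show ?thesis
  proof cases
    case 1
    have "((\<lambda>_. 0) has_real_derivative (- real m * flat_exp (Suc m) x + flat_exp (Suc (Suc m)) x)) (at x)"
      using 1 by (simp add: flat_exp_def)
    then show ?thesis
      by (rule has_field_derivative_transform_within_open[where S = "{..<0}"])
        (use 1 in \<open>auto simp: flat_exp_def\<close>)
  next
    case 3
    have "((\<lambda>x. exp (- inverse x) * inverse x ^ m) has_real_derivative
        - real m * flat_exp (Suc m) x + flat_exp (Suc (Suc m)) x) (at x)"
    proof (cases m)
      case 0
      then show ?thesis
        using 3 by (auto intro!: derivative_eq_intros simp: flat_exp_def algebra_simps power2_eq_square)
    next
      case (Suc k)
      have i: "(inverse has_real_derivative - (inverse x ^ Suc (Suc 0))) (at x)"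
        by (rule DERIV_inverse) (use 3 in simp)
      have "((\<lambda>x. exp (- inverse x)) has_real_derivative exp (- inverse x) * inverse x ^ 2) (at x)"
        using 3 by (auto intro!: derivative_eq_intros simp: power2_eq_square)
      from DERIV_mult[OF this DERIV_power_Suc[OF i, of k]] show ?thesis
        unfolding Suc by (rule DERIV_cong) (use 3 in \<open>simp add: flat_exp_def algebra_simps power2_eq_square\<close>)
    qed
    then show ?thesis
      by (rule has_field_derivative_transform_within_open[where S = "{0<..}"])
        (use 3 in \<open>auto simp: flat_exp_def\<close>)
  next
    case 2
    have "((\<lambda>h. flat_exp m h / h) \<longlongrightarrow> 0) (at 0)"
    proof (rule filterlim_split_at)
      show "((\<lambda>h. flat_exp m h / h) \<longlongrightarrow> 0) (at_left 0)"
        by (rule tendsto_eventually) (auto simp: flat_exp_def eventually_at_filter)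
      show "((\<lambda>h. flat_exp m h / h) \<longlongrightarrow> 0) (at_right 0)"
        by (rule tendsto_cong[THEN iffD1, OF _ flat_exp_tendsto_0[of "Suc m"]])
          (auto simp: flat_exp_def eventually_at_filter field_simps)
    qed
    then show ?thesis
      using 2 by (simp add: DERIV_def flat_exp_def)
  qed
qed

definition bump :: "'a::euclidean_space \<Rightarrow> real \<Rightarrow> 'a \<Rightarrow> real" where
  "bump z0 \<rho> z = flat_exp 0 (\<rho>\<^sup>2 - (z - z0) \<bullet> (z - z0))"

lemma Ck_bump: "Ck k (bump z0 \<rho>)"
proof -
  have "Ck k (\<lambda>z. flat_exp m (\<rho>\<^sup>2 - (z - z0) \<bullet> (z - z0)))" for m
  proof (induction k arbitrary: m)
    case 0
    have "continuous_on UNIV (flat_exp m)"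
      using flat_exp_deriv DERIV_isCont by (intro continuous_at_imp_continuous_on) blast
    then show ?case
      by (auto intro!: continuous_on_compose2[of UNIV "flat_exp m"] continuous_intros)
  next
    case (Suc k)
    let ?Q = "\<lambda>z. \<rho>\<^sup>2 - (z - z0) \<bullet> (z - z0)"
    have D: "((\<lambda>z. flat_exp m (?Q z)) has_derivative
        (\<lambda>v. (- real m * flat_exp (Suc m) (?Q z) + flat_exp (Suc (Suc m)) (?Q z)) * ((-2) * (z \<bullet> v + - (z0 \<bullet> v)))))
        (at z)" for z
    proof (rule has_derivative_compose[of ?Q _ z UNIV "flat_exp m", THEN has_derivative_eq_rhs])
      show "(?Q has_derivative (\<lambda>v. - ((z - z0) \<bullet> v + v \<bullet> (z - z0)))) (at z)"
        by (auto intro!: derivative_eq_intros)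
      show "(flat_exp m has_derivative (*) (- real m * flat_exp (Suc m) (?Q z) + flat_exp (Suc (Suc m)) (?Q z))) (at (?Q z))"
        using flat_exp_deriv by (simp add: has_field_derivative_def)
    qed (auto simp: inner_diff_left inner_diff_right inner_commute algebra_simps)
    show ?case
      by (rule Ck_SucI[OF D]) (intro Ck_mult Ck_add Ck_const Suc.IH Ck_affine)
  qed
  then show ?thesis by (simp add: bump_def[abs_def])
qed

lemma bump_nonneg: "0 \<le> bump z0 \<rho> z"
  by (simp add: bump_def flat_exp_def)

lemma bump_pos_iff: "0 < \<rho> \<Longrightarrow> bump z0 \<rho> z \<noteq> 0 \<longleftrightarrow> dist z0 z < \<rho>"
proof -
  assume "0 < \<rho>"
  have "(z - z0) \<bullet> (z - z0) = (dist z0 z)\<^sup>2"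
    by (simp add: dist_norm power2_norm_eq_inner norm_minus_commute)
  moreover have "(dist z0 z)\<^sup>2 < \<rho>\<^sup>2 \<longleftrightarrow> dist z0 z < \<rho>"
    using abs_le_square_iff[of \<rho> "dist z0 z"] \<open>0 < \<rho>\<close> by (simp add: not_le[symmetric])
  ultimately show ?thesis by (simp add: bump_def flat_exp_def)
qed

lemma continuous_bump: "continuous_on A (bump z0 \<rho>)"
  using Ck_bump[of 0 z0 \<rho>] by (auto intro: continuous_on_subset)

lemma integrable_compact_support:
  fixes h :: "'a::euclidean_space \<Rightarrow> real"
  assumes "continuous_on UNIV h" "compact K" "\<And>z. z \<notin> K \<Longrightarrow> h z = 0"
  shows "integrable lborel h"
proof -
  have "integrable lborel (\<lambda>z. indicator K z *\<^sub>R h z)"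
    using assms by (intro borel_integrable_compact) (auto intro: continuous_on_subset)
  moreover have "(\<lambda>z. indicator K z *\<^sub>R h z) = h"
    using assms(3) by (auto simp: indicator_def fun_eq_iff)
  ultimately show ?thesis by simp
qed

lemma integrable_mult_bump:
  assumes "continuous_on UNIV h" "0 < \<rho>"
  shows "integrable lborel (\<lambda>z. h z * bump z0 \<rho> z)"
  using bump_pos_iff[OF assms(2), of z0]
  by (intro integrable_compact_support[of _ "cball z0 \<rho>"] continuous_intros continuous_bump assms) force+

lemma integral_bump_pos: "0 < \<rho> \<Longrightarrow> 0 < (\<integral>z. bump z0 \<rho> z \<partial>lborel)"
proof -
  assume \<rho>: "0 < \<rho>"
  have i: "integrable lborel (bump z0 \<rho>)"
    using integrable_mult_bump[of "\<lambda>_. 1"] \<rho> by simp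
  have "(\<integral>z. bump z0 \<rho> z \<partial>lborel) \<noteq> 0"
  proof
    assume "(\<integral>z. bump z0 \<rho> z \<partial>lborel) = 0"
    then have "AE z in lborel. bump z0 \<rho> z = 0"
      using integral_nonneg_eq_0_iff_AE[OF i] by (simp add: bump_nonneg)
    then have "AE z in lborel. z \<notin> ball z0 \<rho>"
      by eventually_elim (use bump_pos_iff[OF \<rho>, of z0] in force)
    then have "ball z0 \<rho> \<in> null_sets lborel"
      by (subst (asm) AE_iff_null_sets[symmetric]) auto
    then have "negligible (ball z0 \<rho>)"
      using negligible_iff_null_sets null_sets_completionI by blast
    then show False
      using \<rho> open_not_negligible[of "ball z0 \<rho>"] by simp
  qed
  then show ?thesis
    using Bochner_Integration.integral_nonneg[of lborel "bump z0 \<rho>"] bump_nonneg by fastforce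
qed

text \<open>Averages against bumps that shrink to a point recover the value of a continuous function.\<close>

lemma bump_average_bound:
  assumes P: "continuous_on UNIV P" and \<rho>1: "0 < \<rho>1"
    and bd: "\<And>\<rho>. 0 < \<rho> \<Longrightarrow> \<rho> \<le> \<rho>1 \<Longrightarrow>
      \<bar>\<integral>z. P z * bump z0 \<rho> z \<partial>lborel\<bar> \<le> c * (\<integral>z. bump z0 \<rho> z \<partial>lborel)"
  shows "\<bar>P z0\<bar> \<le> c"
proof (rule ccontr)
  assume "\<not> \<bar>P z0\<bar> \<le> c"
  then obtain d where d: "c < d" "d < \<bar>P z0\<bar>" using dense[of c "\<bar>P z0\<bar>"] by auto
  define \<sigma> where "\<sigma> = sgn (P z0)"
  have "continuous_on UNIV (\<lambda>z. \<sigma> * P z)" by (intro continuous_intros P)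
  moreover have "d < \<sigma> * P z0" using d(2) by (simp add: \<sigma>_def abs_sgn mult.commute)
  ultimately have "open {z. d < \<sigma> * P z}" "z0 \<in> {z. d < \<sigma> * P z}"
    by (auto intro!: open_Collect_less continuous_intros)
  then obtain \<rho>2 where \<rho>2: "\<rho>2 > 0" "ball z0 \<rho>2 \<subseteq> {z. d < \<sigma> * P z}"
    by (metis open_contains_ball)
  define \<rho> where "\<rho> = min \<rho>1 \<rho>2"
  have \<rho>: "0 < \<rho>" "\<rho> \<le> \<rho>1" using \<rho>1 \<rho>2 by (auto simp: \<rho>_def)
  have "d * bump z0 \<rho> z \<le> \<sigma> * P z * bump z0 \<rho> z" for z
  proof (cases "dist z0 z < \<rho>")
    case True
    then have "d \<le> \<sigma> * P z" using \<rho>2(2) by (force simp: \<rho>_def)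
    then show ?thesis by (intro mult_right_mono bump_nonneg)
  next
    case False
    then have "bump z0 \<rho> z = 0" using bump_pos_iff[OF \<rho>(1), of z0 z] by blast
    then show ?thesis by simp
  qed
  then have "(\<integral>z. d * bump z0 \<rho> z \<partial>lborel) \<le> (\<integral>z. \<sigma> * P z * bump z0 \<rho> z \<partial>lborel)"
    by (intro integral_mono integrable_mult_bump continuous_intros P \<rho>)
  also have "\<dots> = \<sigma> * (\<integral>z. P z * bump z0 \<rho> z \<partial>lborel)"
    by (simp add: mult.assoc)
  also have "\<dots> \<le> \<bar>\<integral>z. P z * bump z0 \<rho> z \<partial>lborel\<bar>"
    by (auto simp: \<sigma>_def sgn_if)
  also have "\<dots> \<le> c * (\<integral>z. bump z0 \<rho> z \<partial>lborel)" by (rule bd[OF \<rho>])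
  finally have "d * (\<integral>z. bump z0 \<rho> z \<partial>lborel) \<le> c * (\<integral>z. bump z0 \<rho> z \<partial>lborel)"
    by simp
  then show False
    using d(1) integral_bump_pos[OF \<rho>(1), of z0] by simp
qed


section \<open>Derivatives along horizontal lines\<close>

text \<open>The coordinate expression at \<open>z\<close> of the left-invariant horizontal field with value \<open>v\<close> at the origin. Its flow is
  right multiplication by \<open>hexp (s v)\<close>, which is affine in coordinates.\<close>

definition hdir :: "real ^ ('n::finite + 'n) \<Rightarrow> (real ^ ('n + 'n)) \<times> real \<Rightarrow> (real ^ ('n + 'n)) \<times> real" where
  "hdir v z = (v, sympl (fst z) v / 2)"

lemma coords_hexp: "coords (Heis z \<cdot> hexp (s *\<^sub>R v)) = z + s *\<^sub>R hdir v z"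
  by (cases z) (simp add: coords_mult_right hdir_def sympl_simps)

lemma sum_UNIV_Plus:
  fixes g :: "'n::finite + 'n \<Rightarrow> 'a::comm_monoid_add"
  shows "sum g UNIV = (\<Sum>i\<in>UNIV. g (Inl i)) + (\<Sum>i\<in>UNIV. g (Inr i))"
  using sum.Plus[of UNIV UNIV g] by simp

lemma X_field_sum:
  fixes \<phi> :: "(real ^ ('n::finite + 'n)) \<times> real \<Rightarrow> real"
  assumes D: "(\<phi> has_derivative D) (at z)"
  shows "(\<Sum>j\<in>UNIV. v $ j * X_field j (\<lambda>p. \<phi> (coords p)) (Heis z)) = D (hdir v z)"
proof -
  interpret D: bounded_linear D using D by (rule has_derivative_bounded_linear)
  have fd: "frechet_derivative \<phi> (at z) = D"
    by (rule frechet_derivative_at[OF D, symmetric])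
  have fd': "frechet_derivative (\<lambda>z. \<phi> z) (at z) = D" using fd by simp
  have "hdir v z = (\<Sum>j\<in>UNIV. v $ j *\<^sub>R (axis j 1, 0)) + (sympl (fst z) v / 2) *\<^sub>R (0, 1)"
    by (auto simp: hdir_def prod_eq_iff fst_sum snd_sum vec_eq_iff sum_component axis_def if_distrib[of "\<lambda>x. _ * x"]
        cong: if_cong)
  then have "D (hdir v z) = (\<Sum>j\<in>UNIV. v $ j * D (axis j 1, 0)) + sympl (fst z) v / 2 * D (0, 1)"
    by (simp add: D.add D.sum D.scaleR del: scaleR_Pair)
  also have "\<dots> = (\<Sum>j\<in>UNIV. v $ j * X_field j (\<lambda>p. \<phi> (coords p)) (Heis z))"
    unfolding sum_UNIV_Plus
    by (simp add: partial_x_def partial_t_def fd' sympl_def hor_def algebra_simps sum.distrib sum_subtractf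
        sum_distrib_left sum_distrib_right sum_divide_distrib diff_divide_distrib)
  finally show ?thesis by simp
qed

lemma derivative_zero_outside:
  fixes \<phi> :: "'a::euclidean_space \<Rightarrow> real"
  assumes D: "(\<phi> has_derivative D) (at z)" and K: "closed K" "\<And>z. z \<notin> K \<Longrightarrow> \<phi> z = 0" and "z \<notin> K"
  shows "D v = 0"
proof -
  have "((\<lambda>_. 0) has_derivative D) (at z)"
    by (rule has_derivative_transform_within_open[OF D, of "- K"]) (use K \<open>z \<notin> K\<close> in \<open>auto simp: open_Compl\<close>)
  then have "D = (\<lambda>_. 0)"
    by (rule has_derivative_unique) simp
  then show ?thesis by simp
qed

text \<open>The weak identity tested in one direction, with \<open>f\<close> and its gradient replaced by
  continuous functions on the whole space that agree with them on the support.\<close>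

lemma weak_identity:
  fixes f :: "'n::finite heis \<Rightarrow> real" and G :: "(real ^ ('n + 'n)) \<times> real \<Rightarrow> real ^ ('n + 'n)"
  assumes weak: "weak_hgrad U f g"
    and K: "compact K" "Heis ` K \<subseteq> U"
    and F: "continuous_on UNIV F" "\<And>z. z \<in> K \<Longrightarrow> F z = f (Heis z)"
    and G: "continuous_on UNIV G" "\<And>z. z \<in> K \<Longrightarrow> G z = g (Heis z)"
    and \<phi>: "\<And>k. Ck k \<phi>" "\<And>z. z \<notin> K \<Longrightarrow> \<phi> z = 0"
  shows "(\<integral>z. F z * frechet_derivative \<phi> (at z) (hdir v z) \<partial>lborel) = - (\<integral>z. (G z \<bullet> v) * \<phi> z \<partial>lborel)"
proof -
  have clK: "closed K" using K compact_imp_closed by blast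
  have D: "(\<phi> has_derivative frechet_derivative \<phi> (at z)) (at z)" for z
    using Ck_SucD(1)[OF \<phi>(1)[of "Suc 0"]] .
  have contD: "continuous_on UNIV (\<lambda>z. frechet_derivative \<phi> (at z) w)" for w
    using Ck_SucD(2)[OF \<phi>(1)[of "Suc 0"]] by simp
  have D0: "frechet_derivative \<phi> (at z) w = 0" if "z \<notin> K" for z w
    by (rule derivative_zero_outside[OF D clK \<phi>(2) that])
  have cont\<phi>: "continuous_on UNIV \<phi>" using \<phi>(1)[of 0] by simp
  let ?\<psi> = "\<lambda>p. \<phi> (coords p)"
  have tf: "test_function U ?\<psi>"
  proof -
    have "compact (Heis ` K)" by (intro compact_continuous_image continuous_on_Heis K)
    moreover have "{p. ?\<psi> p \<noteq> 0} \<subseteq> Heis ` K"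
      using \<phi>(2) by (metis (mono_tags, lifting) Heis_coords image_eqI mem_Collect_eq subsetI)
    ultimately have "closure {p. ?\<psi> p \<noteq> 0} \<subseteq> Heis ` K" "compact (closure {p. ?\<psi> p \<noteq> 0})"
      by (metis closure_minimal compact_imp_closed, metis closed_closure closure_minimal compact_Int_closed compact_imp_closed inf.absorb_iff2)
    then show ?thesis
      using \<phi>(1) K(2) by (auto simp: test_function_def)
  qed
  let ?X = "\<lambda>j z. X_field j ?\<psi> (Heis z)"
  have X_eq: "?X j z = frechet_derivative \<phi> (at z) (hdir (axis j 1) z)" for j z
    using X_field_sum[OF D, of "axis j 1" z]
    by (simp add: axis_def if_distrib[of "\<lambda>x. x * _"] cong: if_cong)
  have cX: "continuous_on UNIV (?X j)" for j
  proof -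
    have eq: "?X j = (\<lambda>z. frechet_derivative \<phi> (at z) (axis j 1, 0)
        + sympl (fst z) (axis j 1) / 2 * frechet_derivative \<phi> (at z) (0, 1))"
    proof
      fix z
      interpret L: bounded_linear "frechet_derivative \<phi> (at z)"
        using D by (rule has_derivative_bounded_linear)
      have "hdir (axis j 1) z = (axis j 1, 0) + (sympl (fst z) (axis j 1) / 2) *\<^sub>R (0, 1)"
        by (simp add: hdir_def)
      then show "?X j z = frechet_derivative \<phi> (at z) (axis j 1, 0)
        + sympl (fst z) (axis j 1) / 2 * frechet_derivative \<phi> (at z) (0, 1)"
        unfolding X_eq by (simp add: L.add L.scaleR del: scaleR_Pair)
    qed
    show ?thesis
      unfolding eq by (intro continuous_intros contD sympl.continuous_on) auto
  qed
  have iX: "integrable lborel (\<lambda>z. F z * ?X j z)" for j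
    by (rule integrable_compact_support[OF continuous_on_mult[OF F(1) cX] K(1)]) (simp add: X_eq D0)
  have iG: "integrable lborel (\<lambda>z. G z $ j * \<phi> z)" for j
    by (rule integrable_compact_support[OF _ K(1)])
      (auto intro!: continuous_intros G cont\<phi> simp: \<phi>(2))
  have j: "(\<integral>z. F z * ?X j z \<partial>lborel) = - (\<integral>z. G z $ j * \<phi> z \<partial>lborel)" for j
  proof -
    have "(\<lambda>z. F z * ?X j z) = (\<lambda>z. f (Heis z) * ?X j z)"
    proof
      fix z show "F z * ?X j z = f (Heis z) * ?X j z" by (cases "z \<in> K") (simp_all add: F(2) X_eq D0)
    qed
    moreover have "(\<lambda>z. G z $ j * \<phi> z) = (\<lambda>z. g (Heis z) $ j * ?\<psi> (Heis z))"
    proof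
      fix z show "G z $ j * \<phi> z = g (Heis z) $ j * ?\<psi> (Heis z)"
        by (cases "z \<in> K") (simp_all add: G(2) \<phi>(2))
    qed
    ultimately show ?thesis
      using weak tf unfolding weak_hgrad_def by simp
  qed
  have "(\<integral>z. F z * frechet_derivative \<phi> (at z) (hdir v z) \<partial>lborel)
      = (\<integral>z. (\<Sum>j\<in>UNIV. v $ j * (F z * ?X j z)) \<partial>lborel)"
    by (simp add: X_field_sum[OF D, of v, symmetric] sum_distrib_left mult.left_commute)
  also have "\<dots> = (\<Sum>j\<in>UNIV. v $ j * (\<integral>z. F z * ?X j z \<partial>lborel))"
    using iX by (simp add: Bochner_Integration.integral_sum)
  also have "\<dots> = - (\<Sum>j\<in>UNIV. v $ j * (\<integral>z. G z $ j * \<phi> z \<partial>lborel))"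
    by (simp add: j sum_negf)
  also have "(\<Sum>j\<in>UNIV. v $ j * (\<integral>z. G z $ j * \<phi> z \<partial>lborel)) = (\<integral>z. (\<Sum>j\<in>UNIV. v $ j * (G z $ j * \<phi> z)) \<partial>lborel)"
    using iG by (simp add: Bochner_Integration.integral_sum)
  also have "\<dots> = (\<integral>z. (G z \<bullet> v) * \<phi> z \<partial>lborel)"
    by (simp add: inner_vec_def sum_distrib_right mult_ac flip: sum_distrib_left)
  finally show ?thesis .
qed

text \<open>A function with continuous distributional horizontal gradient is classically differentiable
  along horizontal lines. Testing with a bump that is carried along the flow of the field, the
  identity becomes one about the derivative of a single integral in the flow time; the mean value
  theorem and shrinking bumps then give the pointwise statement.\<close>

lemma horizontal_difference_bound:
  fixes f :: "'n::finite heis \<Rightarrow> real"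
  assumes U: "open U" and f: "continuous_on U f" and g: "continuous_on U g"
    and weak: "weak_hgrad U f g" and q: "q \<in> U" and \<epsilon>: "0 < \<epsilon>"
  shows "\<exists>d>0. \<forall>s. \<bar>s\<bar> < d \<longrightarrow>
    \<bar>f (q \<cdot> hexp (s *\<^sub>R v)) - f q - s * (g q \<bullet> v)\<bar> \<le> \<epsilon> * \<bar>s\<bar>"
proof -
  define z0 where "z0 = coords q"
  have "open (coords ` U)" "z0 \<in> coords ` U" using U q by (auto simp: open_coords_image z0_def)
  then obtain \<rho>0 where \<rho>0: "\<rho>0 > 0" "cball z0 \<rho>0 \<subseteq> coords ` U"
    by (metis open_contains_cball)
  define K where "K = cball z0 \<rho>0"
  have K: "compact K" "Heis ` K \<subseteq> U" using \<rho>0 by (auto simp: K_def)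
  have cf: "continuous_on K (\<lambda>z. f (Heis z))" "continuous_on K (\<lambda>z. g (Heis z))"
    using K(2) by (auto intro!: continuous_on_compose2[OF f] continuous_on_compose2[OF g] continuous_on_Heis)
  have "closedin (top_of_set UNIV) K" by (simp add: K_def)
  then obtain F G where F: "continuous_on UNIV F" "\<And>z. z \<in> K \<Longrightarrow> F z = f (Heis z)"
    and G: "continuous_on UNIV G" "\<And>z. z \<in> K \<Longrightarrow> G z = g (Heis z)"
    using Tietze_unbounded[OF cf(1)] Tietze_unbounded[OF cf(2)] by metis
  have z0K: "z0 \<in> K" using \<rho>0 by (simp add: K_def)
  define T where "T s z = z + s *\<^sub>R hdir v z" for s z
  have T_coords: "T s z = coords (Heis z \<cdot> hexp (s *\<^sub>R v))" for s z
    by (simp add: T_def coords_hexp)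
  have T_inv: "T s (T (- s) z) = z" for s z
  proof -
    have "hexp ((- s) *\<^sub>R v) \<cdot> hexp (s *\<^sub>R v) = Heis (0, 0)" by (simp only: hexp_add) simp
    then show ?thesis unfolding T_coords Heis_coords heis_assoc by simp
  qed
  have contT: "continuous_on UNIV (\<lambda>x. T (fst x) (snd x))"
    unfolding T_def hdir_def by (intro continuous_intros sympl.continuous_on) auto
  have contT': "continuous_on A (T s)" for A s
    using continuous_on_compose2[OF contT continuous_on_Pair[OF continuous_on_const[of A s] continuous_on_id]]
    by simp
  have T0: "T 0 z = z" for z by (simp add: T_def)
  \<comment> \<open>a neighbourhood of \<open>z0\<close> and a flow time for which the flow stays in \<open>K\<close> and the
     gradient is almost constant\<close>
  have "open {x. dist z0 (T (fst x) (snd x)) < \<rho>0 \<and> \<bar>G (T (fst x) (snd x)) \<bullet> v - G z0 \<bullet> v\<bar> < \<epsilon>}"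
    by (intro open_Collect_conj open_Collect_less continuous_intros contT
        continuous_on_compose2[OF G(1) contT]) auto
  moreover have "(0, z0) \<in> {x. dist z0 (T (fst x) (snd x)) < \<rho>0 \<and> \<bar>G (T (fst x) (snd x)) \<bullet> v - G z0 \<bullet> v\<bar> < \<epsilon>}"
    using \<rho>0 \<epsilon> by (simp add: T0)
  ultimately obtain S A where SA: "open S" "open A" "0 \<in> S" "z0 \<in> A"
    and sub: "S \<times> A \<subseteq> {x. dist z0 (T (fst x) (snd x)) < \<rho>0 \<and> \<bar>G (T (fst x) (snd x)) \<bullet> v - G z0 \<bullet> v\<bar> < \<epsilon>}"
    by (rule open_prod_elim) auto
  obtain d where d: "d > 0" "ball 0 d \<subseteq> S" using SA by (metis open_contains_ball)
  obtain \<rho>1 where \<rho>1: "\<rho>1 > 0" "cball z0 \<rho>1 \<subseteq> A" using SA by (metis open_contains_cball)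
  have TK: "T s z \<in> K" and G\<epsilon>: "\<bar>G (T s z) \<bullet> v - G z0 \<bullet> v\<bar> < \<epsilon>"
    if "\<bar>s\<bar> < d" "z \<in> cball z0 \<rho>1" for s z
  proof -
    have "(s, z) \<in> S \<times> A" using that d \<rho>1 by auto
    then show "T s z \<in> K" "\<bar>G (T s z) \<bullet> v - G z0 \<bullet> v\<bar> < \<epsilon>"
      using sub by (auto simp: K_def less_imp_le)
  qed
  have main: "\<bar>F (T s z0) - F z0 - s * (G z0 \<bullet> v)\<bar> \<le> \<epsilon> * \<bar>s\<bar>" if s: "\<bar>s\<bar> < d" for s
  proof (rule bump_average_bound[OF _ \<rho>1(1), where P = "\<lambda>z. F (T s z) - F z - s * (G z0 \<bullet> v)"])
    show "continuous_on UNIV (\<lambda>z. F (T s z) - F z - s * (G z0 \<bullet> v))"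
      by (intro continuous_intros F contT' continuous_on_compose2[OF F(1)]) auto
    fix \<rho> assume \<rho>: "0 < \<rho>" "\<rho> \<le> \<rho>1"
    let ?b = "bump z0 \<rho>"
    have b0: "?b z = 0" if "z \<notin> cball z0 \<rho>" for z
      using that bump_pos_iff[OF \<rho>(1), of z0 z] by auto
    define b where "b \<sigma> z = ?b (T (- \<sigma>) z)" for \<sigma> z
    have bK: "b \<sigma> z = 0" if "\<bar>\<sigma>\<bar> < d" "z \<notin> K" for \<sigma> z
    proof -
      have "T (- \<sigma>) z \<notin> cball z0 \<rho>"
        using TK[OF that(1), of "T (- \<sigma>) z"] that(2) \<rho>(2) by (auto simp: T_inv)
      then show ?thesis by (simp add: b_def b0)
    qed
    have Ckb: "Ck k (b \<sigma>)" for k \<sigma>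
    proof -
      let ?A = "\<lambda>z. z + (- \<sigma>) *\<^sub>R (0, sympl (fst z) v / 2)"
      have "bounded_linear ?A"
        by (intro bounded_linear_add bounded_linear_ident bounded_linear_compose[OF bounded_linear_scaleR_right]
            bounded_linear_Pair bounded_linear_zero bounded_linear_compose[OF bounded_linear_divide]
            bounded_linear_compose[OF sympl.bounded_linear_left] bounded_linear_fst)
      then have "Ck k (\<lambda>z. ?b (?A z + (- \<sigma>) *\<^sub>R (v, 0)))"
        by (rule Ck_compose_affine[OF _ Ck_bump])
      moreover have "?A z + (- \<sigma>) *\<^sub>R (v, 0) = T (- \<sigma>) z" for z
        by (cases z) (simp add: T_def hdir_def)
      ultimately show ?thesis by (simp add: b_def[abs_def])
    qed
    have Db: "(?b has_derivative frechet_derivative ?b (at z)) (at z)" for z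
      using Ck_SucD(1)[OF Ck_bump[of "Suc 0" z0 \<rho>]] .
    have cDb: "continuous_on UNIV (\<lambda>z. frechet_derivative ?b (at z) w)" for w
      using Ck_SucD(2)[OF Ck_bump[of "Suc 0" z0 \<rho>]] by simp
    \<comment> \<open>left-invariance of the field: differentiating in the flow time is differentiating along the field\<close>
    have Vb: "frechet_derivative (b \<sigma>) (at z) (hdir v z) = frechet_derivative ?b (at (T (- \<sigma>) z)) (hdir v z)" for \<sigma> z
    proof -
      have "(T (- \<sigma>) has_derivative (\<lambda>w. w + (- \<sigma>) *\<^sub>R (0, sympl (fst w) v / 2))) (at z)"
        unfolding T_def[abs_def] hdir_def
        by (auto intro!: derivative_eq_intros bounded_linear.has_derivative[OF sympl.bounded_linear_left])
      from has_derivative_compose[OF this Db]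
      have "frechet_derivative (b \<sigma>) (at z) = (\<lambda>w. frechet_derivative ?b (at (T (- \<sigma>) z)) (w + (- \<sigma>) *\<^sub>R (0, sympl (fst w) v / 2)))"
        unfolding b_def[abs_def] by (rule frechet_derivative_at[symmetric])
      then show ?thesis by (simp add: hdir_def)
    qed
    define h where "h \<sigma> = (\<integral>z. F z * b \<sigma> z \<partial>lborel)" for \<sigma>
    have ih: "integrable lborel (\<lambda>z. F z * b \<sigma> z)" if "\<bar>\<sigma>\<bar> < d" for \<sigma>
      using Ckb[of 0 \<sigma>] bK[OF that]
      by (intro integrable_compact_support[OF _ K(1)] continuous_intros F) auto
    have shift: "(\<integral>z. H z * b \<sigma> z \<partial>lborel) = (\<integral>z. H (T \<sigma> z) * ?b z \<partial>lborel)"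
      if H: "continuous_on UNIV H" for H :: "_ \<Rightarrow> real" and \<sigma>
    proof -
      have "(\<integral>z. H z * b \<sigma> z \<partial>lborel) = (\<integral>z. H z * b \<sigma> z \<partial>(distr lborel lborel (T \<sigma>)))"
        unfolding T_coords[abs_def] lborel_distr_right ..
      also have "\<dots> = (\<integral>z. H (T \<sigma> z) * b \<sigma> (T \<sigma> z) \<partial>lborel)"
        using Ckb[of 0 \<sigma>] by (intro integral_distr) (auto intro!: borel_measurable_continuous_onI contT' continuous_intros H)
      finally show ?thesis
        using T_inv[of "- \<sigma>"] by (simp add: b_def)
    qed
    have h_deriv: "(h has_real_derivative (\<integral>z. (G (T \<sigma> z) \<bullet> v) * ?b z \<partial>lborel)) (at \<sigma>)"
      if \<sigma>: "\<bar>\<sigma>\<bar> < d" for \<sigma>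
    proof -
      obtain a c where ac: "K \<subseteq> cbox a c"
        using K(1) by (meson bounded_subset_cbox_symmetric compact_imp_bounded)
      let ?I = "{- d<..<d}"
      let ?f' = "\<lambda>\<sigma> z. F z * - frechet_derivative ?b (at (T (- \<sigma>) z)) (hdir v z)"
      have eq: "(\<integral>z. H z \<partial>lborel) = integral (cbox a c) H"
        if H: "integrable lborel H" "\<And>z. z \<notin> K \<Longrightarrow> H z = 0" for H :: "_ \<Rightarrow> real"
      proof -
        have "(\<lambda>z. if z \<in> cbox a c then H z else 0) = H"
        proof
          fix z show "(if z \<in> cbox a c then H z else 0) = H z"
            using ac H(2)[of z] by (cases "z \<in> K") auto
        qed
        then show ?thesis
          using integral_lborel[OF H(1)] by (metis integral_restrict_UNIV)
      qed
      have "((\<lambda>\<sigma>. integral (cbox a c) (\<lambda>z. F z * b \<sigma> z)) has_field_derivative integral (cbox a c) (?f' \<sigma>)) (at \<sigma> within ?I)"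
      proof (rule leibniz_rule_field_derivative)
        fix \<tau> z
        have "((\<lambda>\<tau>. T (- \<tau>) z) has_derivative (\<lambda>x. - x *\<^sub>R hdir v z)) (at \<tau> within ?I)"
          unfolding T_def by (auto intro!: derivative_eq_intros)
        from has_derivative_compose[OF this Db]
        have "((\<lambda>\<tau>. b \<tau> z) has_derivative (\<lambda>x. frechet_derivative ?b (at (T (- \<tau>) z)) (- x *\<^sub>R hdir v z))) (at \<tau> within ?I)"
          by (simp add: b_def)
        moreover have "(\<lambda>x. frechet_derivative ?b (at (T (- \<tau>) z)) (- x *\<^sub>R hdir v z))
           = (*) (- frechet_derivative ?b (at (T (- \<tau>) z)) (hdir v z))"
        proof
          fix x
          interpret L: bounded_linear "frechet_derivative ?b (at (T (- \<tau>) z))"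
            by (rule has_derivative_bounded_linear[OF Db])
          show "frechet_derivative ?b (at (T (- \<tau>) z)) (- x *\<^sub>R hdir v z)
            = - frechet_derivative ?b (at (T (- \<tau>) z)) (hdir v z) * x"
            unfolding L.scaleR by simp
        qed
        ultimately have "((\<lambda>\<tau>. b \<tau> z) has_field_derivative - frechet_derivative ?b (at (T (- \<tau>) z)) (hdir v z)) (at \<tau> within ?I)"
          by (simp add: has_field_derivative_def)
        then show "((\<lambda>\<tau>. F z * b \<tau> z) has_field_derivative ?f' \<tau> z) (at \<tau> within ?I)"
          by (rule DERIV_cmult)
      next
        fix \<tau> :: real
        show "(\<lambda>z. F z * b \<tau> z) integrable_on cbox a c"
          using Ckb[of 0 \<tau>] by (intro integrable_continuous continuous_intros)
            (auto intro: continuous_on_subset F)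
      next
        have "frechet_derivative ?b (at z) (hdir v w) = frechet_derivative ?b (at z) (v, 0)
            + sympl (fst w) v / 2 * frechet_derivative ?b (at z) (0, 1)" for z w
        proof -
          interpret L: bounded_linear "frechet_derivative ?b (at z)"
            using Db by (rule has_derivative_bounded_linear)
          have "hdir v w = (v, 0) + (sympl (fst w) v / 2) *\<^sub>R (0, 1)" by (simp add: hdir_def)
          then show ?thesis by (simp add: L.add L.scaleR del: scaleR_Pair)
        qed
        then show "continuous_on (?I \<times> cbox a c) (\<lambda>(\<tau>, z). ?f' \<tau> z)"
          unfolding case_prod_beta
          by (simp, intro continuous_intros continuous_on_compose2[OF F(1)] sympl.continuous_on
              continuous_on_compose2[OF cDb] continuous_on_compose2[OF contT, of _ "\<lambda>x. (- fst x, snd x)", simplified]) auto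
      qed (use \<sigma> in auto)
      then have "((\<lambda>\<sigma>. integral (cbox a c) (\<lambda>z. F z * b \<sigma> z)) has_field_derivative integral (cbox a c) (?f' \<sigma>)) (at \<sigma>)"
        using \<sigma> at_within_open[of \<sigma> ?I] by (simp add: abs_less_iff)
      then have "(h has_real_derivative integral (cbox a c) (?f' \<sigma>)) (at \<sigma>)"
      proof (rule has_field_derivative_transform_within_open)
        show "integral (cbox a c) (\<lambda>z. F z * b \<tau> z) = h \<tau>" if "\<tau> \<in> ?I" for \<tau>
          unfolding h_def using that by (intro eq[symmetric] ih) (auto simp: bK)
      qed (use \<sigma> in auto)
      also have "integral (cbox a c) (?f' \<sigma>) = integral (cbox a c) (\<lambda>z. - (F z * frechet_derivative (b \<sigma>) (at z) (hdir v z)))"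
        by (simp add: Vb)
      also have "\<dots> = (\<integral>z. - (F z * frechet_derivative (b \<sigma>) (at z) (hdir v z)) \<partial>lborel)"
      proof (rule eq[symmetric])
        have cl: "closed K" using K compact_imp_closed by blast
        have Db\<sigma>: "(b \<sigma> has_derivative frechet_derivative (b \<sigma>) (at z)) (at z)" for z
          using Ck_SucD(1)[OF Ckb[of "Suc 0"]] .
        show 0: "- (F z * frechet_derivative (b \<sigma>) (at z) (hdir v z)) = 0" if "z \<notin> K" for z
          using derivative_zero_outside[OF Db\<sigma> cl bK[OF \<sigma>] that] by simp
        have "frechet_derivative (b \<sigma>) (at z) (hdir v z) = frechet_derivative (b \<sigma>) (at z) (v, 0)
            + sympl (fst z) v / 2 * frechet_derivative (b \<sigma>) (at z) (0, 1)" for z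
        proof -
          interpret L: bounded_linear "frechet_derivative (b \<sigma>) (at z)"
            using Db\<sigma> by (rule has_derivative_bounded_linear)
          have "hdir v z = (v, 0) + (sympl (fst z) v / 2) *\<^sub>R (0, 1)" by (simp add: hdir_def)
          then show ?thesis by (simp add: L.add L.scaleR del: scaleR_Pair)
        qed
        then have "continuous_on UNIV (\<lambda>z. - (F z * frechet_derivative (b \<sigma>) (at z) (hdir v z)))"
          using Ck_SucD(2)[OF Ckb[of "Suc 0" \<sigma>]] by (simp, intro continuous_intros F sympl.continuous_on) auto
        then show "integrable lborel (\<lambda>z. - (F z * frechet_derivative (b \<sigma>) (at z) (hdir v z)))"
          by (rule integrable_compact_support[OF _ K(1)]) (rule 0)
      qed
      also have "\<dots> = (\<integral>z. (G z \<bullet> v) * b \<sigma> z \<partial>lborel)"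
        using weak_identity[OF weak K F G Ckb bK[OF \<sigma>], of v] by simp
      also have "\<dots> = (\<integral>z. (G (T \<sigma> z) \<bullet> v) * ?b z \<partial>lborel)"
        by (rule shift) (intro continuous_intros G)
      finally show ?thesis .
    qed
    obtain \<xi> where \<xi>: "\<bar>\<xi>\<bar> < d" "h s - h 0 = s * (\<integral>z. (G (T \<xi> z) \<bullet> v) * ?b z \<partial>lborel)"
    proof (cases "s = 0")
      case True
      then show ?thesis using that[of 0] d by simp
    next
      case False
      let ?l = "min 0 s" and ?u = "max 0 s"
      have "\<exists>z. ?l < z \<and> z < ?u \<and> h ?u - h ?l = (?u - ?l) * (\<integral>x. (G (T z x) \<bullet> v) * ?b x \<partial>lborel)"
        using False s by (intro MVT2 h_deriv) auto
      then obtain z where z: "?l < z" "z < ?u" "h ?u - h ?l = (?u - ?l) * (\<integral>x. (G (T z x) \<bullet> v) * ?b x \<partial>lborel)"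
        by blast
      show ?thesis
        using z s by (intro that[of z]) (auto simp: min_def max_def split: if_splits)
    qed
    have iP: "integrable lborel (\<lambda>z. F (T s z) * ?b z)" "integrable lborel (\<lambda>z. F z * ?b z)"
      "integrable lborel (\<lambda>z. s * (G z0 \<bullet> v) * ?b z)" "integrable lborel (\<lambda>z. (G (T \<xi> z) \<bullet> v) * ?b z)"
      "integrable lborel (\<lambda>z. (G z0 \<bullet> v) * ?b z)" "integrable lborel (\<lambda>z. \<epsilon> * ?b z)"
      "integrable lborel (\<lambda>z. (G (T \<xi> z) \<bullet> v - G z0 \<bullet> v) * ?b z)"
      by (intro integrable_mult_bump \<rho> continuous_intros F contT' continuous_on_compose2[OF F(1)]
          continuous_on_compose2[OF G(1)]; auto)+
    have "(\<integral>z. (F (T s z) - F z - s * (G z0 \<bullet> v)) * ?b z \<partial>lborel)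
        = h s - h 0 - s * (\<integral>z. (G z0 \<bullet> v) * ?b z \<partial>lborel)"
      unfolding h_def shift[OF F(1)] left_diff_distrib T0
      using iP by (simp add: mult.assoc)
    also have "\<dots> = s * (\<integral>z. (G (T \<xi> z) \<bullet> v - G z0 \<bullet> v) * ?b z \<partial>lborel)"
      unfolding \<xi>(2) left_diff_distrib using iP by (simp add: right_diff_distrib)
    finally have "\<bar>\<integral>z. (F (T s z) - F z - s * (G z0 \<bullet> v)) * ?b z \<partial>lborel\<bar>
        = \<bar>s\<bar> * \<bar>\<integral>z. (G (T \<xi> z) \<bullet> v - G z0 \<bullet> v) * ?b z \<partial>lborel\<bar>"
      by (simp add: abs_mult)
    also have "\<dots> \<le> \<bar>s\<bar> * (\<integral>z. \<epsilon> * ?b z \<partial>lborel)"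
    proof (rule mult_left_mono[OF order_trans[OF integral_abs_bound integral_mono]])
      fix z
      show "\<bar>(G (T \<xi> z) \<bullet> v - G z0 \<bullet> v) * ?b z\<bar> \<le> \<epsilon> * ?b z"
      proof (cases "z \<in> cball z0 \<rho>")
        case True
        then have "\<bar>G (T \<xi> z) \<bullet> v - G z0 \<bullet> v\<bar> \<le> \<epsilon>"
          using G\<epsilon>[OF \<xi>(1), of z] \<rho>(2) by auto
        then show ?thesis
          by (simp add: abs_mult bump_nonneg mult_right_mono)
      qed (simp add: b0)
    qed (use iP in \<open>auto intro: integrable_abs\<close>)
    finally show "\<bar>\<integral>z. (F (T s z) - F z - s * (G z0 \<bullet> v)) * ?b z \<partial>lborel\<bar>
        \<le> \<epsilon> * \<bar>s\<bar> * (\<integral>z. ?b z \<partial>lborel)"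
      by (simp add: mult_ac)
  qed
  show ?thesis
  proof (intro exI[of _ d] conjI d allI impI)
    fix s assume s: "\<bar>s\<bar> < d"
    have "Heis (T s z0) = q \<cdot> hexp (s *\<^sub>R v)" by (simp add: T_coords z0_def)
    then show "\<bar>f (q \<cdot> hexp (s *\<^sub>R v)) - f q - s * (g q \<bullet> v)\<bar> \<le> \<epsilon> * \<bar>s\<bar>"
      using main[OF s] F(2)[OF TK[OF s, of z0]] F(2)[OF z0K] G(2)[OF z0K] \<rho>1
      by (simp add: z0_def)
  qed
qed

lemma horizontal_derivative:
  fixes f :: "'n::finite heis \<Rightarrow> real"
  assumes U: "open U" and f: "continuous_on U f" and g: "continuous_on U g"
    and weak: "weak_hgrad U f g" and q: "q \<cdot> hexp (t *\<^sub>R v) \<in> U"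
  shows "((\<lambda>s. f (q \<cdot> hexp (s *\<^sub>R v))) has_real_derivative g (q \<cdot> hexp (t *\<^sub>R v)) \<bullet> v) (at t)"
  unfolding has_field_derivative_def has_derivative_at_alt
proof (intro conjI allI impI)
  let ?q = "q \<cdot> hexp (t *\<^sub>R v)"
  fix \<epsilon> :: real assume "0 < \<epsilon>"
  from horizontal_difference_bound[OF U f g weak q this, of v]
  obtain d where d: "d > 0" "\<And>s. \<bar>s\<bar> < d \<Longrightarrow>
    \<bar>f (?q \<cdot> hexp (s *\<^sub>R v)) - f ?q - s * (g ?q \<bullet> v)\<bar> \<le> \<epsilon> * \<bar>s\<bar>" by blast
  show "\<exists>d>0. \<forall>y. norm (y - t) < d \<longrightarrow> norm (f (q \<cdot> hexp (y *\<^sub>R v)) - f ?q - g ?q \<bullet> v * (y - t)) \<le> \<epsilon> * norm (y - t)"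
  proof (intro exI[of _ d] conjI d allI impI)
    fix y assume "norm (y - t) < d"
    then show "norm (f (q \<cdot> hexp (y *\<^sub>R v)) - f ?q - g ?q \<bullet> v * (y - t)) \<le> \<epsilon> * norm (y - t)"
      using d(2)[of "y - t"] by (simp add: heis_assoc hexp_add mult.commute)
  qed
qed (rule bounded_linear_mult_right)


section \<open>Hausdorff measure is a Borel measure\<close>

text \<open>The approximation at scale \<open>\<delta>\<close> of Hausdorff measure.\<close>

definition hpre :: "real \<Rightarrow> real \<Rightarrow> 'a::metric_space set \<Rightarrow> ennreal" where
  "hpre s \<delta> A = (INF C\<in>{C :: nat \<Rightarrow> 'a set. (\<forall>i. bounded (C i) \<and> diameter (C i) \<le> \<delta>) \<and> A \<subseteq> (\<Union>i. C i)}.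
     \<Sum>i. ennreal (diameter (C i) powr s))"

lemma hausdorff_outer_hpre: "hausdorff_outer s A = (SUP \<delta>\<in>{0<..}. hpre s \<delta> A)"
  by (simp add: hausdorff_outer_def hpre_def)

lemma hpre_le:
  assumes "\<And>i. bounded (C i)" "\<And>i. diameter (C i) \<le> \<delta>" "A \<subseteq> (\<Union>i. C i)"
  shows "hpre s \<delta> A \<le> (\<Sum>i. ennreal (diameter (C i) powr s))"
  unfolding hpre_def using assms by (intro INF_lower) auto

lemma hpre_less_D:
  assumes "hpre s \<delta> A < x"
  obtains C where "\<And>i. bounded (C i)" "\<And>i. diameter (C i) \<le> \<delta>" "A \<subseteq> (\<Union>i. C i)"
    "(\<Sum>i. ennreal (diameter (C i) powr s)) < x"
  using assms unfolding hpre_def INF_less_iff by auto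

lemma hpre_greatest:
  assumes "\<And>C. (\<And>i. bounded (C i)) \<Longrightarrow> (\<And>i. diameter (C i) \<le> \<delta>) \<Longrightarrow> A \<subseteq> (\<Union>i. C i) \<Longrightarrow>
    x \<le> (\<Sum>i. ennreal (diameter (C i) powr s))"
  shows "x \<le> hpre s \<delta> A"
  unfolding hpre_def using assms by (intro INF_greatest) auto

lemma hpre_mono: "A \<subseteq> B \<Longrightarrow> hpre s \<delta> A \<le> hpre s \<delta> B"
  by (intro hpre_greatest hpre_le) auto

lemma hpre_antimono: "\<delta> \<le> \<delta>' \<Longrightarrow> hpre s \<delta>' A \<le> hpre s \<delta> A"
  by (intro hpre_greatest hpre_le) (auto intro: order_trans)

lemma hpre_le_outer: "0 < \<delta> \<Longrightarrow> hpre s \<delta> A \<le> hausdorff_outer s A"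
  unfolding hausdorff_outer_hpre by (intro SUP_upper) auto

lemma hausdorff_outer_leI: "(\<And>\<delta>. 0 < \<delta> \<Longrightarrow> hpre s \<delta> A \<le> x) \<Longrightarrow> hausdorff_outer s A \<le> x"
  unfolding hausdorff_outer_hpre by (intro SUP_least) auto

lemma hausdorff_outer_mono: "A \<subseteq> B \<Longrightarrow> hausdorff_outer s A \<le> hausdorff_outer s B"
  by (meson hausdorff_outer_leI hpre_le_outer hpre_mono order_trans)

lemma hausdorff_outer_empty [simp]: "hausdorff_outer s {} = 0"
proof -
  have "hpre s \<delta> {} \<le> 0" if "0 < \<delta>" for \<delta> :: real
    using hpre_le[of "\<lambda>_. {}" \<delta> "{}" s] that by simp
  then have "hausdorff_outer s {} \<le> 0" by (intro hausdorff_outer_leI)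
  then show ?thesis by simp
qed

lemma hpre_UN: "hpre s \<delta> (\<Union>i. A i) \<le> (\<Sum>i::nat. hpre s \<delta> (A i))"
proof (rule ennreal_le_epsilon)
  fix e :: real assume top: "(\<Sum>i. hpre s \<delta> (A i)) < top" and e: "0 < e"
  have fin: "hpre s \<delta> (A i) < top" for i
    using top by (metis ennreal_suminf_lessD)
  have ex: "\<exists>C. (\<forall>j. bounded (C j) \<and> diameter (C j) \<le> \<delta>) \<and> A i \<subseteq> (\<Union>j. C j) \<and>
      (\<Sum>j. ennreal (diameter (C j) powr s)) \<le> hpre s \<delta> (A i) + ennreal (e * (1/2) ^ Suc i)" for i
  proof -
    have "hpre s \<delta> (A i) < hpre s \<delta> (A i) + ennreal (e * (1/2) ^ Suc i)"
    proof -
      obtain r where r: "hpre s \<delta> (A i) = ennreal r" "0 \<le> r"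
        using fin[of i] by (cases "hpre s \<delta> (A i)") auto
      then show ?thesis
        using e by (simp add: ennreal_plus[symmetric] ennreal_less_iff del: ennreal_plus)
    qed
    then obtain C where C: "\<And>j. bounded (C j)" "\<And>j. diameter (C j) \<le> \<delta>" "A i \<subseteq> (\<Union>j. C j)"
      "(\<Sum>j. ennreal (diameter (C j) powr s)) < hpre s \<delta> (A i) + ennreal (e * (1/2) ^ Suc i)"
      by (rule hpre_less_D) blast
    show ?thesis
      by (intro exI[of _ C] conjI allI C less_imp_le[OF C(4)])
  qed
  have "\<exists>C. \<forall>i. (\<forall>j. bounded (C i j) \<and> diameter (C i j) \<le> \<delta>) \<and> A i \<subseteq> (\<Union>j. C i j) \<and>
      (\<Sum>j. ennreal (diameter (C i j) powr s)) \<le> hpre s \<delta> (A i) + ennreal (e * (1/2) ^ Suc i)"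
    by (rule choice[OF allI[OF ex]])
  then obtain C where C0: "\<forall>i. (\<forall>j. bounded (C i j) \<and> diameter (C i j) \<le> \<delta>) \<and> A i \<subseteq> (\<Union>j. C i j) \<and>
      (\<Sum>j. ennreal (diameter (C i j) powr s)) \<le> hpre s \<delta> (A i) + ennreal (e * (1/2) ^ Suc i)" ..
  have C: "bounded (C i j)" "diameter (C i j) \<le> \<delta>" for i j
    using C0[THEN spec, of i] by blast+
  have C3: "A i \<subseteq> (\<Union>j. C i j)"
    and C4: "(\<Sum>j. ennreal (diameter (C i j) powr s)) \<le> hpre s \<delta> (A i) + ennreal (e * (1/2) ^ Suc i)" for i
    by (rule C0[THEN spec, of i, THEN conjunct2, THEN conjunct1],
        rule C0[THEN spec, of i, THEN conjunct2, THEN conjunct2])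
  let ?D = "\<lambda>n. case_prod C (prod_decode n)"
  have "hpre s \<delta> (\<Union>i. A i) \<le> (\<Sum>n. ennreal (diameter (?D n) powr s))"
  proof (rule hpre_le)
    show "(\<Union>i. A i) \<subseteq> (\<Union>n. ?D n)"
    proof
      fix x assume "x \<in> (\<Union>i. A i)"
      then obtain i j where "x \<in> C i j" using C3 by blast
      then have "x \<in> ?D (prod_encode (i, j))" by simp
      then show "x \<in> (\<Union>n. ?D n)" by (rule UN_I[OF UNIV_I])
    qed
  qed (simp_all add: C split_beta)
  also have "\<dots> = (\<Sum>i. \<Sum>j. ennreal (diameter (C i j) powr s))"
    by (rule suminf_ennreal_2dimen[where f = "\<lambda>p. ennreal (diameter (case_prod C p) powr s)"]) (simp only: prod.case)
  also have "\<dots> \<le> (\<Sum>i. hpre s \<delta> (A i) + ennreal (e * (1/2) ^ Suc i))"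
    by (intro suminf_le C4 summableI)
  also have "\<dots> = (\<Sum>i. hpre s \<delta> (A i)) + (\<Sum>i. ennreal (e * (1/2) ^ Suc i))"
    by (intro suminf_add[symmetric] summableI)
  also have "(\<Sum>i. ennreal (e * (1/2) ^ Suc i)) = ennreal e"
    using e sums_mult[OF power_half_series, of e] by (intro suminf_ennreal_eq) simp_all
  finally show "hpre s \<delta> (\<Union>i. A i) \<le> (\<Sum>i. hpre s \<delta> (A i)) + ennreal e" .
qed

lemma hausdorff_outer_UN: "hausdorff_outer s (\<Union>i. A i) \<le> (\<Sum>i::nat. hausdorff_outer s (A i))"
  by (intro hausdorff_outer_leI order_trans[OF hpre_UN] suminf_le hpre_le_outer) auto

lemma outer_measure_hausdorff: "outer_measure_space (Pow UNIV) (hausdorff_outer s)"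
  unfolding outer_measure_space_def positive_def increasing_def countably_subadditive_def
  by (simp add: hausdorff_outer_mono hausdorff_outer_UN)

lemma hausdorff_outer_Un: "hausdorff_outer s (A \<union> B) \<le> hausdorff_outer s A + hausdorff_outer s B"
proof -
  have "A \<union> B = (\<Union>i. binaryset A B i)" by (simp add: UN_binaryset_eq)
  then show ?thesis
    using hausdorff_outer_UN[of s "binaryset A B"] by (simp add: suminf_binaryset_eq)
qed

text \<open>A set of diameter less than \<open>d\<close> meets at most one of two sets at distance \<open>d\<close>, so a fine cover
  of the union splits into covers of the parts.\<close>

lemma hausdorff_outer_metric:
  fixes A B :: "'a::metric_space set"
  assumes d: "0 < d" "\<And>x y. x \<in> A \<Longrightarrow> y \<in> B \<Longrightarrow> d \<le> dist x y" and s: "0 < s"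
  shows "hausdorff_outer s A + hausdorff_outer s B \<le> hausdorff_outer s (A \<union> B)"
proof -
  have pre: "hpre s \<delta> A + hpre s \<delta> B \<le> hpre s \<delta> (A \<union> B)" if "0 < \<delta>" "\<delta> < d" for \<delta>
  proof (rule hpre_greatest)
    fix C :: "nat \<Rightarrow> 'a set"
    assume C: "\<And>i. bounded (C i)" "\<And>i. diameter (C i) \<le> \<delta>" "A \<union> B \<subseteq> (\<Union>i. C i)"
    define CA where "CA i = (if C i \<inter> A = {} then {} else C i)" for i
    define CB where "CB i = (if C i \<inter> B = {} then {} else C i)" for i
    have "A \<subseteq> (\<Union>i. CA i)" "B \<subseteq> (\<Union>i. CB i)"
      using C(3) unfolding CA_def CB_def by fastforce+
    then have "hpre s \<delta> A \<le> (\<Sum>i. ennreal (diameter (CA i) powr s))"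
      using C that by (intro hpre_le) (simp_all add: CA_def)
    moreover have "hpre s \<delta> B \<le> (\<Sum>i. ennreal (diameter (CB i) powr s))"
      using C that \<open>B \<subseteq> (\<Union>i. CB i)\<close> by (intro hpre_le) (simp_all add: CB_def)
    ultimately have "hpre s \<delta> A + hpre s \<delta> B
        \<le> (\<Sum>i. ennreal (diameter (CA i) powr s)) + (\<Sum>i. ennreal (diameter (CB i) powr s))"
      by (rule add_mono)
    also have "\<dots> = (\<Sum>i. ennreal (diameter (CA i) powr s) + ennreal (diameter (CB i) powr s))"
      by (intro suminf_add) auto
    also have "\<dots> \<le> (\<Sum>i. ennreal (diameter (C i) powr s))"
    proof (intro suminf_le allI)
      fix i
      have "\<not> (C i \<inter> A \<noteq> {} \<and> C i \<inter> B \<noteq> {})"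
      proof
        assume "C i \<inter> A \<noteq> {} \<and> C i \<inter> B \<noteq> {}"
        then obtain x y where "x \<in> C i" "y \<in> C i" "x \<in> A" "y \<in> B" by blast
        then show False
          using diameter_bounded_bound[OF C(1)[of i], of x y] C(2)[of i] d(2)[of x y] that by linarith
      qed
      then show "ennreal (diameter (CA i) powr s) + ennreal (diameter (CB i) powr s) \<le> ennreal (diameter (C i) powr s)"
        using s by (auto simp: CA_def CB_def)
    qed auto
    finally show "hpre s \<delta> A + hpre s \<delta> B \<le> (\<Sum>i. ennreal (diameter (C i) powr s))" .
  qed
  have "hausdorff_outer s A + hausdorff_outer s B = (SUP \<delta>\<in>{0<..}. hpre s \<delta> A + hpre s \<delta> B)"
    unfolding hausdorff_outer_hpre
  proof (rule SUP_add_directed_ennreal[symmetric])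
    fix i j :: real assume "i \<in> {0<..}" "j \<in> {0<..}"
    then show "\<exists>k\<in>{0<..}. hpre s i A + hpre s j B \<le> hpre s k A + hpre s k B"
      by (intro bexI[of _ "min i j"] add_mono hpre_antimono) auto
  qed
  also have "\<dots> \<le> hausdorff_outer s (A \<union> B)"
  proof (rule SUP_least)
    fix \<delta> :: real assume \<delta>: "\<delta> \<in> {0<..}"
    let ?\<delta> = "min \<delta> (d / 2)"
    have "hpre s \<delta> A + hpre s \<delta> B \<le> hpre s ?\<delta> A + hpre s ?\<delta> B"
      by (intro add_mono hpre_antimono) auto
    also have "\<dots> \<le> hpre s ?\<delta> (A \<union> B)" using \<delta> d(1) by (intro pre) auto
    also have "\<dots> \<le> hausdorff_outer s (A \<union> B)" using \<delta> d(1) by (intro hpre_le_outer) auto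
    finally show "hpre s \<delta> A + hpre s \<delta> B \<le> hausdorff_outer s (A \<union> B)" .
  qed
  finally show ?thesis .
qed

lemma lambda_hausdorff_iff:
  "E \<in> lambda_system UNIV UNIV (hausdorff_outer s) \<longleftrightarrow>
    (\<forall>A. hausdorff_outer s (A \<inter> E) + hausdorff_outer s (A - E) \<le> hausdorff_outer s A)"
proof -
  have "hausdorff_outer s A \<le> hausdorff_outer s (A \<inter> E) + hausdorff_outer s (A - E)" for A
    using hausdorff_outer_Un[of s "A \<inter> E" "A - E"] by (simp add: Un_Diff_Int Int_Diff_Un)
  moreover have "E \<inter> A = A \<inter> E" "(UNIV - E) \<inter> A = A - E" for A by auto
  ultimately show ?thesis
    unfolding lambda_system_def by (simp add: eq_iff[where 'a = ennreal])
qed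

text \<open>Caratheodory's criterion: layers of \<open>A\<close> at comparable distances from the closed set \<open>F\<close>
  whose indices have the same parity are positively separated, so the measures of the layers are
  summable, and what lies close to \<open>F\<close> but off it has small measure.\<close>

lemma closed_lambda_hausdorff:
  fixes F :: "'a::metric_space set"
  assumes F: "closed F" and s: "0 < s"
  shows "F \<in> lambda_system UNIV UNIV (hausdorff_outer s)"
  unfolding lambda_hausdorff_iff
proof
  let ?\<mu> = "hausdorff_outer s"
  fix A :: "'a set"
  show "?\<mu> (A \<inter> F) + ?\<mu> (A - F) \<le> ?\<mu> A"
  proof (cases "?\<mu> A = top \<or> F = {}")
    case True then show ?thesis by auto
  next
    case False
    then have fin: "?\<mu> A < top" and ne: "F \<noteq> {}" by (auto simp: top.not_eq_extremum)
    define u where "u k = 1 / (real k + 1)" for k :: nat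
    have u: "0 < u k" "u (Suc k) < u k" for k by (auto simp: u_def field_simps)
    have u_mono: "u k \<le> u j" if "j \<le> k" for j k using that by (simp add: u_def field_simps)
    define B where "B k = {x \<in> A. u k \<le> infdist x F}" for k
    define R where "R k = B (Suc k) - B k" for k
    have sep: "?\<mu> (A \<inter> F) + ?\<mu> (B k) \<le> ?\<mu> A" for k
    proof -
      have "?\<mu> (A \<inter> F) + ?\<mu> (B k) \<le> ?\<mu> ((A \<inter> F) \<union> B k)"
      proof (rule hausdorff_outer_metric[OF u(1)[of k] _ s])
        fix x y assume "x \<in> A \<inter> F" "y \<in> B k"
        then show "u k \<le> dist x y" using infdist_le[of x F y] by (auto simp: B_def dist_commute)
      qed
      also have "\<dots> \<le> ?\<mu> A" by (rule hausdorff_outer_mono) (auto simp: B_def)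
      finally show ?thesis .
    qed
    have layers: "(\<Sum>j<m. ?\<mu> (R (2 * j + p))) \<le> ?\<mu> (\<Union>j<m. R (2 * j + p))" for m p
    proof (induction m)
      case (Suc m)
      let ?V = "\<Union>j<m. R (2 * j + p)"
      show ?case
      proof (cases m)
        case (Suc l)
        have "?\<mu> ?V + ?\<mu> (R (2 * m + p)) \<le> ?\<mu> (?V \<union> R (2 * m + p))"
        proof (rule hausdorff_outer_metric[OF _ _ s])
          show "0 < u (2 * l + p + 1) - u (2 * m + p)"
            using u(2)[of "2 * l + p + 1"] by (simp add: Suc)
          fix x y assume x: "x \<in> ?V" and y: "y \<in> R (2 * m + p)"
          from x obtain j where j: "j < m" "x \<in> B (Suc (2 * j + p))" by (auto simp: R_def)
          then have "u (2 * l + p + 1) \<le> u (Suc (2 * j + p))" by (intro u_mono) (simp add: Suc)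
          then have "u (2 * l + p + 1) \<le> infdist x F" using j(2) by (simp add: B_def)
          moreover have "infdist y F < u (2 * m + p)" using y by (auto simp: R_def B_def)
          moreover have "infdist x F \<le> infdist y F + dist x y" by (rule infdist_triangle)
          ultimately show "u (2 * l + p + 1) - u (2 * m + p) \<le> dist x y" by linarith
        qed
        moreover have "?V \<union> R (2 * m + p) = (\<Union>j<Suc m. R (2 * j + p))" by (auto simp: lessThan_Suc)
        ultimately have "?\<mu> ?V + ?\<mu> (R (2 * m + p)) \<le> ?\<mu> (\<Union>j<Suc m. R (2 * j + p))" by simp
        then show ?thesis
          unfolding sum.lessThan_Suc by (rule order_trans[OF add_right_mono[OF Suc.IH]])
      qed (simp add: lessThan_Suc)
    qed simp
    have RA: "(\<Union>j<m. R (2 * j + p)) \<subseteq> A" for m p by (auto simp: R_def B_def)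
    have part: "(\<Sum>k<2 * m. ?\<mu> (R k)) \<le> ?\<mu> A + ?\<mu> A" for m
    proof -
      have "(\<Sum>k<2 * m. ?\<mu> (R k)) = (\<Sum>j<m. ?\<mu> (R (2 * j + 0))) + (\<Sum>j<m. ?\<mu> (R (2 * j + 1)))"
        by (induction m) (simp_all add: add_ac)
      also have "\<dots> \<le> ?\<mu> A + ?\<mu> A"
        by (intro add_mono order_trans[OF layers] hausdorff_outer_mono RA)
      finally show ?thesis .
    qed
    have "(\<Sum>k. ?\<mu> (R k)) \<le> ?\<mu> A + ?\<mu> A"
    proof (rule suminf_le_const)
      fix m
      have "(\<Sum>k<m. ?\<mu> (R k)) \<le> (\<Sum>k<2 * m. ?\<mu> (R k))" by (intro sum_mono2) auto
      then show "(\<Sum>k<m. ?\<mu> (R k)) \<le> ?\<mu> A + ?\<mu> A" using part[of m] by (rule order_trans)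
    qed simp
    also have "\<dots> < top" using fin by simp
    finally have sfin: "(\<Sum>k. ?\<mu> (R k)) < top" .
    define c where "c k = enn2real (?\<mu> (R k))" for k
    have c: "?\<mu> (R k) = ennreal (c k)" for k
      using ennreal_suminf_lessD[OF sfin, of k] by (simp add: c_def)
    have cs: "summable c"
      using sfin unfolding c by (intro summable_suminf_not_top) (auto simp: c_def)
    have "?\<mu> (A \<inter> F) + ?\<mu> (A - F) \<le> ?\<mu> A + ennreal e" if e: "0 < e" for e
    proof -
      obtain k where k: "norm (\<Sum>j. c (j + k)) < e"
        using suminf_exist_split[OF e cs] by auto
      have "(\<Sum>j. ?\<mu> (R (j + k))) = ennreal (\<Sum>j. c (j + k))"
        unfolding c by (rule suminf_ennreal2) (auto simp: c_def summable_iff_shift[of "\<lambda>k. enn2real (?\<mu> (R k))"] cs[unfolded c_def[abs_def]])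
      also have "\<dots> \<le> ennreal e" using k by (intro ennreal_leI) auto
      finally have tail: "(\<Sum>j. ?\<mu> (R (j + k))) \<le> ennreal e" .
      have "A - F \<subseteq> B k \<union> (\<Union>j. R (j + k))"
      proof
        fix x assume x: "x \<in> A - F"
        then have "0 < infdist x F"
          using F ne infdist_pos_not_in_closed by blast
        then obtain m where m: "inverse (real (Suc m)) < infdist x F" using reals_Archimedean by blast
        then have "x \<in> B m" using x by (simp add: B_def u_def inverse_eq_divide add.commute)
        then have "x \<in> B k \<or> (\<exists>j. x \<in> R (j + k))"
        proof (induction m)
          case 0
          then show ?case using u_mono[of 0 k] by (auto simp: B_def)
        next
          case (Suc m)
          show ?case
          proof (cases "x \<in> B m \<or> Suc m \<le> k")
            case True
            then show ?thesis using Suc u_mono[of "Suc m" k] by (auto simp: B_def)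
          next
            case False
            then have "x \<in> R ((m - k) + k)" using Suc.prems by (simp add: R_def)
            then show ?thesis by blast
          qed
        qed
        then show "x \<in> B k \<union> (\<Union>j. R (j + k))" by blast
      qed
      then have "?\<mu> (A - F) \<le> ?\<mu> (B k \<union> (\<Union>j. R (j + k)))" by (rule hausdorff_outer_mono)
      also have "\<dots> \<le> ?\<mu> (B k) + (\<Sum>j. ?\<mu> (R (j + k)))"
        by (intro order_trans[OF hausdorff_outer_Un] add_left_mono hausdorff_outer_UN)
      also have "\<dots> \<le> ?\<mu> (B k) + ennreal e" by (intro add_left_mono tail)
      finally have "?\<mu> (A \<inter> F) + ?\<mu> (A - F) \<le> ?\<mu> (A \<inter> F) + (?\<mu> (B k) + ennreal e)"
        by (rule add_left_mono)
      also have "\<dots> \<le> ?\<mu> A + ennreal e"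
        unfolding add.assoc[symmetric] by (intro add_right_mono sep)
      finally show ?thesis .
    qed
    then show ?thesis by (rule ennreal_le_epsilon)
  qed
qed

definition hmeas :: "real \<Rightarrow> 'a::metric_space measure" where
  "hmeas s = measure_of UNIV (lambda_system UNIV UNIV (hausdorff_outer s)) (hausdorff_outer s)"

lemma measure_space_hausdorff:
  "measure_space UNIV (lambda_system UNIV UNIV (hausdorff_outer s :: 'a::metric_space set \<Rightarrow> _)) (hausdorff_outer s)"
  using sigma_algebra.caratheodory_lemma[OF sigma_algebra_Pow outer_measure_hausdorff, of s]
  by (simp add: Pow_UNIV)

lemma sets_hmeas: "sets (hmeas s :: 'a::metric_space measure) = lambda_system UNIV UNIV (hausdorff_outer s)"
proof -
  have "sigma_algebra UNIV (lambda_system UNIV UNIV (hausdorff_outer s :: 'a set \<Rightarrow> _))"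
    using measure_space_hausdorff[of s] unfolding measure_space_def by blast
  then show ?thesis
    by (simp add: hmeas_def sets_measure_of_conv sigma_algebra.sigma_sets_eq)
qed

lemma space_hmeas [simp]: "space (hmeas s) = UNIV"
  by (simp add: hmeas_def space_measure_of_conv)

lemma borel_subset_hmeas:
  fixes A :: "'a::metric_space set"
  shows "0 < s \<Longrightarrow> A \<in> sets borel \<Longrightarrow> A \<in> sets (hmeas s)"
proof -
  assume s: "0 < s" and A: "A \<in> sets borel"
  have "sigma_sets UNIV (Collect closed) \<subseteq> sets (hmeas s :: 'a measure)"
  proof -
    have "Collect closed \<subseteq> sets (hmeas s :: 'a measure)"
      using closed_lambda_hausdorff[OF _ s] by (auto simp: sets_hmeas)
    from sets.sigma_sets_subset[OF this] show ?thesis by simp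
  qed
  moreover have "sets borel = sigma_sets UNIV (Collect (closed :: 'a set \<Rightarrow> bool))"
    unfolding borel_eq_closed by (simp add: sets_measure_of_conv)
  ultimately show ?thesis using A by auto
qed

lemma emeasure_hmeas: "A \<in> sets (hmeas s) \<Longrightarrow> emeasure (hmeas s) A = hausdorff_outer s A"
proof -
  assume "A \<in> sets (hmeas s)"
  then have A: "A \<in> lambda_system UNIV UNIV (hausdorff_outer s)" by (simp only: sets_hmeas)
  show ?thesis
    using measure_space_hausdorff[of s] A unfolding hmeas_def measure_space_def
    by (intro emeasure_measure_of_sigma) auto
qed

lemma hausdorff_measurable_borel:
  "0 < s \<Longrightarrow> E \<in> sets borel \<Longrightarrow> hausdorff_measurable s E"
  using borel_subset_hmeas unfolding hausdorff_measurable_def sets_hmeas by blast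


section \<open>Level sets with a transversal direction\<close>

definition Jm :: "real ^ ('n::finite + 'n) \<Rightarrow> real ^ ('n + 'n)" where
  "Jm y = (\<chi> j. case j of Inl i \<Rightarrow> y $ Inr i | Inr i \<Rightarrow> - y $ Inl i)"

lemma sympl_Jm: "sympl x y = x \<bullet> Jm y"
  by (simp add: sympl_def inner_vec_def sum_UNIV_Plus Jm_def sum_subtractf sum_negf)

lemma Jm_Jm [simp]: "Jm (Jm y) = - y"
  by (simp add: Jm_def vec_eq_iff split: sum.split)

lemma Jm_linear: "linear Jm"
  by (rule linearI) (simp_all add: Jm_def vec_eq_iff split: sum.split)

lemma norm_Jm [simp]: "norm (Jm y) = norm y"
proof -
  have "Jm y \<bullet> Jm y = y \<bullet> y"
    by (simp add: inner_vec_def sum_UNIV_Plus Jm_def)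
  then show ?thesis by (simp add: norm_eq_sqrt_inner)
qed

text \<open>The direction conjugate to \<open>e\<close> is the one whose commutator with \<open>e\<close> is the unit of the centre.\<close>

lemma ex_conjugate:
  assumes "norm e = 1" "\<bar>\<sigma>\<bar> = 1"
  shows "\<exists>u. norm u = 1 \<and> sympl e u = \<sigma>"
proof (intro exI[of _ "- \<sigma> *\<^sub>R Jm e"] conjI)
  show "norm (- \<sigma> *\<^sub>R Jm e) = 1" using assms by simp
  show "sympl e (- \<sigma> *\<^sub>R Jm e) = \<sigma>"
    using assms(1) by (simp add: sympl_simps sympl_Jm dot_square_norm linear_neg[OF Jm_linear] linear_cmul[OF Jm_linear])
qed

text \<open>\<open>S\<close> is near \<open>p\<close> the zero set of \<open>f\<close>, whose horizontal gradient \<open>G\<close> has a component in the unit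
  direction \<open>e\<close> that is bounded below. The vector \<open>N\<close> is the normal scaled so that \<open>N \<bullet> e = 1\<close>; only
  its restriction to \<open>S\<close> is assumed Hoelder continuous.\<close>

locale graded_patch =
  fixes f :: "'n::finite heis \<Rightarrow> real" and G :: "'n heis \<Rightarrow> real ^ ('n + 'n)"
    and e :: "real ^ ('n + 'n)" and p :: "'n heis" and R L c H \<alpha> :: real and S :: "'n heis set"
  assumes norm_e: "norm e = 1"
    and R: "0 < R" and c: "0 < c" and L: "0 < L" and H: "0 \<le> H" and \<alpha>: "0 < \<alpha>" "\<alpha> \<le> 1"
    and der: "\<And>q t v. q \<cdot> hexp (t *\<^sub>R v) \<in> ball p R \<Longrightarrow>
        ((\<lambda>s. f (q \<cdot> hexp (s *\<^sub>R v))) has_real_derivative G (q \<cdot> hexp (t *\<^sub>R v)) \<bullet> v) (at t)"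
    and contG: "continuous_on (ball p R) G"
    and norm_G: "\<And>q. q \<in> ball p R \<Longrightarrow> norm (G q) \<le> L"
    and G_e: "\<And>q. q \<in> ball p R \<Longrightarrow> c \<le> G q \<bullet> e"
    and S_zero: "\<And>q. q \<in> ball p R \<Longrightarrow> q \<in> S \<longleftrightarrow> f q = 0"
    and holder: "\<And>q1 q2. q1 \<in> S \<inter> ball p R \<Longrightarrow> q2 \<in> S \<inter> ball p R \<Longrightarrow>
        norm (G q1 /\<^sub>R (G q1 \<bullet> e) - G q2 /\<^sub>R (G q2 \<bullet> e)) \<le> H * dist q1 q2 powr \<alpha>"
begin

definition N :: "'n heis \<Rightarrow> real ^ ('n + 'n)" where
  "N q = G q /\<^sub>R (G q \<bullet> e)"

lemma N_e: "q \<in> ball p R \<Longrightarrow> N q \<bullet> e = 1"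
  using G_e[of q] c by (simp add: N_def)

lemma norm_N: "q \<in> ball p R \<Longrightarrow> norm (N q) \<le> L / c"
  using G_e[of q] norm_G[of q] c L by (auto simp: N_def abs_if inverse_eq_divide intro!: frac_le)

lemma N_bound: "q \<in> ball p R \<Longrightarrow> \<bar>N q \<bullet> u\<bar> \<le> L / c * norm u"
  using norm_N[of q] Cauchy_Schwarz_ineq2[of "N q" u] by (meson mult_right_mono norm_ge_zero order_trans)

lemma N_holder: "q1 \<in> S \<Longrightarrow> q1 \<in> ball p R \<Longrightarrow> q2 \<in> S \<Longrightarrow> q2 \<in> ball p R \<Longrightarrow>
    norm (N q1 - N q2) \<le> H * dist q1 q2 powr \<alpha>"
  using holder by (simp add: N_def)

lemma segment:
  assumes "dist p q + norm v < R"
  obtains t where "0 < t" "t < 1" "f (q \<cdot> hexp v) - f q = G (q \<cdot> hexp (t *\<^sub>R v)) \<bullet> v"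
    "dist q (q \<cdot> hexp (t *\<^sub>R v)) \<le> norm v"
proof -
  have d: "dist q (q \<cdot> hexp (t *\<^sub>R v)) \<le> norm v" if "0 \<le> t" "t \<le> 1" for t
    using that by (simp add: mult_left_le_one_le)
  have in_ball: "q \<cdot> hexp (t *\<^sub>R v) \<in> ball p R" if "0 \<le> t" "t \<le> 1" for t
    using d[OF that] dist_triangle[of p "q \<cdot> hexp (t *\<^sub>R v)" q] assms by simp
  have "\<exists>t>0. t < 1 \<and> f (q \<cdot> hexp (1 *\<^sub>R v)) - f (q \<cdot> hexp (0 *\<^sub>R v)) = (1 - 0) * (G (q \<cdot> hexp (t *\<^sub>R v)) \<bullet> v)"
    by (rule MVT2) (auto intro!: der in_ball)
  then show thesis using that d by auto
qed

lemma lipschitz_hexp: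
  assumes "dist p q + norm v < R"
  shows "\<bar>f (q \<cdot> hexp v) - f q\<bar> \<le> L * norm v"
proof -
  obtain t where t: "f (q \<cdot> hexp v) - f q = G (q \<cdot> hexp (t *\<^sub>R v)) \<bullet> v"
    "dist q (q \<cdot> hexp (t *\<^sub>R v)) \<le> norm v" using segment[OF assms] by metis
  then have "q \<cdot> hexp (t *\<^sub>R v) \<in> ball p R"
    using dist_triangle[of p "q \<cdot> hexp (t *\<^sub>R v)" q] assms by simp
  then show ?thesis
    using t(1) norm_G Cauchy_Schwarz_ineq2[of "G (q \<cdot> hexp (t *\<^sub>R v))" v]
    by (metis (no_types, lifting) mult_right_mono norm_ge_zero order_trans)
qed

lemma increasing_e:
  assumes "dist p q + s < R" "0 \<le> s"
  shows "c * s \<le> f (q \<cdot> hexp (s *\<^sub>R e)) - f q"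
proof -
  have "dist p q + norm (s *\<^sub>R e) < R" using assms norm_e by simp
  then obtain t where t: "f (q \<cdot> hexp (s *\<^sub>R e)) - f q = G (q \<cdot> hexp (t *\<^sub>R s *\<^sub>R e)) \<bullet> (s *\<^sub>R e)"
    "dist q (q \<cdot> hexp (t *\<^sub>R s *\<^sub>R e)) \<le> norm (s *\<^sub>R e)" using segment by metis
  then have "q \<cdot> hexp (t *\<^sub>R s *\<^sub>R e) \<in> ball p R"
    using dist_triangle[of p "q \<cdot> hexp (t *\<^sub>R s *\<^sub>R e)" q] assms norm_e by simp
  from mult_left_mono[OF G_e[OF this] assms(2)] show ?thesis
    using t(1) by (simp add: mult.commute)
qed

text \<open>A vertical displacement is a commutator of horizontal ones of length the square root of its
  size, so bounds on the horizontal gradient give a bound in the metric.\<close>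

lemma lipschitz_f:
  assumes "dist p x + 3 * dist x y < R"
  shows "\<bar>f y - f x\<bar> \<le> 3 * L * dist x y"
proof -
  define z where "z = heis_inv x \<cdot> y"
  define a where "a = sqrt \<bar>vert z\<bar>"
  have "\<exists>u. norm u = 1 \<and> sympl e u = (if 0 \<le> vert z then 1 else -1)"
    by (rule ex_conjugate[OF norm_e]) simp
  then obtain u where u: "norm u = 1" "sympl e u = (if 0 \<le> vert z then 1 else -1)" by blast
  have a2: "a * a * sympl e u = vert z" by (simp add: a_def u)
  have a0: "0 \<le> a" by (simp add: a_def)
  define x1 where "x1 = x \<cdot> hexp (hor z)"
  define x2 where "x2 = x1 \<cdot> hexp (a *\<^sub>R e)"
  define x3 where "x3 = x2 \<cdot> hexp (a *\<^sub>R u)"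
  define x4 where "x4 = x3 \<cdot> hexp (- a *\<^sub>R e)"
  define x5 where "x5 = x4 \<cdot> hexp (- a *\<^sub>R u)"
  have "hexp (hor z) \<cdot> (hexp (a *\<^sub>R e) \<cdot> (hexp (a *\<^sub>R u) \<cdot> (hexp (- a *\<^sub>R e) \<cdot> hexp (- a *\<^sub>R u)))) = z"
    using a2 by (intro heis_eqI) (simp_all add: sympl_simps sympl_commute[of u e] algebra_simps)
  then have "x5 = x \<cdot> z" by (simp only: x5_def x4_def x3_def x2_def x1_def heis_assoc)
  then have x5: "x5 = y" by (simp add: z_def)
  have len: "norm (hor z) + 4 * a \<le> 3 * dist x y"
    using norm_hor_le[of z] sqrt_vert_le[of z] by (simp add: a_def dist_heis z_def)
  have d1: "dist p x1 \<le> dist p x + norm (hor z)" using dist_triangle[of p x1 x] by (simp add: x1_def)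
  have d2: "dist p x2 \<le> dist p x1 + a" using dist_triangle[of p x2 x1] a0 norm_e by (simp add: x2_def)
  have d3: "dist p x3 \<le> dist p x2 + a" using dist_triangle[of p x3 x2] a0 u by (simp add: x3_def)
  have d4: "dist p x4 \<le> dist p x3 + a" using dist_triangle[of p x4 x3] a0 norm_e by (simp add: x4_def)
  have "\<bar>f x1 - f x\<bar> \<le> L * norm (hor z)"
    unfolding x1_def using len a0 assms by (intro lipschitz_hexp) linarith
  moreover have "\<bar>f x2 - f x1\<bar> \<le> L * norm (a *\<^sub>R e)"
    unfolding x2_def using len a0 assms d1 norm_e by (intro lipschitz_hexp) simp
  moreover have "\<bar>f x3 - f x2\<bar> \<le> L * norm (a *\<^sub>R u)"
    unfolding x3_def using len a0 assms d1 d2 u by (intro lipschitz_hexp) simp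
  moreover have "\<bar>f x4 - f x3\<bar> \<le> L * norm (- a *\<^sub>R e)"
    unfolding x4_def using len a0 assms d1 d2 d3 norm_e by (intro lipschitz_hexp) simp
  moreover have "\<bar>f x5 - f x4\<bar> \<le> L * norm (- a *\<^sub>R u)"
    unfolding x5_def using len a0 assms d1 d2 d3 d4 u by (intro lipschitz_hexp) simp
  ultimately have "\<bar>f x5 - f x\<bar> \<le> L * (norm (hor z) + 4 * a)"
    using a0 norm_e u by (simp add: algebra_simps)
  also have "\<dots> \<le> L * (3 * dist x y)" using len L by (intro mult_left_mono) auto
  finally show ?thesis by (simp add: x5)
qed

text \<open>One step of a discrete flow inside \<open>S\<close>: move in direction \<open>u\<close>, then return to \<open>S\<close> along \<open>e\<close>.
  The intermediate value theorem provides the return, and uniform continuity of \<open>G\<close> determines its length to first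
  order, uniformly in the starting point.\<close>

lemma surface_step:
  assumes \<delta>: "0 < \<delta>" "\<delta> \<le> 1"
  shows "\<exists>\<eta>0>0. \<forall>\<eta> q u. 0 < \<eta> \<longrightarrow> \<eta> < \<eta>0 \<longrightarrow> q \<in> S \<longrightarrow> dist p q \<le> R / 2 \<longrightarrow> norm u = 1 \<longrightarrow>
    (\<exists>\<mu>. q \<cdot> hexp (\<eta> *\<^sub>R u) \<cdot> hexp (\<mu> *\<^sub>R e) \<in> S \<and> \<bar>\<mu> + \<eta> * (N q \<bullet> u)\<bar> \<le> \<delta> * \<eta>)"
proof -
  define K where "K = 2 + L / c"
  have K: "1 < K" using L c by (simp add: K_def add_pos_pos)
  define \<delta>' where "\<delta>' = \<delta> * c / K"
  have \<delta>': "0 < \<delta>'" using \<delta> c K by (simp add: \<delta>'_def)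
  have sub: "cball p (3 * R / 4) \<subseteq> ball p R" using R by auto
  have "uniformly_continuous_on (cball p (3 * R / 4)) G"
    by (intro compact_uniformly_continuous compact_cball_heis continuous_on_subset[OF contG sub])
  then obtain \<eta>' where \<eta>': "0 < \<eta>'"
    "\<And>x y. x \<in> cball p (3 * R / 4) \<Longrightarrow> y \<in> cball p (3 * R / 4) \<Longrightarrow> dist y x < \<eta>' \<Longrightarrow> dist (G y) (G x) < \<delta>'"
    using \<delta>' unfolding uniformly_continuous_on_def by metis
  define \<eta>0 where "\<eta>0 = min \<eta>' (R / 4) / K"
  have "\<exists>\<mu>. q \<cdot> hexp (\<eta> *\<^sub>R u) \<cdot> hexp (\<mu> *\<^sub>R e) \<in> S \<and> \<bar>\<mu> + \<eta> * (N q \<bullet> u)\<bar> \<le> \<delta> * \<eta>"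
    if \<eta>: "0 < \<eta>" "\<eta> < \<eta>0" and q: "q \<in> S" "dist p q \<le> R / 2" and u: "norm u = 1" for \<eta> q u
  proof -
    have K\<eta>: "K * \<eta> < \<eta>'" "K * \<eta> < R / 4"
      using \<eta>(2) K by (auto simp: \<eta>0_def field_simps)
    have qb: "q \<in> ball p R" using q R by simp
    have fq: "f q = 0" using S_zero[OF qb] q by simp
    define q1 where "q1 = q \<cdot> hexp (\<eta> *\<^sub>R u)"
    have dq1: "dist q q1 = \<eta>" using u \<eta> by (simp add: q1_def)
    have close: "norm (G x - G q) \<le> \<delta>'" if "dist q x \<le> K * \<eta>" for x
    proof -
      have "dist p x \<le> 3 * R / 4" using dist_triangle[of p x q] that K\<eta> q by simp
      moreover have "dist p q \<le> 3 * R / 4" using q R by simp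
      ultimately show ?thesis using \<eta>'(2)[of q x] that K\<eta> by (simp add: dist_norm dist_commute)
    qed
    have "\<eta> \<le> K * \<eta>" using K \<eta> by simp
    have "dist p q + \<eta> < R"
      using q(2) K\<eta>(2) R \<open>\<eta> \<le> K * \<eta>\<close> by linarith
    then have "dist p q + norm (\<eta> *\<^sub>R u) < R" using u \<eta> by simp
    then obtain t where t: "f q1 - f q = G (q \<cdot> hexp (t *\<^sub>R \<eta> *\<^sub>R u)) \<bullet> (\<eta> *\<^sub>R u)"
      "dist q (q \<cdot> hexp (t *\<^sub>R \<eta> *\<^sub>R u)) \<le> norm (\<eta> *\<^sub>R u)"
      unfolding q1_def using segment by metis
    have "\<bar>f q1 - \<eta> * (G q \<bullet> u)\<bar> \<le> \<eta> * \<delta>'"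
    proof -
      let ?x = "q \<cdot> hexp (t *\<^sub>R \<eta> *\<^sub>R u)"
      have "norm (\<eta> *\<^sub>R u) = \<eta>" using u \<eta> by simp
      then have "norm (G ?x - G q) \<le> \<delta>'"
        by (intro close order_trans[OF t(2)]) (simp only: \<open>\<eta> \<le> K * \<eta>\<close>)
      then have "\<bar>(G ?x - G q) \<bullet> u\<bar> \<le> \<delta>'"
        using Cauchy_Schwarz_ineq2[of "G ?x - G q" u] u by simp
      moreover have "f q1 - \<eta> * (G q \<bullet> u) = \<eta> * ((G ?x - G q) \<bullet> u)"
        using t(1) fq by (simp add: inner_diff_left right_diff_distrib)
      ultimately show ?thesis using \<eta> by (simp add: abs_mult)
    qed
    note f1 = this
    have f2: "\<bar>f (q1 \<cdot> hexp (\<mu> *\<^sub>R e)) - (\<eta> * (G q \<bullet> u) + \<mu> * (G q \<bullet> e))\<bar> \<le> \<delta>' * (K * \<eta>)"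
      if \<mu>: "\<bar>\<mu>\<bar> \<le> (K - 1) * \<eta>" for \<mu>
    proof -
      have n: "norm (\<mu> *\<^sub>R e) = \<bar>\<mu>\<bar>" using norm_e by simp
      have "dist p q1 + norm (\<mu> *\<^sub>R e) < R"
        using dist_triangle[of p q1 q] dq1 q \<mu> K\<eta> R unfolding n by (simp add: algebra_simps)
      then obtain t where t: "f (q1 \<cdot> hexp (\<mu> *\<^sub>R e)) - f q1 = G (q1 \<cdot> hexp (t *\<^sub>R \<mu> *\<^sub>R e)) \<bullet> (\<mu> *\<^sub>R e)"
        "dist q1 (q1 \<cdot> hexp (t *\<^sub>R \<mu> *\<^sub>R e)) \<le> norm (\<mu> *\<^sub>R e)"
        using segment by metis
      let ?x = "q1 \<cdot> hexp (t *\<^sub>R \<mu> *\<^sub>R e)"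
      have "dist q ?x \<le> K * \<eta>"
        using dist_triangle[of q ?x q1] dq1 t(2) \<mu> unfolding n by (simp add: algebra_simps)
      then have "\<bar>(G ?x - G q) \<bullet> e\<bar> \<le> \<delta>'"
        using Cauchy_Schwarz_ineq2[of "G ?x - G q" e] norm_e close[of ?x] by simp
      then have "\<bar>\<mu> * ((G ?x - G q) \<bullet> e)\<bar> \<le> (K - 1) * \<eta> * \<delta>'"
        unfolding abs_mult using \<mu> K \<eta> by (intro mult_mono) auto
      moreover have "f (q1 \<cdot> hexp (\<mu> *\<^sub>R e)) - (\<eta> * (G q \<bullet> u) + \<mu> * (G q \<bullet> e))
          = (f q1 - \<eta> * (G q \<bullet> u)) + \<mu> * ((G ?x - G q) \<bullet> e)"
        using t(1) by (simp add: inner_diff_left algebra_simps)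
      ultimately show ?thesis using f1 by (simp add: algebra_simps)
    qed
    let ?m = "- \<eta> * (N q \<bullet> u)"
    have Ge: "c \<le> G q \<bullet> e" by (rule G_e[OF qb])
    have mG: "?m * (G q \<bullet> e) = - \<eta> * (G q \<bullet> u)"
      using Ge c by (simp add: N_def)
    have m: "\<bar>?m + s\<bar> \<le> (K - 1) * \<eta>" if "\<bar>s\<bar> \<le> \<delta> * \<eta>" for s
    proof -
      have "\<bar>?m\<bar> \<le> \<eta> * (L / c)" using mult_left_mono[OF N_bound[OF qb, of u], of \<eta>] u \<eta> by (simp add: abs_mult)
      moreover have "\<delta> * \<eta> \<le> \<eta>" using \<delta> \<eta> by simp
      ultimately have "\<bar>?m + s\<bar> \<le> \<eta> * (L / c) + \<eta>" using that by linarith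
      then show ?thesis by (simp add: K_def algebra_simps)
    qed
    have key: "\<delta>' * (K * \<eta>) \<le> \<delta> * \<eta> * (G q \<bullet> e)"
    proof -
      have "\<delta>' * (K * \<eta>) = \<delta> * \<eta> * c" using K by (simp add: \<delta>'_def)
      then show ?thesis using Ge \<delta> \<eta> by simp
    qed
    have E: "\<bar>f (q1 \<cdot> hexp ((?m + s) *\<^sub>R e)) - s * (G q \<bullet> e)\<bar> \<le> \<delta> * \<eta> * (G q \<bullet> e)"
      if "\<bar>s\<bar> \<le> \<delta> * \<eta>" for s
    proof -
      have "\<eta> * (G q \<bullet> u) + (?m + s) * (G q \<bullet> e) = s * (G q \<bullet> e)"
        using mG unfolding distrib_right by linarith
      then show ?thesis using order_trans[OF f2[OF m[OF that]] key] by simp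
    qed
    have "\<exists>\<mu>\<ge>?m - \<delta> * \<eta>. \<mu> \<le> ?m + \<delta> * \<eta> \<and> f (q1 \<cdot> hexp (\<mu> *\<^sub>R e)) = 0"
    proof (rule IVT')
      show "f (q1 \<cdot> hexp ((?m - \<delta> * \<eta>) *\<^sub>R e)) \<le> 0"
      proof -
        have "\<bar>- (\<delta> * \<eta>)\<bar> \<le> \<delta> * \<eta>" using \<delta> \<eta> by simp
        from E[OF this] have "f (q1 \<cdot> hexp ((?m + - (\<delta> * \<eta>)) *\<^sub>R e)) \<le> 0"
          by (simp only: abs_le_iff mult_minus_left) linarith
        then show ?thesis by (simp only: diff_conv_add_uminus)
      qed
      show "0 \<le> f (q1 \<cdot> hexp ((?m + \<delta> * \<eta>) *\<^sub>R e))"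
        using E[of "\<delta> * \<eta>"] \<delta> \<eta> by simp
      show "?m - \<delta> * \<eta> \<le> ?m + \<delta> * \<eta>" using \<delta> \<eta> by simp
      show "continuous_on {?m - \<delta> * \<eta>..?m + \<delta> * \<eta>} (\<lambda>\<mu>. f (q1 \<cdot> hexp (\<mu> *\<^sub>R e)))"
      proof (rule continuous_at_imp_continuous_on, rule ballI)
        fix \<mu> assume "\<mu> \<in> {?m - \<delta> * \<eta>..?m + \<delta> * \<eta>}"
        then have "\<bar>\<mu> - ?m\<bar> \<le> \<delta> * \<eta>" unfolding atLeastAtMost_iff by linarith
        then have "\<bar>\<mu>\<bar> \<le> (K - 1) * \<eta>" using m[of "\<mu> - ?m"] by simp
        then have "q1 \<cdot> hexp (\<mu> *\<^sub>R e) \<in> ball p R"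
          using dist_triangle[of p "q1 \<cdot> hexp (\<mu> *\<^sub>R e)" q1] dist_triangle[of p q1 q] dq1 q K\<eta> R norm_e
          by (simp add: algebra_simps)
        then show "isCont (\<lambda>\<mu>. f (q1 \<cdot> hexp (\<mu> *\<^sub>R e))) \<mu>" by (rule DERIV_isCont[OF der])
      qed
    qed
    then obtain \<mu> where \<mu>0: "?m - \<delta> * \<eta> \<le> \<mu>" "\<mu> \<le> ?m + \<delta> * \<eta>"
      and \<mu>2: "f (q1 \<cdot> hexp (\<mu> *\<^sub>R e)) = 0" by blast
    have \<mu>: "\<bar>\<mu> - ?m\<bar> \<le> \<delta> * \<eta>" "f (q1 \<cdot> hexp (\<mu> *\<^sub>R e)) = 0"
      using \<mu>0 \<mu>2 by linarith+
    have "\<bar>\<mu>\<bar> \<le> (K - 1) * \<eta>" using m[of "\<mu> - ?m"] \<mu>(1) by simp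
    then have "q1 \<cdot> hexp (\<mu> *\<^sub>R e) \<in> ball p R"
      using dist_triangle[of p "q1 \<cdot> hexp (\<mu> *\<^sub>R e)" q1] dist_triangle[of p q1 q] dq1 q K\<eta> R norm_e
      by (simp add: algebra_simps)
    then have "q1 \<cdot> hexp (\<mu> *\<^sub>R e) \<in> S" using S_zero \<mu>(2) by blast
    then show ?thesis using \<mu>(1) unfolding q1_def by (intro exI[of _ \<mu>]) simp
  qed
  moreover have "0 < \<eta>0" using \<eta>'(1) R K by (simp add: \<eta>0_def)
  ultimately show ?thesis by blast
qed

end


section \<open>Power-rate flatness\<close>

text \<open>The gain in the exponent that survives the passage from the Hoelder continuity of the normal
  to the flatness of the surface.\<close>

definition (in graded_patch) \<beta> :: real where "\<beta> = \<alpha> / 3"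

context graded_patch begin

text \<open>A bound for the distance covered by the discrete flow per unit of time.\<close>

definition speed :: real where "speed = 2 + L / c"

lemma speed: "1 < speed" using L c by (simp add: speed_def add_pos_pos)

lemma \<beta>: "0 < \<beta>" "\<beta> \<le> 1 / 3" using \<alpha> by (simp_all add: \<beta>_def)

lemma N_near:
  assumes "q1 \<in> S" "q1 \<in> ball p R" "q2 \<in> S" "q2 \<in> ball p R" "dist q1 q2 \<le> d"
  shows "norm (N q2 - N q1) \<le> H * d powr \<alpha>"
proof -
  have "norm (N q2 - N q1) \<le> H * dist q1 q2 powr \<alpha>"
    using N_holder[OF assms(1-4)] by (simp add: norm_minus_commute)
  also have "\<dots> \<le> H * d powr \<alpha>"
    using H \<alpha> assms(5) by (intro mult_left_mono powr_mono2) auto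
  finally show ?thesis .
qed

text \<open>The return lengths are given as a function \<open>\<mu>\<close> of the point, so that a step is a map, which can be iterated.\<close>

definition is_step :: "real \<Rightarrow> real \<Rightarrow> real ^ ('n + 'n) \<Rightarrow> ('n heis \<Rightarrow> real) \<Rightarrow> bool" where
  "is_step \<delta> \<eta> u \<mu> \<longleftrightarrow> (\<forall>q\<in>S. dist p q \<le> R / 2 \<longrightarrow>
     q \<cdot> hexp (\<eta> *\<^sub>R u) \<cdot> hexp (\<mu> q *\<^sub>R e) \<in> S \<and> \<bar>\<mu> q + \<eta> * (N q \<bullet> u)\<bar> \<le> \<delta> * \<eta>)"

definition step :: "real \<Rightarrow> real ^ ('n + 'n) \<Rightarrow> ('n heis \<Rightarrow> real) \<Rightarrow> 'n heis \<Rightarrow> 'n heis" where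
  "step \<eta> u \<mu> q = q \<cdot> hexp (\<eta> *\<^sub>R u) \<cdot> hexp (\<mu> q *\<^sub>R e)"

lemma ex_step:
  assumes "0 < \<delta>" "\<delta> \<le> 1"
  shows "\<exists>\<eta>0>0. \<forall>\<eta> u. 0 < \<eta> \<longrightarrow> \<eta> < \<eta>0 \<longrightarrow> norm u = 1 \<longrightarrow> (\<exists>\<mu>. is_step \<delta> \<eta> u \<mu>)"
proof -
  obtain \<eta>0 where \<eta>0: "\<eta>0 > 0" "\<And>\<eta> q u. 0 < \<eta> \<Longrightarrow> \<eta> < \<eta>0 \<Longrightarrow> q \<in> S \<Longrightarrow> dist p q \<le> R / 2 \<Longrightarrow> norm u = 1 \<Longrightarrow>
      \<exists>\<mu>. q \<cdot> hexp (\<eta> *\<^sub>R u) \<cdot> hexp (\<mu> *\<^sub>R e) \<in> S \<and> \<bar>\<mu> + \<eta> * (N q \<bullet> u)\<bar> \<le> \<delta> * \<eta>"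
    using surface_step[OF assms] by metis
  have "\<exists>\<mu>. is_step \<delta> \<eta> u \<mu>" if "0 < \<eta>" "\<eta> < \<eta>0" "norm u = 1" for \<eta> u
  proof -
    have "\<forall>q. \<exists>\<mu>. q \<in> S \<longrightarrow> dist p q \<le> R / 2 \<longrightarrow>
        q \<cdot> hexp (\<eta> *\<^sub>R u) \<cdot> hexp (\<mu> *\<^sub>R e) \<in> S \<and> \<bar>\<mu> + \<eta> * (N q \<bullet> u)\<bar> \<le> \<delta> * \<eta>"
      using \<eta>0(2)[OF that(1,2)] that(3) by blast
    then show ?thesis unfolding is_step_def by metis
  qed
  then show ?thesis using \<eta>0(1) by blast
qed

lemma step_size:
  assumes st: "is_step \<delta> \<eta> u \<mu>" and "0 < \<eta>" "\<delta> \<le> 1" "norm u = 1" and q: "q \<in> S" "dist p q \<le> R / 2"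
  shows "dist q (step \<eta> u \<mu> q) \<le> speed * \<eta>"
proof -
  have qb: "q \<in> ball p R" using q R by simp
  have "\<bar>\<mu> q + \<eta> * (N q \<bullet> u)\<bar> \<le> \<delta> * \<eta>" using st q by (simp add: is_step_def)
  moreover have "\<delta> * \<eta> \<le> \<eta>" using assms by simp
  moreover have "\<bar>\<eta> * (N q \<bullet> u)\<bar> \<le> \<eta> * (L / c)"
    using mult_left_mono[OF N_bound[OF qb, of u], of \<eta>] assms by (simp add: abs_mult)
  ultimately have \<mu>: "\<bar>\<mu> q\<bar> \<le> \<eta> * (L / c) + \<eta>" by linarith
  have "dist q (step \<eta> u \<mu> q) \<le> dist q (q \<cdot> hexp (\<eta> *\<^sub>R u)) + dist (q \<cdot> hexp (\<eta> *\<^sub>R u)) (step \<eta> u \<mu> q)"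
    by (rule dist_triangle)
  also have "\<dots> = \<eta> + \<bar>\<mu> q\<bar>" using assms norm_e by (simp add: step_def)
  finally show ?thesis using \<mu> by (simp add: speed_def algebra_simps)
qed

lemma chain:
  assumes st: "is_step \<delta> \<eta> u \<mu>" and \<eta>: "0 < \<eta>" "\<delta> \<le> 1" "norm u = 1"
    and q: "q \<in> S" "dist p q \<le> R / 4" and k: "speed * (real k * \<eta>) \<le> R / 4"
  shows "(step \<eta> u \<mu> ^^ k) q \<in> S" (is ?A) and "dist q ((step \<eta> u \<mu> ^^ k) q) \<le> speed * (real k * \<eta>)" (is ?B)
    and "dist p ((step \<eta> u \<mu> ^^ k) q) \<le> R / 2" (is ?C)
proof -
  have "?A \<and> ?B \<and> ?C" using k
  proof (induction k)
    case 0
    then show ?case using q R by simp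
  next
    case (Suc k)
    let ?q = "(step \<eta> u \<mu> ^^ k) q"
    have "speed * (real k * \<eta>) \<le> speed * (real (Suc k) * \<eta>)"
      using speed \<eta> by simp
    then have IH: "?q \<in> S" "dist q ?q \<le> speed * (real k * \<eta>)" "dist p ?q \<le> R / 2"
      using Suc by auto
    have 1: "step \<eta> u \<mu> ?q \<in> S" using st IH by (simp add: is_step_def step_def)
    have "dist q (step \<eta> u \<mu> ?q) \<le> speed * (real k * \<eta>) + speed * \<eta>"
      using dist_triangle[of q "step \<eta> u \<mu> ?q" ?q] step_size[OF st \<eta> IH(1,3)] IH(2) by linarith
    then have 2: "dist q (step \<eta> u \<mu> ?q) \<le> speed * (real (Suc k) * \<eta>)"
      by (simp add: algebra_simps)
    have 3: "dist p (step \<eta> u \<mu> ?q) \<le> R / 2"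
      using dist_triangle[of p "step \<eta> u \<mu> ?q" q] 2 Suc.prems q by linarith
    show ?case using 1 2 3 by simp
  qed
  then show ?A ?B ?C by auto
qed

text \<open>A step moves two points of \<open>S\<close> whose difference lies in the plane of \<open>e\<close> and the centre so
  that the central part of the difference changes at a rate given by the part along \<open>e\<close>: this is
  the characteristic structure of Burgers' equation.\<close>

lemma step_difference:
  assumes "q' = q \<cdot> Heis (D *\<^sub>R e, \<tau>)"
  shows "step \<eta> u \<mu> q' = step \<eta> u \<mu> q \<cdot> Heis ((D + (\<mu> q' - \<mu> q)) *\<^sub>R e, \<tau> + \<eta> * sympl e u * D)"
  unfolding step_def assms[symmetric]
proof (rule heis_eqI)
  have q': "hor q' = hor q + D *\<^sub>R e" "vert q' = vert q + \<tau> + D * sympl (hor q) e / 2"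
    by (simp_all add: assms sympl_simps)
  show "hor (q' \<cdot> hexp (\<eta> *\<^sub>R u) \<cdot> hexp (\<mu> q' *\<^sub>R e)) =
    hor (q \<cdot> hexp (\<eta> *\<^sub>R u) \<cdot> hexp (\<mu> q *\<^sub>R e) \<cdot> Heis ((D + (\<mu> q' - \<mu> q)) *\<^sub>R e, \<tau> + \<eta> * sympl e u * D))"
    by (simp add: q' algebra_simps)
  show "vert (q' \<cdot> hexp (\<eta> *\<^sub>R u) \<cdot> hexp (\<mu> q' *\<^sub>R e)) =
    vert (q \<cdot> hexp (\<eta> *\<^sub>R u) \<cdot> hexp (\<mu> q *\<^sub>R e) \<cdot> Heis ((D + (\<mu> q' - \<mu> q)) *\<^sub>R e, \<tau> + \<eta> * sympl e u * D))"
    using sympl_commute[of u e] by (simp add: q' sympl_simps) (simp add: field_simps)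
qed

text \<open>The exponent \<open>\<beta> = \<alpha> / 3\<close> is chosen so that the time \<open>s = r powr (1 - \<beta>)\<close> is short enough for the Hoelder error
  accumulated over it to stay below \<open>r powr (1 + \<beta>)\<close>, and long enough for a drift of speed
  \<open>r powr (1 + \<beta>)\<close> to cover a central displacement \<open>r\<^sup>2\<close>.\<close>

lemma powr_exponent_bounds:
  assumes r: "0 < r" "r \<le> 1"
  defines "s \<equiv> r powr (1 - \<beta>)"
  shows "s * s powr \<alpha> \<le> r powr (1 + \<beta>)" "s * r powr \<alpha> \<le> r powr (1 + \<beta>)" "r powr (1 + \<beta>) * s = r ^ 2"
proof -
  have "(1 - \<beta>) + (1 - \<beta>) * \<alpha> - (1 + \<beta>) = \<beta> * (1 - \<alpha>)" by (simp add: \<beta>_def field_simps)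
  moreover have "0 \<le> \<beta> * (1 - \<alpha>)" using \<beta> \<alpha> by simp
  ultimately have "1 + \<beta> \<le> (1 - \<beta>) + (1 - \<beta>) * \<alpha>" by linarith
  then show "s * s powr \<alpha> \<le> r powr (1 + \<beta>)"
    using r powr_mono'[of "1 + \<beta>" "(1 - \<beta>) + (1 - \<beta>) * \<alpha>" r] by (simp add: s_def powr_powr powr_add[symmetric])
  have "1 + \<beta> \<le> 1 - \<beta> + \<alpha>" using \<alpha> by (simp add: \<beta>_def)
  then show "s * r powr \<alpha> \<le> r powr (1 + \<beta>)"
    using r powr_mono'[of "1 + \<beta>" "1 - \<beta> + \<alpha>" r] by (simp add: s_def powr_add[symmetric])
  show "r powr (1 + \<beta>) * s = r ^ 2"
  proof -
    have "r powr (1 + \<beta>) * s = r powr ((1 + \<beta>) + (1 - \<beta>))" by (simp only: s_def powr_add)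
    also have "(1 + \<beta>) + (1 - \<beta>) = 2" by simp
    also have "r powr 2 = r ^ 2" using r by simp
    finally show ?thesis .
  qed
qed

text \<open>If two points of \<open>S\<close> differed along \<open>e\<close> by much more than \<open>r powr (1 + \<beta>)\<close>, the discrete flow
  in the direction conjugate to \<open>e\<close> would bring them onto a common line in direction \<open>e\<close>
  within time \<open>r powr (1 - \<beta>)\<close>, before the difference along \<open>e\<close> could change appreciably. But \<open>f\<close>
  is strictly increasing along such a line.\<close>

lemma transversal_difference_pos:
  obtains K r0 where "0 < K" "0 < r0" "r0 \<le> 1"
    "\<And>x y D \<tau> r. x \<in> S \<Longrightarrow> y \<in> S \<Longrightarrow> dist p x \<le> R / 4 \<Longrightarrow> dist p y \<le> R / 4 \<Longrightarrow>
      y = x \<cdot> Heis (D *\<^sub>R e, \<tau>) \<Longrightarrow> 0 < r \<Longrightarrow> r \<le> r0 \<Longrightarrow> \<bar>\<tau>\<bar> \<le> r\<^sup>2 \<Longrightarrow> dist x y \<le> r \<Longrightarrow>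
      D \<le> K * r powr (1 + \<beta>)"
proof -
  \<comment> \<open>\<open>C * r powr (1 + \<beta>)\<close> bounds the change of the difference along \<open>e\<close> during the flow\<close>
  define C where "C = 2 * H * speed powr \<alpha> + H + 2"
  have C: "2 \<le> C" using H speed by (simp add: C_def)
  define K where "K = 2 * C"
  have K: "4 \<le> K" using C by (simp add: K_def)
  define b where "b = min 1 (min (R / (4 * speed)) (R / 8))"
  have b: "0 < b" "b \<le> 1" "b \<le> R / (4 * speed)" "b \<le> R / 8" using R speed by (auto simp: b_def)
  define r0 where "r0 = b powr (1 / (1 - \<beta>))"
  have r0: "0 < r0" "r0 \<le> 1" "r0 powr (1 - \<beta>) = b" using b \<beta> by (auto simp: r0_def powr_le1 powr_powr)
  show thesis
  proof (rule that[of K r0])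
    fix x y D \<tau> r
    assume x: "x \<in> S" "dist p x \<le> R / 4" and y: "y \<in> S" "dist p y \<le> R / 4"
      and yx: "y = x \<cdot> Heis (D *\<^sub>R e, \<tau>)" and r: "0 < r" "r \<le> r0" and \<tau>: "\<bar>\<tau>\<bar> \<le> r\<^sup>2" and xy: "dist x y \<le> r"
    have r1: "r \<le> 1" using r r0 by simp
    define s where "s = r powr (1 - \<beta>)"
    note s_bounds = powr_exponent_bounds[OF r(1) r1, folded s_def]
    have s0: "0 < s" using r by (simp add: s_def)
    have sb: "s \<le> b" unfolding s_def r0(3)[symmetric] using r \<beta> by (intro powr_mono2) auto
    have sR: "speed * s \<le> R / 4"
      using mult_left_mono[OF order_trans[OF sb b(3)], of speed] speed by simp
    have rs: "r \<le> s" using powr_mono'[of "1 - \<beta>" 1 r] \<beta> r r1 by (simp add: s_def)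
    show "D \<le> K * r powr (1 + \<beta>)"
    proof (rule ccontr)
      assume "\<not> D \<le> K * r powr (1 + \<beta>)"
      then have D: "K * r powr (1 + \<beta>) < D" by simp
      have D0: "0 < D" using D K r by (smt (verit) mult_nonneg_nonneg powr_ge_zero)
      have Dr: "D \<le> r"
      proof -
        have "norm (D *\<^sub>R e) \<le> dist x y"
          using norm_hor_le[of "Heis (D *\<^sub>R e, \<tau>)"] by (simp add: yx)
        then show ?thesis using xy D0 norm_e by simp
      qed
      define \<delta> where "\<delta> = r powr \<alpha>"
      have \<delta>: "0 < \<delta>" "\<delta> \<le> 1" using r r1 \<alpha> by (auto simp: \<delta>_def powr_le1)
      obtain \<eta>0 where \<eta>0: "\<eta>0 > 0" "\<And>\<eta> u. 0 < \<eta> \<Longrightarrow> \<eta> < \<eta>0 \<Longrightarrow> norm u = 1 \<Longrightarrow> \<exists>\<mu>. is_step \<delta> \<eta> u \<mu>"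
        using ex_step[OF \<delta>] by blast
      \<comment> \<open>The second bound on the step makes the central difference at the crossing time, which one step can
         overshoot, negligible for the Lipschitz estimate of \<open>f\<close>.\<close>
      define \<eta>1 where "\<eta>1 = min \<eta>0 (c\<^sup>2 * D / (300 * L\<^sup>2))"
      have \<eta>1: "0 < \<eta>1" using \<eta>0 c D0 L by (simp add: \<eta>1_def)
      obtain n :: nat where n: "s / \<eta>1 < real n" using reals_Archimedean2 by blast
      have n0: "0 < n" using n s0 \<eta>1 by (metis divide_pos_pos gr0I not_less_iff_gr_or_eq of_nat_0)
      define \<eta> where "\<eta> = s / n"
      have \<eta>: "0 < \<eta>" "\<eta> < \<eta>0" "\<eta> < c\<^sup>2 * D / (300 * L\<^sup>2)"
      proof -
        have "\<eta> < \<eta>1" using n n0 \<eta>1 by (simp add: \<eta>_def field_simps)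
        then show "\<eta> < \<eta>0" "\<eta> < c\<^sup>2 * D / (300 * L\<^sup>2)" by (auto simp: \<eta>1_def)
        show "0 < \<eta>" using s0 n0 by (simp add: \<eta>_def)
      qed
      have n\<eta>: "real n * \<eta> = s" using n0 by (simp add: \<eta>_def)
      \<comment> \<open>the sign for which the flow decreases the central difference\<close>
      define \<sigma> :: real where "\<sigma> = (if 0 \<le> \<tau> then 1 else -1)"
      have \<sigma>: "\<bar>\<sigma>\<bar> = 1" "\<sigma> * \<sigma> = 1" "\<sigma> * \<tau> = \<bar>\<tau>\<bar>" by (auto simp: \<sigma>_def)
      obtain u where u: "norm u = 1" "sympl e u = - \<sigma>"
        using ex_conjugate[OF norm_e, of "- \<sigma>"] \<sigma> by auto
      obtain \<mu> where st: "is_step \<delta> \<eta> u \<mu>" using \<eta>0(2)[OF \<eta>(1,2) u(1)] by blast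
      define X where "X k = (step \<eta> u \<mu> ^^ k) x" for k
      define Y where "Y k = (step \<eta> u \<mu> ^^ k) y" for k
      define d where "d k = D + (\<Sum>j<k. \<mu> (Y j) - \<mu> (X j))" for k
      define t where "t k = \<tau> - \<sigma> * \<eta> * (\<Sum>j<k. d j)" for k
      have kR: "speed * (real k * \<eta>) \<le> R / 4" "speed * (real k * \<eta>) \<le> speed * s" if "k \<le> n" for k
      proof -
        have "real k * \<eta> \<le> s" using that \<eta>(1) unfolding n\<eta>[symmetric] by simp
        then show "speed * (real k * \<eta>) \<le> speed * s" using speed by simp
        then show "speed * (real k * \<eta>) \<le> R / 4" using sR by linarith
      qed
      have X: "X k \<in> S" "dist x (X k) \<le> speed * s" "dist p (X k) \<le> R / 2" if "k \<le> n" for k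
        using chain[OF st \<eta>(1) \<delta>(2) u(1) x kR(1)[OF that]] kR(2)[OF that] by (auto simp: X_def)
      have Y: "Y k \<in> S" "dist y (Y k) \<le> speed * s" "dist p (Y k) \<le> R / 2" if "k \<le> n" for k
        using chain[OF st \<eta>(1) \<delta>(2) u(1) y kR(1)[OF that]] kR(2)[OF that] by (auto simp: Y_def)
      have XY: "Y k = X k \<cdot> Heis (d k *\<^sub>R e, t k)" for k
      proof (induction k)
        case 0
        then show ?case by (simp add: X_def Y_def d_def t_def yx)
      next
        case (Suc k)
        have "Y (Suc k) = step \<eta> u \<mu> (Y k)" "X (Suc k) = step \<eta> u \<mu> (X k)" by (simp_all add: X_def Y_def)
        moreover have "d (Suc k) = d k + (\<mu> (Y k) - \<mu> (X k))" "t (Suc k) = t k + \<eta> * sympl e u * d k"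
          by (simp_all add: d_def t_def u algebra_simps)
        ultimately show ?case using step_difference[OF Suc.IH, of \<eta> u \<mu>] by simp
      qed
      have inc: "\<bar>\<mu> (Y k) - \<mu> (X k)\<bar> \<le> \<eta> * (2 * H * (speed * s) powr \<alpha> + H * r powr \<alpha> + 2 * \<delta>)"
        if k: "k \<le> n" for k
      proof -
        have "\<bar>\<mu> (X k) + \<eta> * (N (X k) \<bullet> u)\<bar> \<le> \<delta> * \<eta>" "\<bar>\<mu> (Y k) + \<eta> * (N (Y k) \<bullet> u)\<bar> \<le> \<delta> * \<eta>"
          using st X[OF k] Y[OF k] by (auto simp: is_step_def)
        moreover have "\<bar>\<eta> * (N (Y k) \<bullet> u) - \<eta> * (N (X k) \<bullet> u)\<bar> \<le> \<eta> * (2 * H * (speed * s) powr \<alpha> + H * r powr \<alpha>)"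
        proof -
          have b: "x \<in> ball p R" "y \<in> ball p R" "X k \<in> ball p R" "Y k \<in> ball p R"
            using x y X(3)[OF k] Y(3)[OF k] R by auto
          have 1: "norm (N (Y k) - N y) \<le> H * (speed * s) powr \<alpha>"
            by (rule N_near[OF y(1) b(2) Y(1)[OF k] b(4) Y(2)[OF k]])
          have 2: "norm (N (X k) - N x) \<le> H * (speed * s) powr \<alpha>"
            by (rule N_near[OF x(1) b(1) X(1)[OF k] b(3) X(2)[OF k]])
          have 3: "norm (N y - N x) \<le> H * r powr \<alpha>"
            by (rule N_near[OF x(1) b(1) y(1) b(2) xy])
          have "norm (N (Y k) - N (X k)) \<le> norm (N (Y k) - N y) + norm (N y - N x) + norm (N (X k) - N x)"
            using dist_triangle[of "N (Y k)" "N (X k)" "N y"] dist_triangle[of "N y" "N (X k)" "N x"]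
            by (simp add: dist_norm norm_minus_commute)
          then have "norm (N (Y k) - N (X k)) \<le> 2 * H * (speed * s) powr \<alpha> + H * r powr \<alpha>"
            using 1 2 3 by simp
          then have "\<bar>(N (Y k) - N (X k)) \<bullet> u\<bar> \<le> 2 * H * (speed * s) powr \<alpha> + H * r powr \<alpha>"
            using Cauchy_Schwarz_ineq2[of "N (Y k) - N (X k)" u] u by simp
          from mult_left_mono[OF this less_imp_le[OF \<eta>(1)]] show ?thesis
            using \<eta>(1) by (simp add: inner_diff_left abs_mult flip: right_diff_distrib)
        qed
        ultimately have "\<bar>\<mu> (Y k) - \<mu> (X k)\<bar> \<le> \<eta> * (2 * H * (speed * s) powr \<alpha> + H * r powr \<alpha>) + 2 * (\<delta> * \<eta>)"
          by linarith
        then show ?thesis by (simp add: algebra_simps)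
      qed
      have d_near: "\<bar>d k - D\<bar> \<le> D / 2" if k: "k \<le> n" for k
      proof -
        let ?E = "2 * H * (speed * s) powr \<alpha> + H * r powr \<alpha> + 2 * \<delta>"
        have E0: "0 \<le> ?E" using H \<delta> by simp
        have "\<bar>d k - D\<bar> \<le> (\<Sum>j<k. \<bar>\<mu> (Y j) - \<mu> (X j)\<bar>)" by (simp add: d_def sum_abs)
        also have "\<dots> \<le> (\<Sum>j<k. \<eta> * ?E)" using k by (intro sum_mono inc) auto
        also have "\<dots> = (real k * \<eta>) * ?E" by simp
        also have "\<dots> \<le> s * ?E"
          using k \<eta>(1) E0 unfolding n\<eta>[symmetric] by (intro mult_right_mono) auto
        also have "\<dots> = 2 * H * speed powr \<alpha> * (s * s powr \<alpha>) + (H + 2) * (s * r powr \<alpha>)"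
          using speed s0 by (simp add: powr_mult \<delta>_def algebra_simps)
        also have "\<dots> \<le> 2 * H * speed powr \<alpha> * r powr (1 + \<beta>) + (H + 2) * r powr (1 + \<beta>)"
          using s_bounds H by (intro add_mono mult_left_mono) auto
        also have "\<dots> = C * r powr (1 + \<beta>)" by (simp add: C_def algebra_simps)
        also have "\<dots> \<le> D / 2" using D by (simp add: K_def)
        finally show ?thesis .
      qed
      have tn: "\<sigma> * t n < 0"
      proof -
        have "(\<Sum>j<n. D / 2) \<le> (\<Sum>j<n. d j)"
          using d_near by (intro sum_mono) (smt (verit) field_sum_of_halves lessThan_iff less_imp_le)
        then have "\<eta> * (\<Sum>j<n. D / 2) \<le> \<eta> * (\<Sum>j<n. d j)" using \<eta>(1) by simp
        moreover have "\<eta> * (\<Sum>j<n. D / 2) = (real n * \<eta>) * D / 2" by simp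
        moreover have "s * D > 2 * r\<^sup>2"
        proof -
          have "2 * r\<^sup>2 < 4 * r\<^sup>2" using r by simp
          also have "\<dots> \<le> K * r\<^sup>2" using K by (intro mult_right_mono) auto
          also have "\<dots> = s * (K * r powr (1 + \<beta>))" using s_bounds(3) by (simp add: mult_ac)
          also have "\<dots> < s * D" using D s0 by simp
          finally show ?thesis .
        qed
        moreover have "\<sigma> * t n = \<bar>\<tau>\<bar> - \<eta> * (\<Sum>j<n. d j)"
        proof -
          have "\<sigma> * t n = \<sigma> * \<tau> - (\<sigma> * \<sigma>) * (\<eta> * (\<Sum>j<n. d j))" by (simp add: t_def algebra_simps)
          then show ?thesis by (simp add: \<sigma>)
        qed
        ultimately show ?thesis using \<tau> unfolding n\<eta> by linarith
      qed
      \<comment> \<open>Just before the first change of sign the two points lie almost on a common line in direction \<open>e\<close>.\<close>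
      define k where "k = (LEAST k. \<sigma> * t k < 0)"
      have k1: "\<sigma> * t k < 0" unfolding k_def by (rule LeastI[of _ n]) (rule tn)
      have kn: "k \<le> n" unfolding k_def by (rule Least_le) (rule tn)
      have "k \<noteq> 0" using k1 \<sigma> by (intro notI) (simp add: t_def)
      then obtain j where j: "k = Suc j" by (cases k) auto
      have jn: "j \<le> n" using kn j by simp
      have tj: "0 \<le> \<sigma> * t j" using not_less_Least[of j "\<lambda>k. \<sigma> * t k < 0"] j by (simp add: k_def[symmetric])
      have "\<sigma> * t k = \<sigma> * t j - (\<sigma> * \<sigma>) * (\<eta> * d j)" by (simp add: t_def j algebra_simps)
      then have "\<sigma> * t j < \<eta> * d j" using k1 \<sigma> by simp
      moreover have dj: "D / 2 \<le> d j" "d j \<le> 3 / 2 * D" using d_near[OF jn] unfolding abs_le_iff by linarith+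
      then have "\<eta> * d j \<le> \<eta> * (3 / 2 * D)" using \<eta>(1) by simp
      ultimately have tj': "\<bar>t j\<bar> \<le> \<eta> * (3 / 2 * D)"
        using tj by (auto simp: \<sigma>_def split: if_splits)
      define z where "z = X j \<cdot> hexp (d j *\<^sub>R e)"
      have Yz: "Y j = z \<cdot> Heis (0, t j)"
        unfolding XY z_def heis_assoc by (intro arg_cong2[where f = heis_mult] heis_eqI) (auto simp: sympl_simps)
      have dzY: "dist (Y j) z \<le> 2 * sqrt \<bar>t j\<bar>"
        using heis_norm_le[of "Heis (0, t j)"] unfolding Yz by simp
      have small: "r \<le> R / 8" using rs sb b(4) by linarith
      have fX: "f (X j) = 0" "f (Y j) = 0"
        using S_zero[of "X j"] S_zero[of "Y j"] X[OF jn] Y[OF jn] R by auto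
      have "dist p (X j) + d j < R" using X(3)[OF jn] dj Dr small R by linarith
      then have "c * d j \<le> f z"
        using increasing_e[of "X j" "d j"] dj D0 fX by (simp add: z_def)
      then have lower: "c * (D / 2) \<le> f z" using dj(1) c mult_left_mono[of "D / 2" "d j" c] by linarith
      have tsmall: "6 * L * sqrt \<bar>t j\<bar> < c * (D / 2)"
      proof (rule power2_less_imp_less)
        have "(6 * L * sqrt \<bar>t j\<bar>)\<^sup>2 = 36 * L\<^sup>2 * \<bar>t j\<bar>" by (simp add: power_mult_distrib)
        also have "\<dots> \<le> 36 * L\<^sup>2 * (\<eta> * (3 / 2 * D))" using tj' by (intro mult_left_mono) auto
        also have "\<dots> < 36 * L\<^sup>2 * (c\<^sup>2 * D / (300 * L\<^sup>2) * (3 / 2 * D))"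
          using \<eta>(3) L D0 by (intro mult_strict_left_mono mult_strict_right_mono) auto
        also have "\<dots> = 54 / 300 * (c * D)\<^sup>2" using L by (simp add: field_simps power2_eq_square)
        also have "\<dots> \<le> (c * (D / 2))\<^sup>2" by (simp add: power_mult_distrib power_divide)
        finally show "(6 * L * sqrt \<bar>t j\<bar>)\<^sup>2 < (c * (D / 2))\<^sup>2" .
      qed (use c D0 in simp)
      have "3 * dist (Y j) z < R / 2"
      proof -
        have "c * (D / 2) \<le> L * (D / 2)"
        proof -
          have "p \<in> ball p R" using R by simp
          then have "c \<le> L" using G_e[of p] norm_G[of p] Cauchy_Schwarz_ineq2[of "G p" e] norm_e by simp
          then show ?thesis using D0 by simp
        qed
        then have "L * (6 * sqrt \<bar>t j\<bar>) < L * (D / 2)" using tsmall by simp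
        then have "6 * sqrt \<bar>t j\<bar> < D / 2" using L by simp
        then show ?thesis using dzY Dr small R by linarith
      qed
      then have "\<bar>f z - f (Y j)\<bar> \<le> 3 * L * dist (Y j) z"
        using Y(3)[OF jn] by (intro lipschitz_f) linarith
      also have "\<dots> \<le> 3 * L * (2 * sqrt \<bar>t j\<bar>)" using dzY L by (intro mult_left_mono) auto
      finally have "f z \<le> 6 * L * sqrt \<bar>t j\<bar>" using fX by simp
      then show False using lower tsmall by linarith
    qed
  qed (use K r0 in auto)
qed

end


context graded_patch begin

text \<open>The surface deviates from its vertical tangent planes at a power rate. The deviation of \<open>y\<close>
  from the tangent plane at \<open>x\<close> is compared with that of the endpoint of a discrete flow line in \<open>S\<close>
  which starts at \<open>x\<close> and has the same component as \<open>y\<close> orthogonal to \<open>e\<close>.\<close>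

lemma flatness:
  obtains K \<rho> where "0 < K" "0 < \<rho>" "\<rho> \<le> R / 8" "\<rho> \<le> 1 / 2"
    "\<And>x y. x \<in> S \<Longrightarrow> y \<in> S \<Longrightarrow> dist p x \<le> \<rho> \<Longrightarrow> dist p y \<le> \<rho> \<Longrightarrow>
      \<bar>N x \<bullet> hor (heis_inv x \<cdot> y)\<bar> \<le> K * dist x y powr (1 + \<beta>)"
proof -
  obtain K r0 where K: "0 < K" "0 < r0" "r0 \<le> 1"
    and pos: "\<And>x y D \<tau> r. x \<in> S \<Longrightarrow> y \<in> S \<Longrightarrow> dist p x \<le> R / 4 \<Longrightarrow> dist p y \<le> R / 4 \<Longrightarrow>
      y = x \<cdot> Heis (D *\<^sub>R e, \<tau>) \<Longrightarrow> 0 < r \<Longrightarrow> r \<le> r0 \<Longrightarrow> \<bar>\<tau>\<bar> \<le> r\<^sup>2 \<Longrightarrow> dist x y \<le> r \<Longrightarrow>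
      D \<le> K * r powr (1 + \<beta>)"
    using transversal_difference_pos by blast
  have both: "\<bar>D\<bar> \<le> K * r powr (1 + \<beta>)"
    if "x \<in> S" "y \<in> S" "dist p x \<le> R / 4" "dist p y \<le> R / 4" "y = x \<cdot> Heis (D *\<^sub>R e, \<tau>)"
      "0 < r" "r \<le> r0" "\<bar>\<tau>\<bar> \<le> r\<^sup>2" "dist x y \<le> r" for x y D \<tau> r
  proof -
    have "x = y \<cdot> Heis ((- D) *\<^sub>R e, - \<tau>)"
      using that(5) by (intro heis_eqI) (simp_all add: sympl_simps)
    then have "- D \<le> K * r powr (1 + \<beta>)"
      using that by (intro pos[of y x "- D" "- \<tau>"]) (auto simp: dist_commute)
    moreover have "D \<le> K * r powr (1 + \<beta>)" by (rule pos[OF that])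
    ultimately show ?thesis by (simp add: abs_le_iff)
  qed
  define \<rho> where "\<rho> = min (R / 8) (min (r0 / (2 * (speed + 1))) (R / (16 * speed)))"
  have \<rho>: "0 < \<rho>" "\<rho> \<le> R / 8" "\<rho> \<le> r0 / (2 * (speed + 1))" "\<rho> \<le> R / (16 * speed)"
  proof -
    show "0 < \<rho>" using R K speed by (simp add: \<rho>_def)
    show "\<rho> \<le> R / 8" unfolding \<rho>_def by (rule min.cobounded1)
    show "\<rho> \<le> r0 / (2 * (speed + 1))" unfolding \<rho>_def by (rule min.coboundedI2[OF min.cobounded1])
    show "\<rho> \<le> R / (16 * speed)" unfolding \<rho>_def by (rule min.coboundedI2[OF min.cobounded2])
  qed
  have \<rho>': "2 * \<rho> * (speed + 1) \<le> r0" "2 * \<rho> * speed \<le> R / 8"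
    using \<rho>(3,4) speed by (simp_all add: field_simps)
  have \<rho>1: "2 * \<rho> \<le> 1"
  proof -
    have "2 * \<rho> * 1 \<le> 2 * \<rho> * (speed + 1)" using \<rho> speed by (intro mult_left_mono) auto
    then show ?thesis using \<rho>' K by linarith
  qed
  define C where "C = 1 + H * speed powr \<alpha>"
  have C: "0 < C" using H by (simp add: C_def add_pos_nonneg)
  show thesis
  proof (rule that[of "C + K * (speed + 1) powr (1 + \<beta>)" \<rho>])
    fix x y assume x: "x \<in> S" "dist p x \<le> \<rho>" and y: "y \<in> S" "dist p y \<le> \<rho>"
    define r where "r = dist x y"
    define z where "z = heis_inv x \<cdot> y"
    show "\<bar>N x \<bullet> hor (heis_inv x \<cdot> y)\<bar> \<le> (C + K * (speed + 1) powr (1 + \<beta>)) * dist x y powr (1 + \<beta>)"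
    proof (cases "r = 0")
      case True
      then show ?thesis by (simp add: r_def)
    next
      case False
      then have r: "0 < r" "r \<le> 2 * \<rho>" using dist_triangle[of x y p] x y by (auto simp: r_def dist_commute)
      have r1: "r \<le> 1" using r \<rho>1 by simp
      have xb: "x \<in> ball p R" using x \<rho> R by simp
      have x4: "dist p x \<le> R / 4" and y4: "dist p y \<le> R / 4" using x y \<rho> R by auto
      define u where "u = hor z - (hor z \<bullet> e) *\<^sub>R e"
      have ee: "e \<bullet> e = 1" using norm_e by (simp add: dot_square_norm)
      have ue: "u \<bullet> e = 0" by (simp add: u_def inner_diff_left ee)
      have ur: "norm u \<le> r"
      proof -
        have "hor z = u + (hor z \<bullet> e) *\<^sub>R e" by (simp add: u_def)
        then have "(norm (hor z))\<^sup>2 = (norm u)\<^sup>2 + (norm ((hor z \<bullet> e) *\<^sub>R e))\<^sup>2"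
          using ue norm_add_Pythagorean[of u "(hor z \<bullet> e) *\<^sub>R e"] by (simp add: orthogonal_def)
        then have "(norm u)\<^sup>2 \<le> (norm (hor z))\<^sup>2"
          using zero_le_power2[of "norm ((hor z \<bullet> e) *\<^sub>R e)"] by linarith
        then have "norm u \<le> norm (hor z)" by (rule power2_le_imp_le) simp
        then show ?thesis using norm_hor_le[of z] by (simp add: r_def dist_heis z_def)
      qed
      have ra: "r * r powr \<alpha> \<le> r powr (1 + \<beta>)"
      proof -
        have "r * r powr \<alpha> = r powr (1 + \<alpha>)" using r by (simp add: powr_add)
        also have "\<dots> \<le> r powr (1 + \<beta>)" using r r1 \<alpha> by (intro powr_mono') (auto simp: \<beta>_def)
        finally show ?thesis .
      qed
      obtain q \<kappa> where q: "q \<in> S" "dist x q \<le> speed * r" "hor q = hor x + u + \<kappa> *\<^sub>R e"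
        and \<kappa>: "\<bar>\<kappa> + N x \<bullet> u\<bar> \<le> C * r powr (1 + \<beta>)"
      proof (cases "u = 0")
        case True
        have "0 \<le> speed * r" "0 \<le> C * r powr (1 + \<beta>)" using r speed C by simp_all
        then show ?thesis by (intro that[of x 0]) (simp_all add: True x)
      next
        case False
        define w where "w = u /\<^sub>R norm u"
        have w: "norm w = 1" "norm u *\<^sub>R w = u" using False by (auto simp: w_def)
        define \<delta> where "\<delta> = r powr \<alpha>"
        have \<delta>: "0 < \<delta>" "\<delta> \<le> 1" using r r1 \<alpha> by (auto simp: \<delta>_def powr_le1)
        obtain \<eta>0 where \<eta>0: "\<eta>0 > 0" "\<And>\<eta> u. 0 < \<eta> \<Longrightarrow> \<eta> < \<eta>0 \<Longrightarrow> norm u = 1 \<Longrightarrow> \<exists>\<mu>. is_step \<delta> \<eta> u \<mu>"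
          using ex_step[OF \<delta>] by blast
        obtain n :: nat where n: "norm u / \<eta>0 < real n" using reals_Archimedean2 by blast
        have n0: "0 < n" using n \<eta>0(1) by (metis divide_nonneg_pos gr0I norm_ge_zero not_le of_nat_0)
        define \<eta> where "\<eta> = norm u / n"
        have \<eta>: "0 < \<eta>" "\<eta> < \<eta>0" using n n0 \<eta>0(1) False by (auto simp: \<eta>_def field_simps)
        have n\<eta>: "real n * \<eta> = norm u" using n0 by (simp add: \<eta>_def)
        obtain \<mu> where st: "is_step \<delta> \<eta> w \<mu>" using \<eta>0(2)[OF \<eta> w(1)] by blast
        define X where "X k = (step \<eta> w \<mu> ^^ k) x" for k
        have kn: "speed * (real k * \<eta>) \<le> speed * norm u" if "k \<le> n" for k
          using that \<eta>(1) speed unfolding n\<eta>[symmetric] by simp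
        have sp: "speed * norm u \<le> speed * r" "speed * r \<le> R / 4"
        proof -
          show "speed * norm u \<le> speed * r" using ur speed by simp
          have "speed * r \<le> speed * (2 * \<rho>)" using r speed by simp
          then show "speed * r \<le> R / 4" using \<rho>'(2) R by (simp add: mult_ac)
        qed
        have X: "X k \<in> S" "dist x (X k) \<le> speed * norm u" "dist p (X k) \<le> R / 2" if "k \<le> n" for k
        proof -
          have "speed * (real k * \<eta>) \<le> R / 4" using kn[OF that] sp by linarith
          from chain[OF st \<eta>(1) \<delta>(2) w(1) x(1) x4 this]
          show "X k \<in> S" "dist x (X k) \<le> speed * norm u" "dist p (X k) \<le> R / 2"
            using kn[OF that] by (auto simp: X_def)
        qed
        have horX: "hor (X k) = hor x + (real k * \<eta>) *\<^sub>R w + (\<Sum>j<k. \<mu> (X j)) *\<^sub>R e" for k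
        proof (induction k)
          case (Suc k)
          have "X (Suc k) = step \<eta> w \<mu> (X k)" by (simp add: X_def)
          then show ?case using Suc by (simp add: step_def algebra_simps)
        qed (simp add: X_def)
        show ?thesis
        proof (rule that[of "X n" "\<Sum>j<n. \<mu> (X j)"])
          show "dist x (X n) \<le> speed * r" using X(2)[of n] sp by simp
          show "hor (X n) = hor x + u + (\<Sum>j<n. \<mu> (X j)) *\<^sub>R e" using horX[of n] n\<eta> w by simp
          have "\<bar>\<mu> (X j) + \<eta> * (N x \<bullet> w)\<bar> \<le> \<eta> * (\<delta> + H * (speed * norm u) powr \<alpha>)" if "j < n" for j
          proof -
            have j: "j \<le> n" using that by simp
            have 1: "\<bar>\<mu> (X j) + \<eta> * (N (X j) \<bullet> w)\<bar> \<le> \<delta> * \<eta>"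
              using st X[OF j] by (simp add: is_step_def)
            have "X j \<in> ball p R" using X(3)[OF j] R by simp
            then have "norm (N (X j) - N x) \<le> H * (speed * norm u) powr \<alpha>"
              by (rule N_near[OF x(1) xb X(1)[OF j] _ X(2)[OF j]])
            then have "\<bar>(N (X j) - N x) \<bullet> w\<bar> \<le> H * (speed * norm u) powr \<alpha>"
              using Cauchy_Schwarz_ineq2[of "N (X j) - N x" w] w by simp
            from mult_left_mono[OF this less_imp_le[OF \<eta>(1)]]
            have "\<bar>\<eta> * (N (X j) \<bullet> w) - \<eta> * (N x \<bullet> w)\<bar> \<le> \<eta> * (H * (speed * norm u) powr \<alpha>)"
              using \<eta>(1) by (simp add: inner_diff_left abs_mult flip: right_diff_distrib)
            then show ?thesis using 1 by (simp add: distrib_left mult.commute[of \<delta>])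
          qed
          then have "\<bar>\<Sum>j<n. \<mu> (X j) + \<eta> * (N x \<bullet> w)\<bar> \<le> (\<Sum>j<n. \<eta> * (\<delta> + H * (speed * norm u) powr \<alpha>))"
            by (intro order_trans[OF sum_abs] sum_mono) auto
          also have "\<dots> = norm u * (\<delta> + H * (speed * norm u) powr \<alpha>)"
            using n\<eta> by (simp flip: mult.assoc)
          also have "\<dots> \<le> r * (\<delta> + H * (speed * r) powr \<alpha>)"
            using ur r H \<delta> \<alpha> speed by (intro mult_mono add_left_mono mult_left_mono powr_mono2) auto
          also have "\<dots> = C * (r * r powr \<alpha>)"
            using r speed by (simp add: C_def \<delta>_def powr_mult algebra_simps)
          also have "\<dots> \<le> C * r powr (1 + \<beta>)" using ra C by simp
          also have "(\<Sum>j<n. \<mu> (X j) + \<eta> * (N x \<bullet> w)) = (\<Sum>j<n. \<mu> (X j)) + N x \<bullet> u"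
          proof -
            have "(real n * \<eta>) * (N x \<bullet> w) = N x \<bullet> u" unfolding n\<eta> using w by (metis inner_scaleR_right)
            then show ?thesis by (simp add: sum.distrib mult.assoc)
          qed
          finally show "\<bar>(\<Sum>j<n. \<mu> (X j)) + N x \<bullet> u\<bar> \<le> C * r powr (1 + \<beta>)" .
        qed (use X in auto)
      qed
      define D where "D = hor z \<bullet> e - \<kappa>"
      define z1 where "z1 = heis_inv q \<cdot> y"
      have horz1: "hor z1 = D *\<^sub>R e"
        by (simp add: z1_def q(3) D_def u_def z_def algebra_simps)
      have yq: "y = q \<cdot> Heis (D *\<^sub>R e, vert z1)"
        unfolding horz1[symmetric] Heis_hor_vert by (simp add: z1_def)
      let ?r = "(speed + 1) * r"
      have dqy: "dist q y \<le> ?r"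
        using dist_triangle[of q y x] q(2) by (simp add: r_def dist_commute algebra_simps)
      have "\<bar>D\<bar> \<le> K * ?r powr (1 + \<beta>)"
      proof (rule both[OF q(1) y(1) _ y4 yq])
        have "speed * r \<le> speed * (2 * \<rho>)" using r speed by simp
        then show "dist p q \<le> R / 4"
          using dist_triangle[of p q x] q(2) x \<rho> \<rho>'(2) by (simp add: mult_ac)
        show "0 < ?r" using r speed by simp
        have "?r \<le> (speed + 1) * (2 * \<rho>)" using r speed by (intro mult_left_mono) auto
        then show "?r \<le> r0" using \<rho>'(1) by (simp add: mult_ac)
        have "\<bar>vert z1\<bar> \<le> (heis_norm z1)\<^sup>2" using vert_le[of z1] zero_le_power2[of "heis_norm z1"] by linarith
        also have "\<dots> \<le> ?r\<^sup>2" using dqy by (intro power_mono) (auto simp: z1_def dist_heis heis_norm_nonneg)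
        finally show "\<bar>vert z1\<bar> \<le> ?r\<^sup>2" .
      qed (rule dqy)
      also have "K * ?r powr (1 + \<beta>) = K * (speed + 1) powr (1 + \<beta>) * r powr (1 + \<beta>)"
        using speed r by (simp add: powr_mult)
      finally have Db: "\<bar>D\<bar> \<le> K * (speed + 1) powr (1 + \<beta>) * r powr (1 + \<beta>)" .
      have "N x \<bullet> hor z = (\<kappa> + N x \<bullet> u) + D"
        using N_e[OF xb] by (simp add: D_def u_def inner_diff_right)
      then have "\<bar>N x \<bullet> hor z\<bar> \<le> (C + K * (speed + 1) powr (1 + \<beta>)) * r powr (1 + \<beta>)"
        using \<kappa> Db by (simp add: distrib_right)
      then show ?thesis by (simp add: z_def r_def)
    qed
  qed (use C K \<rho> \<rho>1 speed in \<open>auto intro!: add_pos_nonneg\<close>)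
qed

end


section \<open>Finiteness of the surface measure\<close>

lemma diameter_ball_le:
  fixes x :: "'a::metric_space"
  assumes "0 < r"
  shows "diameter (ball x r) \<le> 2 * r"
proof (rule ccontr)
  assume "\<not> ?thesis"
  then have "2 * r < diameter (ball x r)" by simp
  then obtain y z where "y \<in> ball x r" "z \<in> ball x r" "2 * r < dist y z"
    using diameter_lower_bounded[of "ball x r" "2 * r"] assms by auto
  then show False using dist_triangle2[of y z x] by (simp add: dist_commute)
qed

lemma maximal_separated_exists:
  fixes A :: "'a::metric_space set"
  assumes r: "0 < r" and bound: "\<And>X. finite X \<Longrightarrow> X \<subseteq> A \<Longrightarrow> (\<And>x y. x \<in> X \<Longrightarrow> y \<in> X \<Longrightarrow> x \<noteq> y \<Longrightarrow> r \<le> dist x y) \<Longrightarrow> card X \<le> M"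
  obtains X where "finite X" "X \<subseteq> A" "\<And>x y. x \<in> X \<Longrightarrow> y \<in> X \<Longrightarrow> x \<noteq> y \<Longrightarrow> r \<le> dist x y"
    "A \<subseteq> (\<Union>x\<in>X. ball x r)"
proof -
  define P where "P X \<longleftrightarrow> finite X \<and> X \<subseteq> A \<and> (\<forall>x\<in>X. \<forall>y\<in>X. x \<noteq> y \<longrightarrow> r \<le> dist x y)" for X
  have P0: "P {}" by (simp add: P_def)
  have bd: "\<forall>X. P X \<longrightarrow> card X < Suc M" using bound by (auto simp: P_def less_Suc_eq_le)
  obtain X where X: "P X" "\<And>Y. P Y \<Longrightarrow> card Y \<le> card X"
    using ex_has_greatest_nat[OF P0 bd] by blast
  have "A \<subseteq> (\<Union>x\<in>X. ball x r)"
  proof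
    fix a assume a: "a \<in> A"
    show "a \<in> (\<Union>x\<in>X. ball x r)"
    proof (rule ccontr)
      assume "a \<notin> (\<Union>x\<in>X. ball x r)"
      then have far: "r \<le> dist x a" if "x \<in> X" for x using that by auto
      show False
      proof (cases "a \<in> X")
        case True
        then show False using far[of a] r by simp
      next
        case False
        have "P (insert a X)"
          using X(1) a far by (auto simp: P_def dist_commute)
        then have "card (insert a X) \<le> card X" by (rule X(2))
        then show False using False X(1) by (simp add: P_def)
      qed
    qed
  qed
  then show thesis using X(1) that by (auto simp: P_def)
qed

text \<open>A maximal separated set is the set of centres of a cover, so packing bounds control the measure.\<close>

lemma hausdorff_outer_le_packing:
  fixes A :: "'a::metric_space set"
  assumes r1: "0 < r1" and C: "0 \<le> C"
    and bound: "\<And>r X. 0 < r \<Longrightarrow> r \<le> r1 \<Longrightarrow> finite X \<Longrightarrow> X \<subseteq> A \<Longrightarrow>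
      (\<And>x y. x \<in> X \<Longrightarrow> y \<in> X \<Longrightarrow> x \<noteq> y \<Longrightarrow> r \<le> dist x y) \<Longrightarrow> real (card X) * r ^ m \<le> C"
  shows "hausdorff_outer (real m) A \<le> ennreal (2 ^ m * C)"
proof (rule hausdorff_outer_leI)
  fix \<delta> :: real assume \<delta>: "0 < \<delta>"
  define r where "r = min r1 (\<delta> / 2)"
  have r: "0 < r" "r \<le> r1" "2 * r \<le> \<delta>" using r1 \<delta> by (auto simp: r_def)
  have "card X \<le> nat \<lceil>C / r ^ m\<rceil>"
    if "finite X" "X \<subseteq> A" "\<And>x y. x \<in> X \<Longrightarrow> y \<in> X \<Longrightarrow> x \<noteq> y \<Longrightarrow> r \<le> dist x y" for X
  proof -
    have "real (card X) \<le> C / r ^ m" using bound[OF r(1,2) that] r(1) by (simp add: field_simps)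
    then show ?thesis by linarith
  qed
  then obtain X where X: "finite X" "X \<subseteq> A" "\<And>x y. x \<in> X \<Longrightarrow> y \<in> X \<Longrightarrow> x \<noteq> y \<Longrightarrow> r \<le> dist x y"
    "A \<subseteq> (\<Union>x\<in>X. ball x r)"
    using maximal_separated_exists[OF r(1), of A] by metis
  obtain xs where xs: "set xs = X" "distinct xs" using finite_distinct_list[OF X(1)] by blast
  have len: "length xs = card X" using xs distinct_card by fastforce
  define B where "B i = (if i < length xs then ball (xs ! i) r else {})" for i
  have "hpre (real m) \<delta> A \<le> (\<Sum>i. ennreal (diameter (B i) powr real m))"
  proof (rule hpre_le)
    show "diameter (B i) \<le> \<delta>" for i
      using diameter_ball_le[OF r(1), of "xs ! i"] r(3) \<delta> by (simp add: B_def)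
    show "A \<subseteq> (\<Union>i. B i)"
    proof
      fix a assume "a \<in> A"
      then obtain x where "x \<in> set xs" "a \<in> ball x r" using X(4) xs by blast
      then obtain i where "i < length xs" "a \<in> ball (xs ! i) r" by (auto simp: in_set_conv_nth)
      then have "a \<in> B i" by (simp add: B_def)
      then show "a \<in> (\<Union>i. B i)" by blast
    qed
  qed (simp add: B_def)
  also have "\<dots> = (\<Sum>i<length xs. ennreal (diameter (B i) powr real m))"
    by (rule suminf_finite) (auto simp: B_def)
  also have "\<dots> \<le> (\<Sum>i<length xs. ennreal ((2 * r) ^ m))"
  proof (intro sum_mono ennreal_leI)
    fix i assume "i \<in> {..<length xs}"
    then have "diameter (B i) \<le> 2 * r" "0 \<le> diameter (B i)"
      using diameter_ball_le[OF r(1), of "xs ! i"] diameter_ge_0[of "ball (xs ! i) r"] by (auto simp: B_def)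
    then have "diameter (B i) powr real m \<le> (2 * r) powr real m" by (intro powr_mono2) auto
    then show "diameter (B i) powr real m \<le> (2 * r) ^ m" using r(1) by (simp add: powr_realpow)
  qed
  also have "\<dots> = ennreal (2 ^ m * (real (card X) * r ^ m))"
    using r(1) by (simp add: len ennreal_of_nat_eq_real_of_nat ennreal_mult[symmetric] power_mult_distrib mult_ac)
  also have "\<dots> \<le> ennreal (2 ^ m * C)"
    using bound[OF r(1,2) X(1-3)] by (intro ennreal_leI mult_left_mono) auto
  finally show "hpre (real m) \<delta> A \<le> ennreal (2 ^ m * C)" .
qed

context graded_patch begin

text \<open>Balls of radius \<open>r / 2\<close> about \<open>r\<close>-separated points of \<open>S\<close>, translated along \<open>e\<close> by multiples of a
  large multiple of \<open>r\<close>, are disjoint because \<open>f\<close> increases along \<open>e\<close>. Comparing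
  volumes gives the bound expected of a set of homogeneous dimension one less than the space.\<close>

lemma separated_surface_card:
  obtains C r1 where "0 \<le> C" "0 < r1"
    "\<And>r X. 0 < r \<Longrightarrow> r \<le> r1 \<Longrightarrow> finite X \<Longrightarrow> X \<subseteq> S \<inter> cball p (R / 8) \<Longrightarrow>
      (\<And>x y. x \<in> X \<Longrightarrow> y \<in> X \<Longrightarrow> x \<noteq> y \<Longrightarrow> r \<le> dist x y) \<Longrightarrow> real (card X) * r ^ (2 * CARD('n) + 1) \<le> C"
proof -
  obtain c1 where c1: "c1 > 0" "\<And>(p :: 'n heis) r. 0 < r \<Longrightarrow> c1 * r ^ (2 * CARD('n) + 2) \<le> hvol (ball p r)"
    by (rule ball_volume[where 'n = 'n]) (rule that)
  let ?d = "2 * CARD('n) + 2"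
  \<comment> \<open>A translation by \<open>s * r\<close> along \<open>e\<close> raises \<open>f\<close> by at least \<open>6 * L * r\<close>, more than the oscillation of \<open>f\<close>
     over the balls of radius \<open>r / 2\<close> about points of \<open>S\<close>.\<close>
  define s where "s = 6 * L / c"
  have s: "6 \<le> s"
  proof -
    have "p \<in> ball p R" using R by simp
    then have "c \<le> L" using G_e[of p] norm_G[of p] Cauchy_Schwarz_ineq2[of "G p" e] norm_e by simp
    then show ?thesis using c by (simp add: s_def field_simps)
  qed
  have cs: "c * s = 6 * L" using c by (simp add: s_def)
  define C where "C = hvol (ball p R) * (8 * s / R) * 2 ^ ?d / c1"
  show thesis
  proof (rule that[of C "R / (8 * s)"])
    show "0 \<le> C" using R s c1 by (simp add: C_def hvol_def)
    show "0 < R / (8 * s)" using R s by simp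
    fix r X assume r: "0 < r" "r \<le> R / (8 * s)" and X: "finite X" "X \<subseteq> S \<inter> cball p (R / 8)"
      and sep: "\<And>x y. x \<in> X \<Longrightarrow> y \<in> X \<Longrightarrow> x \<noteq> y \<Longrightarrow> r \<le> dist x y"
    have rs: "8 * (s * r) \<le> R" using r s by (simp add: field_simps)
    have "6 * r \<le> s * r" using s r by simp
    then have rR: "48 * r \<le> R" using rs by linarith
    define M where "M = nat \<lfloor>R / (4 * (s * r))\<rfloor>"
    have sr: "0 < s * r" using s r by simp
    have M1: "real M * (s * r) \<le> R / 4"
    proof -
      have "real M \<le> R / (4 * (s * r))" unfolding M_def using sr R by (simp add: of_nat_floor)
      then show ?thesis using sr by (simp add: field_simps)
    qed
    have M2: "R / (8 * s) \<le> real M * r"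
    proof -
      have "R / (4 * (s * r)) - 1 \<le> real M" unfolding M_def by linarith
      moreover have "1 \<le> R / (8 * (s * r))" using rs sr by (simp add: field_simps)
      ultimately have "R / (8 * (s * r)) \<le> real M" by (simp add: field_simps)
      then show ?thesis using sr r s by (simp add: field_simps)
    qed
    define A where "A i = (\<lambda>q. q \<cdot> hexp ((real (snd i) * (s * r)) *\<^sub>R e)) ` ball (fst i) (r / 2)" for i :: "'n heis \<times> nat"
    have fx: "f x = 0" "dist p x \<le> R / 8" if "x \<in> X" for x
    proof -
      have x: "x \<in> S" "dist p x \<le> R / 8" using that X(2) by auto
      then show "f x = 0" "dist p x \<le> R / 8" using S_zero[of x] R by auto
    qed
    have near: "\<bar>f b\<bar> < 3 / 2 * (L * r)" "dist p b < R / 4" if "x \<in> X" "b \<in> ball x (r / 2)" for x b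
    proof -
      have d: "dist x b < r / 2" using that by simp
      have "dist p x + 3 * dist x b < R" using fx[OF that(1)] d rR R by linarith
      from lipschitz_f[OF this] have "\<bar>f b\<bar> \<le> L * (3 * dist x b)" using fx[OF that(1)] by simp
      also have "\<dots> < L * (3 * (r / 2))" using d L by (intro mult_strict_left_mono) auto
      finally show "\<bar>f b\<bar> < 3 / 2 * (L * r)" by simp
      show "dist p b < R / 4" using dist_triangle[of p b x] fx[OF that(1)] d rR R by linarith
    qed
    have shifted: "b \<cdot> hexp ((real k * (s * r)) *\<^sub>R e) \<noteq> b' \<cdot> hexp ((real k' * (s * r)) *\<^sub>R e)"
      if xs: "x \<in> X" "x' \<in> X" and b: "b \<in> ball x (r / 2)" "b' \<in> ball x' (r / 2)" and k: "k < k'" "k' < M" for x x' b b' k k'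
    proof
      define t where "t = (real k' - real k) * (s * r)"
      assume eq: "b \<cdot> hexp ((real k * (s * r)) *\<^sub>R e) = b' \<cdot> hexp ((real k' * (s * r)) *\<^sub>R e)"
      have "b = b \<cdot> hexp ((real k * (s * r)) *\<^sub>R e) \<cdot> hexp ((- (real k * (s * r))) *\<^sub>R e)"
        unfolding heis_assoc hexp_add by simp
      also have "\<dots> = b' \<cdot> hexp (t *\<^sub>R e)"
        unfolding eq unfolding heis_assoc hexp_add t_def by (simp add: algebra_simps)
      finally have bb': "b = b' \<cdot> hexp (t *\<^sub>R e)" .
      have "1 * (s * r) \<le> t" unfolding t_def using k sr by (intro mult_right_mono) auto
      then have t: "s * r \<le> t" "0 \<le> t" using sr by auto
      have "t \<le> real M * (s * r)" unfolding t_def using k sr by (intro mult_right_mono) auto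
      then have "dist p b' + t < R" using near(2)[OF xs(2) b(2)] M1 R by linarith
      from increasing_e[OF this t(2)] have "c * t \<le> f b - f b'" by (simp add: bb')
      moreover have "c * (s * r) \<le> c * t" using t c by simp
      moreover have "c * (s * r) = 6 * (L * r)" using cs by (simp add: mult.assoc[symmetric])
      moreover have "0 < L * r" using L r by simp
      ultimately show False using near(1)[OF xs(1) b(1)] near(1)[OF xs(2) b(2)] by linarith
    qed
    have "real (card (X \<times> {..<M})) * (c1 * (r / 2) ^ ?d) \<le> hvol (ball p R)"
    proof (rule packing[of _ A])
      show "finite (X \<times> {..<M})" using X by simp
      show "open (A i)" for i unfolding A_def by (rule open_translate) simp
      show "c1 * (r / 2) ^ ?d \<le> hvol (A i)" for i
        unfolding A_def hvol_translate(2)[OF open_ball] by (rule c1) (use r in simp)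
      fix i assume i: "i \<in> X \<times> {..<M}"
      show "A i \<subseteq> ball p R"
      proof
        fix z assume "z \<in> A i"
        then obtain b where b: "b \<in> ball (fst i) (r / 2)" "z = b \<cdot> hexp ((real (snd i) * (s * r)) *\<^sub>R e)"
          by (auto simp: A_def)
        have "dist b z \<le> real (snd i) * (s * r)" using sr s r norm_e by (simp add: b(2) abs_mult)
        also have "\<dots> \<le> real M * (s * r)" using i sr by (intro mult_right_mono) auto
        finally have "dist b z \<le> R / 4" using M1 by simp
        moreover have "dist p b < R / 4" using i b by (intro near(2)[of "fst i"]) auto
        ultimately show "z \<in> ball p R" using dist_triangle[of p z b] R by simp
      qed
      fix j assume j: "j \<in> X \<times> {..<M}" and ij: "i \<noteq> j"
      show "A i \<inter> A j = {}"
      proof (rule ccontr)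
        assume "A i \<inter> A j \<noteq> {}"
        then obtain b b' where b: "b \<in> ball (fst i) (r / 2)" "b' \<in> ball (fst j) (r / 2)"
          and eq: "b \<cdot> hexp ((real (snd i) * (s * r)) *\<^sub>R e) = b' \<cdot> hexp ((real (snd j) * (s * r)) *\<^sub>R e)"
          by (auto simp: A_def)
        have m: "fst i \<in> X" "fst j \<in> X" "snd i < M" "snd j < M" using i j by auto
        have "snd i = snd j"
          using shifted[OF m(1,2) b, of "snd i" "snd j"] shifted[OF m(2,1) b(2,1), of "snd j" "snd i"] eq m
          by (metis linorder_neqE_nat)
        then have "b \<cdot> hexp ((real (snd i) * (s * r)) *\<^sub>R e) \<cdot> hexp ((- (real (snd i) * (s * r))) *\<^sub>R e)
            = b' \<cdot> hexp ((real (snd i) * (s * r)) *\<^sub>R e) \<cdot> hexp ((- (real (snd i) * (s * r))) *\<^sub>R e)"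
          using eq by simp
        then have "b = b'" unfolding heis_assoc hexp_add by simp
        moreover have "fst i \<noteq> fst j" using \<open>snd i = snd j\<close> ij by (auto simp: prod_eq_iff)
        then have "r \<le> dist (fst i) (fst j)" by (rule sep[OF m(1,2)])
        ultimately show False
          using b dist_triangle2[of "fst i" "fst j" b] by simp
      qed
    qed
    then have "(real (card X) * real M) * (c1 * (r / 2) ^ ?d) \<le> hvol (ball p R)"
      by (simp add: card_cartesian_product)
    moreover have "(real (card X) * real M) * (c1 * (r / 2) ^ ?d)
        = (real (card X) * r ^ (2 * CARD('n) + 1)) * (c1 / 2 ^ ?d) * (real M * r)"
      by (simp add: power_divide field_simps)
    moreover have "(real (card X) * r ^ (2 * CARD('n) + 1)) * (c1 / 2 ^ ?d) * (R / (8 * s))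
        \<le> (real (card X) * r ^ (2 * CARD('n) + 1)) * (c1 / 2 ^ ?d) * (real M * r)"
      using M2 c1 r by (intro mult_left_mono) auto
    ultimately have "(real (card X) * r ^ (2 * CARD('n) + 1)) * (c1 / 2 ^ ?d) * (R / (8 * s)) \<le> hvol (ball p R)"
      by linarith
    then show "real (card X) * r ^ (2 * CARD('n) + 1) \<le> C"
      using c1(1) R s unfolding C_def by (simp add: field_simps)
  qed
qed

lemma hausdorff_outer_surface_finite:
  "hausdorff_outer (2 * CARD('n) + 1) (S \<inter> cball p (R / 8)) < top"
proof (rule separated_surface_card)
  fix C r1 :: real
  assume C: "0 \<le> C" "0 < r1"
    "\<And>r X. 0 < r \<Longrightarrow> r \<le> r1 \<Longrightarrow> finite X \<Longrightarrow> X \<subseteq> S \<inter> cball p (R / 8) \<Longrightarrow>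
      (\<And>x y. x \<in> X \<Longrightarrow> y \<in> X \<Longrightarrow> x \<noteq> y \<Longrightarrow> r \<le> dist x y) \<Longrightarrow> real (card X) * r ^ (2 * CARD('n) + 1) \<le> C"
  have "hausdorff_outer (real (2 * CARD('n) + 1)) (S \<inter> cball p (R / 8)) \<le> ennreal (2 ^ (2 * CARD('n) + 1) * C)"
    by (rule hausdorff_outer_le_packing[OF C(2,1,3)])
  also have "\<dots> < top" by simp
  finally show ?thesis by simp
qed

end


section \<open>Straightening vertical planes by symplectic shears\<close>

text \<open>For \<open>a\<close> orthogonal to the unit vector \<open>e\<close>, a symplectic map that carries the hyperplane
  orthogonal to \<open>e + a\<close> onto the one orthogonal to \<open>e\<close>. The last term compensates the failure of
  the linear shear \<open>x + (a \<bullet> x) e\<close> to preserve the symplectic form.\<close>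

definition shear :: "real ^ ('n::finite + 'n) \<Rightarrow> real ^ ('n + 'n) \<Rightarrow> real ^ ('n + 'n) \<Rightarrow> real ^ ('n + 'n)" where
  "shear e a x = x + (a \<bullet> x) *\<^sub>R e + sympl e x *\<^sub>R (Jm a - (e \<bullet> Jm a) *\<^sub>R e)"

definition hshear :: "real ^ ('n::finite + 'n) \<Rightarrow> real ^ ('n + 'n) \<Rightarrow> 'n heis \<Rightarrow> 'n heis" where
  "hshear e a z = Heis (shear e a (hor z), vert z)"

lemma hor_hshear [simp]: "hor (hshear e a z) = shear e a (hor z)"
  and vert_hshear [simp]: "vert (hshear e a z) = vert z"
  by (simp_all add: hshear_def)

lemma shear_add: "shear e a (x + y) = shear e a x + shear e a y"
  by (simp add: shear_def sympl_simps inner_add_right algebra_simps)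

lemma shear_minus: "shear e a (- x) = - shear e a x"
  by (simp add: shear_def sympl_simps)

context
  fixes e a :: "real ^ ('n::finite + 'n)"
  assumes e: "norm e = 1" and ae: "a \<bullet> e = 0"
begin

private lemma ee: "e \<bullet> e = 1"
  using e by (simp add: dot_square_norm)

lemma inner_shear: "e \<bullet> shear e a x = (e + a) \<bullet> x"
  by (simp add: shear_def inner_add_left inner_add_right inner_diff_right ee)

lemma sympl_shear: "sympl (shear e a x) (shear e a y) = sympl x y"
proof -
  let ?k = "e \<bullet> Jm a"
  let ?b = "Jm a - ?k *\<^sub>R e"
  have xb: "sympl x ?b = - (a \<bullet> x) + ?k * sympl e x" for x
    by (simp add: sympl_simps sympl_Jm[of x "Jm a"] sympl_commute[of x e] inner_commute)
  have eb: "sympl e ?b = 0" using xb[of e] ae by simp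
  have bx: "sympl ?b x = (a \<bullet> x) - ?k * sympl e x" for x
    using xb[of x] sympl_commute[of ?b x] by simp
  have be: "sympl ?b e = 0" using eb sympl_commute[of ?b e] by simp
  show ?thesis
    unfolding shear_def sympl.add_left sympl.add_right sympl.scaleR_left sympl.scaleR_right xb[of x] eb bx[of y] be sympl_self
    using sympl_commute[of x e] by (simp add: algebra_simps)
qed

lemma hshear_mult: "hshear e a (p \<cdot> q) = hshear e a p \<cdot> hshear e a q"
  by (rule heis_eqI) (simp_all add: shear_add sympl_shear)

lemma hshear_inv: "hshear e a (heis_inv p) = heis_inv (hshear e a p)"
  by (rule heis_eqI) (simp_all add: shear_minus)

lemma shear_inverse: "shear e (- a) (shear e a x) = x"
proof -
  let ?k = "e \<bullet> Jm a"
  let ?b = "Jm a - ?k *\<^sub>R e"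
  have b: "shear e (- a) y = y - (a \<bullet> y) *\<^sub>R e - sympl e y *\<^sub>R ?b" for y
    by (simp add: shear_def linear_neg[OF Jm_linear] algebra_simps)
  have "a \<bullet> Jm a = 0" using sympl_Jm[of a a] by simp
  then have "a \<bullet> ?b = 0" using ae by (simp add: inner_diff_right)
  then have 1: "a \<bullet> shear e a x = a \<bullet> x"
    using ae by (simp add: shear_def inner_add_right)
  have "sympl e ?b = 0"
    using ae by (simp add: sympl_simps sympl_Jm[of e "Jm a"] inner_commute)
  then have 2: "sympl e (shear e a x) = sympl e x"
    by (simp add: shear_def sympl.add_right sympl.scaleR_right)
  show ?thesis unfolding b 1 2 by (simp add: shear_def)
qed

end

lemma norm_shear_diff:
  assumes "norm e = 1"
  shows "norm (shear e a x - shear e a' x) \<le> 3 * norm (a - a') * norm x"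
proof -
  let ?d = "a - a'"
  have "shear e a x - shear e a' x = (?d \<bullet> x) *\<^sub>R e + sympl e x *\<^sub>R (Jm ?d - (e \<bullet> Jm ?d) *\<^sub>R e)"
    by (simp add: shear_def linear_diff[OF Jm_linear] inner_diff_left inner_diff_right algebra_simps)
  also have "norm \<dots> \<le> norm ((?d \<bullet> x) *\<^sub>R e) + norm (sympl e x *\<^sub>R (Jm ?d - (e \<bullet> Jm ?d) *\<^sub>R e))"
    by (rule norm_triangle_ineq)
  also have "norm ((?d \<bullet> x) *\<^sub>R e) \<le> norm ?d * norm x"
    using assms Cauchy_Schwarz_ineq2 by simp
  also have "norm (sympl e x *\<^sub>R (Jm ?d - (e \<bullet> Jm ?d) *\<^sub>R e)) \<le> norm x * (norm ?d + norm ?d)"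
    unfolding norm_scaleR
  proof (intro mult_mono)
    show "\<bar>sympl e x\<bar> \<le> norm x" using sympl_bound[of e x] assms by simp
    have "norm (Jm ?d - (e \<bullet> Jm ?d) *\<^sub>R e) \<le> norm (Jm ?d) + norm ((e \<bullet> Jm ?d) *\<^sub>R e)"
      by (rule norm_triangle_ineq4)
    also have "norm ((e \<bullet> Jm ?d) *\<^sub>R e) \<le> norm ?d"
      using assms Cauchy_Schwarz_ineq2[of e "Jm ?d"] by simp
    finally show "norm (Jm ?d - (e \<bullet> Jm ?d) *\<^sub>R e) \<le> norm ?d + norm ?d" by simp
  qed auto
  finally show ?thesis by (simp add: algebra_simps)
qed

lemma shear_0: "shear e 0 x = x"
  by (simp add: shear_def linear_0[OF Jm_linear])

lemma norm_shear:
  assumes "norm e = 1"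
  shows "norm (shear e a x) \<le> (1 + 3 * norm a) * norm x"
  using norm_shear_diff[OF assms, of a x 0] norm_triangle_ineq2[of "shear e a x" x]
  by (simp add: shear_0 algebra_simps)

lemma heis_norm_hshear:
  assumes "norm e = 1"
  shows "heis_norm (hshear e a z) \<le> (2 + 3 * norm a) * heis_norm z"
proof -
  have "heis_norm (hshear e a z) \<le> norm (shear e a (hor z)) + 2 * sqrt \<bar>vert z\<bar>"
    using heis_norm_le[of "hshear e a z"] by simp
  also have "norm (shear e a (hor z)) \<le> (1 + 3 * norm a) * heis_norm z"
    using norm_shear[OF assms, of a "hor z"] mult_left_mono[OF norm_hor_le[of z], of "1 + 3 * norm a"] by simp
  finally show ?thesis using sqrt_vert_le[of z] by (simp add: algebra_simps)
qed

lemma heis_norm_hshear_lower: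
  assumes "norm e = 1" "a \<bullet> e = 0"
  shows "heis_norm z \<le> (2 + 3 * norm a) * heis_norm (hshear e a z)"
proof -
  have "hshear e (- a) (hshear e a z) = z"
    by (rule heis_eqI) (simp_all add: shear_inverse[OF assms])
  then show ?thesis using heis_norm_hshear[OF assms(1), of "- a" "hshear e a z"] by simp
qed

lemma dist_hshear_le:
  assumes e: "norm e = 1" and A: "norm a \<le> A" "norm a' \<le> A"
  shows "dist (hshear e a z) (hshear e a' z)
    \<le> (3 * sqrt (2 * A) + 2 * sqrt (2 + 6 * A)) * sqrt (norm (a - a')) * heis_norm z"
proof -
  let ?x = "hor z" and ?\<delta> = "norm (a - a')"
  let ?w = "heis_inv (hshear e a' z) \<cdot> hshear e a z"
  let ?D = "shear e a ?x - shear e a' ?x"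
  have A0: "0 \<le> A" using A norm_ge_zero order_trans by blast
  have xz: "norm ?x \<le> heis_norm z" by (rule norm_hor_le)
  have "?\<delta> \<le> 2 * A" using A norm_triangle_ineq4[of a a'] by simp
  then have "sqrt ?\<delta> * sqrt ?\<delta> \<le> sqrt (2 * A) * sqrt ?\<delta>" by (intro mult_right_mono) auto
  then have \<delta>: "?\<delta> \<le> sqrt (2 * A) * sqrt ?\<delta>" by simp
  have D: "norm ?D \<le> 3 * ?\<delta> * norm ?x" by (rule norm_shear_diff[OF e])
  have "norm (hor ?w) \<le> 3 * sqrt (2 * A) * sqrt ?\<delta> * heis_norm z"
  proof -
    have "norm (hor ?w) \<le> 3 * ?\<delta> * norm ?x" using D by simp
    also have "\<dots> \<le> (3 * (sqrt (2 * A) * sqrt ?\<delta>)) * heis_norm z"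
      using \<delta> xz A0 by (intro mult_mono) auto
    finally show ?thesis by (simp add: mult_ac)
  qed
  moreover have "sqrt \<bar>vert ?w\<bar> \<le> sqrt (2 + 6 * A) * sqrt ?\<delta> * heis_norm z"
  proof (rule real_le_lsqrt)
    have "vert ?w = - sympl (shear e a' ?x) ?D / 2"
      by (simp add: sympl_simps)
    then have "\<bar>vert ?w\<bar> \<le> norm (shear e a' ?x) * norm ?D / 2"
      using sympl_bound[of "shear e a' ?x" ?D] by simp
    also have "\<dots> \<le> ((1 + 3 * A) * norm ?x) * (3 * ?\<delta> * norm ?x) / 2"
    proof (intro divide_right_mono mult_mono D)
      have "(1 + 3 * norm a') * norm ?x \<le> (1 + 3 * A) * norm ?x" using A by (intro mult_right_mono) auto
      then show "norm (shear e a' ?x) \<le> (1 + 3 * A) * norm ?x" using norm_shear[OF e, of a' ?x] by linarith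
    qed (use A0 in auto)
    also have "\<dots> = (3 / 2 * (1 + 3 * A)) * ?\<delta> * (norm ?x)\<^sup>2" by (simp add: power2_eq_square)
    also have "\<dots> \<le> (2 + 6 * A) * ?\<delta> * (heis_norm z)\<^sup>2"
      using xz A0 by (intro mult_mono power_mono) auto
    also have "\<dots> = (sqrt (2 + 6 * A) * sqrt ?\<delta> * heis_norm z)\<^sup>2"
      using A0 by (simp add: power_mult_distrib)
    finally show "\<bar>vert ?w\<bar> \<le> (sqrt (2 + 6 * A) * sqrt ?\<delta> * heis_norm z)\<^sup>2" .
  qed (use A0 in \<open>auto simp: heis_norm_nonneg\<close>)
  ultimately show ?thesis
    using heis_norm_le[of ?w] by (simp add: dist_heis_def algebra_simps)
qed

definition vplane :: "real ^ ('n::finite + 'n) \<Rightarrow> 'n heis set" where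
  "vplane e = {z. hor z \<bullet> e = 0}"

lemma vplane_subgroup:
  "Heis (0, 0) \<in> vplane e" "p \<in> vplane e \<Longrightarrow> q \<in> vplane e \<Longrightarrow> p \<cdot> q \<in> vplane e"
  by (simp_all add: vplane_def inner_add_left)

lemma closed_vplane: "closed (vplane e)"
  unfolding vplane_def by (intro closed_Collect_eq continuous_intros continuous_on_hor)

lemma vertical_vplane:
  fixes e :: "real ^ ('n::finite + 'n)"
  assumes "e \<noteq> 0"
  shows "vertical_subgroup_codim1 (vplane e)"
proof -
  have im: "coords ` vplane e = {z. (e, 0) \<bullet> z = 0}"
  proof (intro set_eqI iffI)
    fix z assume "z \<in> {z. (e, 0 :: real) \<bullet> z = 0}"
    then have "Heis z \<in> vplane e" by (cases z) (simp add: vplane_def inner_commute)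
    then show "z \<in> coords ` vplane e" by (metis coords_Heis image_eqI)
  qed (auto simp: vplane_def coords_eq inner_commute)
  have "dim {z. (e, 0 :: real) \<bullet> z = 0} = DIM((real ^ ('n + 'n)) \<times> real) - 1"
    using assms by (intro dim_hyperplane) (simp add: zero_prod_def)
  then show ?thesis
    unfolding vertical_subgroup_codim1_def im
    by (auto simp: subspace_hyperplane vplane_def)
qed

context graded_patch begin

definition tilt :: "'n heis \<Rightarrow> real ^ ('n + 'n)" where "tilt q = N q - e"

lemma tilt_e: "q \<in> ball p R \<Longrightarrow> tilt q \<bullet> e = 0"
  using N_e[of q] norm_e by (simp add: tilt_def inner_diff_left dot_square_norm)

lemma norm_tilt: "q \<in> ball p R \<Longrightarrow> norm (tilt q) \<le> L / c + 1"
  using norm_N[of q] norm_triangle_ineq4[of "N q" e] norm_e by (simp add: tilt_def)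

text \<open>The straightened view of \<open>x\<close> from \<open>q\<close>, and its projection to the vertical plane of \<open>e\<close> along
  the left-invariant field of \<open>e\<close>. The projection is a small displacement precisely because the
  surface is flat.\<close>

definition view :: "'n heis \<Rightarrow> 'n heis \<Rightarrow> 'n heis" where
  "view q x = hshear e (tilt q) (heis_inv q \<cdot> x)"

definition proj :: "'n heis \<Rightarrow> 'n heis \<Rightarrow> 'n heis" where
  "proj q x = view q x \<cdot> hexp (- (hor (view q x) \<bullet> e) *\<^sub>R e)"

lemma proj_vplane: "proj q x \<in> vplane e"
  using norm_e by (simp add: proj_def vplane_def inner_add_left inner_diff_left dot_square_norm)

lemma dist_view_proj:
  assumes "q \<in> ball p R"
  shows "dist (view q x) (proj q x) = \<bar>N q \<bullet> hor (heis_inv q \<cdot> x)\<bar>"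
proof -
  have "dist (view q x) (proj q x) = \<bar>e \<bullet> shear e (tilt q) (hor (heis_inv q \<cdot> x))\<bar>"
    unfolding proj_def dist_mult_right_self using norm_e by (simp add: view_def inner_commute)
  also have "e \<bullet> shear e (tilt q) (hor (heis_inv q \<cdot> x)) = N q \<bullet> hor (heis_inv q \<cdot> x)"
    unfolding inner_shear[OF norm_e tilt_e[OF assms]] by (simp add: tilt_def)
  finally show ?thesis .
qed

lemma dist_view:
  assumes "q \<in> ball p R"
  shows "dist (view q x) (view q y) \<le> (2 + 3 * (L / c + 1)) * dist x y"
    and "dist x y \<le> (2 + 3 * (L / c + 1)) * dist (view q x) (view q y)"
proof -
  have "heis_inv (view q x) \<cdot> view q y = hshear e (tilt q) (heis_inv (heis_inv q \<cdot> x) \<cdot> (heis_inv q \<cdot> y))"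
    unfolding view_def hshear_mult[OF norm_e tilt_e[OF assms]] hshear_inv[OF norm_e tilt_e[OF assms]] ..
  also have "heis_inv (heis_inv q \<cdot> x) \<cdot> (heis_inv q \<cdot> y) = heis_inv x \<cdot> y"
    by (simp add: heis_inv_mult heis_assoc)
  finally have d: "dist (view q x) (view q y) = heis_norm (hshear e (tilt q) (heis_inv x \<cdot> y))"
    by (simp add: dist_heis)
  have t: "2 + 3 * norm (tilt q) \<le> 2 + 3 * (L / c + 1)" using norm_tilt[OF assms] by simp
  show "dist (view q x) (view q y) \<le> (2 + 3 * (L / c + 1)) * dist x y"
    unfolding d dist_heis[of x y]
    by (rule order_trans[OF heis_norm_hshear[OF norm_e] mult_right_mono[OF t heis_norm_nonneg]])
  show "dist x y \<le> (2 + 3 * (L / c + 1)) * dist (view q x) (view q y)"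
    unfolding d dist_heis[of x y]
    by (rule order_trans[OF heis_norm_hshear_lower[OF norm_e tilt_e[OF assms]] mult_right_mono[OF t heis_norm_nonneg]])
qed

lemma view_change: "q \<in> ball p R \<Longrightarrow> view q x = view q q' \<cdot> hshear e (tilt q) (heis_inv q' \<cdot> x)"
  unfolding view_def by (subst hshear_mult[OF norm_e tilt_e, symmetric]) (simp_all add: heis_assoc)

definition \<gamma> :: real where "\<gamma> = \<beta> / 2"

lemma \<gamma>: "0 < \<gamma>" "\<gamma> \<le> 1" using \<beta> by (simp_all add: \<gamma>_def)

text \<open>The projections seen from two points of the surface differ by a left translation, up to
  an error of higher order. The square roots from the vertical direction halve the exponent.\<close>

lemma proj_estimates:
  obtains K \<rho> where "0 < K" "0 < \<rho>" "\<rho> \<le> R / 8"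
    "\<And>q x y r. q \<in> S \<inter> cball p \<rho> \<Longrightarrow> x \<in> S \<inter> cball p \<rho> \<Longrightarrow> y \<in> S \<inter> cball p \<rho> \<Longrightarrow>
      dist q x \<le> r \<Longrightarrow> dist q y \<le> r \<Longrightarrow> r \<le> 1 \<Longrightarrow>
      dist (proj q x) (proj q y) \<le> K * dist x y + K * r powr (1 + \<gamma>) \<and>
      dist x y \<le> K * dist (proj q x) (proj q y) + K * r powr (1 + \<gamma>)"
    "\<And>q q' x r. q \<in> S \<inter> cball p \<rho> \<Longrightarrow> q' \<in> S \<inter> cball p \<rho> \<Longrightarrow> x \<in> S \<inter> cball p \<rho> \<Longrightarrow>
      dist q q' \<le> r \<Longrightarrow> dist q x \<le> r \<Longrightarrow> dist q' x \<le> r \<Longrightarrow> r \<le> 1 \<Longrightarrow>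
      dist (proj q x) (proj q q' \<cdot> proj q' x) \<le> K * r powr (1 + \<gamma>)"
proof (rule flatness)
  fix K0 \<rho> :: real
  assume K0: "0 < K0" and \<rho>: "0 < \<rho>" "\<rho> \<le> R / 8" "\<rho> \<le> 1 / 2"
    and flat: "\<And>x y. x \<in> S \<Longrightarrow> y \<in> S \<Longrightarrow> dist p x \<le> \<rho> \<Longrightarrow> dist p y \<le> \<rho> \<Longrightarrow>
      \<bar>N x \<bullet> hor (heis_inv x \<cdot> y)\<bar> \<le> K0 * dist x y powr (1 + \<beta>)"
  define A where "A = L / c + 1"
  have A: "1 \<le> A" using L c by (simp add: A_def)
  define B where "B = 2 + 3 * A"
  have B: "5 \<le> B" using A by (simp add: B_def)
  define E where "E = (3 * sqrt (2 * A) + 2 * sqrt (2 + 6 * A)) * sqrt H"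
  have E: "0 \<le> E" using A H by (simp add: E_def)
  let ?Q = "S \<inter> cball p \<rho>"
  have Qb: "x \<in> ball p R" if "x \<in> ?Q" for x using that \<rho> R by auto
  have vp: "dist (view q x) (proj q x) \<le> K0 * r powr (1 + \<beta>)"
    if "q \<in> ?Q" "x \<in> ?Q" "dist q x \<le> r" for q x r
  proof -
    have "dist (view q x) (proj q x) \<le> K0 * dist q x powr (1 + \<beta>)"
      unfolding dist_view_proj[OF Qb[OF that(1)]] using flat[of q x] that by simp
    also have "\<dots> \<le> K0 * r powr (1 + \<beta>)"
      using K0 that \<beta> by (intro mult_left_mono powr_mono2) auto
    finally show ?thesis .
  qed
  have rpow: "r powr (1 + \<beta>) \<le> r powr (1 + \<gamma>)" if "0 \<le> r" "r \<le> 1" for r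
    using that \<beta> by (intro powr_mono') (auto simp: \<gamma>_def)
  have vp': "dist (view q x) (proj q x) \<le> K0 * r powr (1 + \<gamma>)"
    if "q \<in> ?Q" "x \<in> ?Q" "dist q x \<le> r" "r \<le> 1" for q x r
  proof -
    have "0 \<le> r" using that(3) zero_le_dist order_trans by blast
    then show ?thesis
      using K0 by (intro order_trans[OF vp[OF that(1-3)] mult_left_mono[OF rpow[OF _ that(4)]]]) auto
  qed
  define K where "K = B + 2 * B * K0 + 4 * K0 + 2 * sqrt (K0 * (B + 2 * K0)) + E"
  have rootK: "0 \<le> sqrt (K0 * (B + 2 * K0))" using K0 B by simp
  have KB: "0 < K" "B \<le> K" "2 * K0 \<le> K" "2 * B * K0 \<le> K"
    using K0 B E rootK by (simp_all add: K_def add_pos_nonneg)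
  show thesis
  proof (rule that[of K \<rho>])
    fix q x y r
    assume q: "q \<in> ?Q" and x: "x \<in> ?Q" and y: "y \<in> ?Q" and r: "dist q x \<le> r" "dist q y \<le> r" "r \<le> 1"
    let ?\<epsilon> = "K0 * r powr (1 + \<gamma>)"
    have e: "0 \<le> r powr (1 + \<gamma>)" by simp
    have "dist (proj q x) (proj q y) \<le> dist (view q x) (view q y) + 2 * ?\<epsilon>"
      using vp'[OF q x r(1,3)] vp'[OF q y r(2,3)] dist_triangle[of "proj q x" "proj q y" "view q x"]
        dist_triangle[of "view q x" "proj q y" "view q y"] by (simp add: dist_commute)
    also have "\<dots> \<le> B * dist x y + 2 * ?\<epsilon>"
      using dist_view(1)[OF Qb[OF q], of x y] by (simp add: B_def A_def)
    also have "\<dots> \<le> K * dist x y + K * r powr (1 + \<gamma>)"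
      using mult_right_mono[OF KB(2) zero_le_dist[of x y]] mult_right_mono[OF KB(3) e] by simp
    finally have 1: "dist (proj q x) (proj q y) \<le> K * dist x y + K * r powr (1 + \<gamma>)" .
    have "dist x y \<le> B * dist (view q x) (view q y)"
      using dist_view(2)[OF Qb[OF q], of x y] by (simp add: B_def A_def)
    also have "\<dots> \<le> B * (dist (proj q x) (proj q y) + 2 * ?\<epsilon>)"
    proof (rule mult_left_mono)
      show "dist (view q x) (view q y) \<le> dist (proj q x) (proj q y) + 2 * ?\<epsilon>"
        using vp'[OF q x r(1,3)] vp'[OF q y r(2,3)] dist_triangle[of "view q x" "view q y" "proj q x"]
          dist_triangle[of "proj q x" "view q y" "proj q y"] by (simp add: dist_commute)
    qed (use B in simp)
    also have "\<dots> = B * dist (proj q x) (proj q y) + (2 * B * K0) * r powr (1 + \<gamma>)" by (simp add: algebra_simps)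
    also have "\<dots> \<le> K * dist (proj q x) (proj q y) + K * r powr (1 + \<gamma>)"
      by (intro add_mono mult_right_mono KB) auto
    finally show "dist (proj q x) (proj q y) \<le> K * dist x y + K * r powr (1 + \<gamma>) \<and>
      dist x y \<le> K * dist (proj q x) (proj q y) + K * r powr (1 + \<gamma>)" using 1 by blast
  next
    fix q q' x r
    assume q: "q \<in> ?Q" and q': "q' \<in> ?Q" and x: "x \<in> ?Q"
      and r: "dist q q' \<le> r" "dist q x \<le> r" "dist q' x \<le> r" "r \<le> 1"
    have r0: "0 \<le> r" using r(1) zero_le_dist order_trans by blast
    let ?\<epsilon> = "r powr (1 + \<gamma>)"
    let ?h = "hshear e (tilt q) (heis_inv q' \<cdot> x)"
    have 1: "dist (proj q x) (view q x) \<le> K0 * ?\<epsilon>"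
      using vp'[OF q x r(2,4)] by (simp add: dist_commute)
    have 2: "dist (view q x) (view q q' \<cdot> view q' x) \<le> E * ?\<epsilon>"
    proof -
      have "dist (view q x) (view q q' \<cdot> view q' x) = dist ?h (view q' x)"
        unfolding view_change[OF Qb[OF q], of x q'] by simp
      also have "\<dots> \<le> (3 * sqrt (2 * A) + 2 * sqrt (2 + 6 * A)) * sqrt (norm (tilt q - tilt q')) * heis_norm (heis_inv q' \<cdot> x)"
        unfolding view_def[of q'] A_def
        by (rule dist_hshear_le[OF norm_e norm_tilt[OF Qb[OF q]] norm_tilt[OF Qb[OF q']]])
      also have "\<dots> \<le> (3 * sqrt (2 * A) + 2 * sqrt (2 + 6 * A)) * (sqrt H * r powr \<gamma>) * r"
      proof (intro mult_mono mult_left_mono)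
        have "norm (tilt q - tilt q') \<le> H * r powr \<alpha>"
          using N_near[OF _ Qb[OF q'] _ Qb[OF q], of r] q q' r by (simp add: tilt_def dist_commute)
        then have "sqrt (norm (tilt q - tilt q')) \<le> sqrt (H * r powr \<alpha>)" by simp
        also have "\<dots> = sqrt H * r powr (\<alpha> / 2)" by (simp add: real_sqrt_mult powr_half_sqrt[symmetric] powr_powr)
        also have "\<dots> \<le> sqrt H * r powr \<gamma>"
          using r0 r(4) H \<alpha> by (intro mult_left_mono powr_mono') (auto simp: \<gamma>_def \<beta>_def)
        finally show "sqrt (norm (tilt q - tilt q')) \<le> sqrt H * r powr \<gamma>" .
        show "heis_norm (heis_inv q' \<cdot> x) \<le> r" using r(3) by (simp add: dist_heis)
      qed (use A H r0 in \<open>auto simp: heis_norm_nonneg\<close>)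
      also have "\<dots> = E * (r powr \<gamma> * r)" by (simp add: E_def)
      also have "r powr \<gamma> * r = ?\<epsilon>" using r0 by (cases "r = 0") (auto simp: powr_add)
      finally show ?thesis .
    qed
    have 3: "dist (view q q' \<cdot> view q' x) (view q q' \<cdot> proj q' x) \<le> K0 * ?\<epsilon>"
      using vp'[OF q' x r(3,4)] by simp
    have 4: "dist (view q q' \<cdot> proj q' x) (proj q q' \<cdot> proj q' x)
      \<le> 2 * K0 * ?\<epsilon> + 2 * sqrt (K0 * (B + 2 * K0)) * ?\<epsilon>"
    proof -
      let ?d = "dist (view q q') (proj q q')"
      have "heis_norm (proj q' x) \<le> (B + 2 * K0) * r"
      proof -
        have "view q' q' = Heis (0, 0)"
          unfolding view_def by (rule heis_eqI) (simp_all add: shear_def sympl_simps)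
        then have "proj q' q' = Heis (0, 0)" by (simp add: proj_def)
        then have "heis_norm (proj q' x) = dist (proj q' q') (proj q' x)"
          by (simp add: dist_heis heis_inv_def)
        also have "\<dots> \<le> dist (view q' q') (view q' x) + K0 * r powr (1 + \<gamma>)"
          using vp'[OF q' x r(3,4)] dist_triangle[of "proj q' q'" "proj q' x" "view q' x"]
          unfolding \<open>proj q' q' = _\<close> \<open>view q' q' = _\<close> by simp
        also have "\<dots> \<le> B * r + K0 * r"
        proof (intro add_mono mult_left_mono)
          have "dist (view q' q') (view q' x) \<le> B * dist q' x"
            using dist_view(1)[OF Qb[OF q'], of q' x] by (simp add: B_def A_def)
          also have "\<dots> \<le> B * r" using r B by (intro mult_left_mono) auto
          finally show "dist (view q' q') (view q' x) \<le> B * r" .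
          show "r powr (1 + \<gamma>) \<le> r"
            using powr_mono'[of 1 "1 + \<gamma>" r] \<gamma> r0 r(4) by simp
        qed (use K0 in simp)
        also have "\<dots> \<le> (B + 2 * K0) * r" using K0 r0 by (simp add: algebra_simps)
        finally show ?thesis .
      qed
      moreover have d: "?d \<le> K0 * r powr (1 + \<beta>)" by (rule vp[OF q q' r(1)])
      ultimately have "?d * heis_norm (proj q' x) \<le> (K0 * r powr (1 + \<beta>)) * ((B + 2 * K0) * r)"
        using K0 by (intro mult_mono) (auto simp: heis_norm_nonneg)
      also have "\<dots> = K0 * (B + 2 * K0) * (r powr (1 + \<gamma>))\<^sup>2"
      proof -
        have "r powr (1 + \<beta>) * r = (r powr (1 + \<gamma>))\<^sup>2"
        proof (cases "r = 0")
          case False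
          then have "r powr (1 + \<beta>) * r = r powr (1 + \<beta>) * r powr 1" using r0 by simp
          also have "\<dots> = r powr ((1 + \<gamma>) + (1 + \<gamma>))" unfolding powr_add[symmetric] by (simp add: \<gamma>_def)
          also have "\<dots> = (r powr (1 + \<gamma>))\<^sup>2" by (simp only: powr_add power2_eq_square)
          finally show ?thesis .
        qed simp
        then show ?thesis by (simp add: mult_ac)
      qed
      finally have "sqrt (?d * heis_norm (proj q' x)) \<le> sqrt (K0 * (B + 2 * K0) * (r powr (1 + \<gamma>))\<^sup>2)"
        by simp
      also have "\<dots> = sqrt (K0 * (B + 2 * K0)) * ?\<epsilon>" by (simp add: real_sqrt_mult)
      finally show ?thesis
        using dist_mult_le[of "view q q'" "proj q' x" "proj q q'"] vp'[OF q q' r(1,4)] by simp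
    qed
    have "dist (proj q x) (proj q q' \<cdot> proj q' x) \<le> K0 * ?\<epsilon> + E * ?\<epsilon> + K0 * ?\<epsilon> + (2 * K0 * ?\<epsilon> + 2 * sqrt (K0 * (B + 2 * K0)) * ?\<epsilon>)"
      using 1 2 3 4 dist_triangle[of "proj q x" "proj q q' \<cdot> proj q' x" "view q x"]
        dist_triangle[of "view q x" "proj q q' \<cdot> proj q' x" "view q q' \<cdot> view q' x"]
        dist_triangle[of "view q q' \<cdot> view q' x" "proj q q' \<cdot> proj q' x" "view q q' \<cdot> proj q' x"]
      by linarith
    also have "\<dots> = (4 * K0 + 2 * sqrt (K0 * (B + 2 * K0)) + E) * ?\<epsilon>" by (simp add: algebra_simps)
    also have "\<dots> \<le> K * ?\<epsilon>" using B K0 by (intro mult_right_mono) (auto simp: K_def)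
    finally show "dist (proj q x) (proj q q' \<cdot> proj q' x) \<le> K * ?\<epsilon>" .
  qed (use KB \<rho> in auto)
qed

end


section \<open>A coding criterion for bilipschitz maps\<close>

text \<open>\<open>P q\<close> is a map from \<open>A\<close> to the group which near \<open>q\<close>, at scale \<open>r\<close>, is bilipschitz up to an error of
  order \<open>r powr (1 + \<gamma>)\<close>; different maps are compatible up to errors of the same order. \<open>idx k\<close>
  divides \<open>A\<close> into cells of diameter comparable to the scale \<open>\<rho>0 / 2 ^ k\<close>, distinct cells being apart by
  an only slightly higher power of the scale. The maps \<open>P q\<close>, with \<open>q\<close> a base point of the cell
  that contains the argument, are then glued along the nested cells to a single map \<open>glue\<close>, which is
  bilipschitz: two points are separated at a scale at which all later corrections are small
  compared with their distance.\<close>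

locale coding =
  fixes A W :: "'n::finite heis set" and P :: "'n heis \<Rightarrow> 'n heis \<Rightarrow> 'n heis"
    and idx :: "nat \<Rightarrow> 'n heis \<Rightarrow> 'i" and \<rho>0 K \<gamma> b :: real
  assumes \<rho>0: "0 < \<rho>0" "4 * \<rho>0 \<le> 1" and \<gamma>: "0 < \<gamma>" "\<gamma> \<le> 1" and K: "1 \<le> K" and b: "0 < b"
    and cell_diam: "\<And>k x y. x \<in> A \<Longrightarrow> y \<in> A \<Longrightarrow> idx k x = idx k y \<Longrightarrow> dist x y \<le> 4 * (\<rho>0 * (1/2) ^ k)"
    and cell_gap: "\<And>k x y. x \<in> A \<Longrightarrow> y \<in> A \<Longrightarrow> idx k x \<noteq> idx k y \<Longrightarrow>
      b * (\<rho>0 * (1/2) ^ k) powr (1 + \<gamma> / 2) \<le> dist x y"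
    and almost_bilipschitz: "\<And>q x y r. q \<in> A \<Longrightarrow> x \<in> A \<Longrightarrow> y \<in> A \<Longrightarrow> dist q x \<le> r \<Longrightarrow> dist q y \<le> r \<Longrightarrow> r \<le> 1 \<Longrightarrow>
      dist (P q x) (P q y) \<le> K * dist x y + K * r powr (1 + \<gamma>) \<and>
      dist x y \<le> K * dist (P q x) (P q y) + K * r powr (1 + \<gamma>)"
    and compatible: "\<And>q q' x r. q \<in> A \<Longrightarrow> q' \<in> A \<Longrightarrow> x \<in> A \<Longrightarrow>
      dist q q' \<le> r \<Longrightarrow> dist q x \<le> r \<Longrightarrow> dist q' x \<le> r \<Longrightarrow> r \<le> 1 \<Longrightarrow>
      dist (P q x) (P q q' \<cdot> P q' x) \<le> K * r powr (1 + \<gamma>)"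
    and small: "128 * K * (4 * K + 1) * \<rho>0 powr (\<gamma> / 2) \<le> b"
    and W: "closed W" "Heis (0, 0) \<in> W" "\<And>x y. x \<in> W \<Longrightarrow> y \<in> W \<Longrightarrow> x \<cdot> y \<in> W" "\<And>q x. P q x \<in> W"
begin

definition scale :: "nat \<Rightarrow> real" where "scale k = \<rho>0 * (1/2) ^ k"

lemma scale_pos: "0 < scale k" using \<rho>0 by (simp add: scale_def)

lemma scale_le: "4 * scale k \<le> 1"
proof -
  have "\<rho>0 * (1/2) ^ k \<le> \<rho>0" using \<rho>0 by (simp add: mult_left_le power_le_one)
  then show ?thesis using \<rho>0 unfolding scale_def by linarith
qed

definition same :: "nat \<Rightarrow> 'n heis \<Rightarrow> 'n heis \<Rightarrow> bool" where
  "same n x y \<longleftrightarrow> (\<forall>k\<le>n. idx k x = idx k y)"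

text \<open>The base point is a point of the nested cell of \<open>x\<close> that depends on the cell alone
  (\<open>base_cong\<close>).\<close>

definition base :: "nat \<Rightarrow> 'n heis \<Rightarrow> 'n heis" where
  "base n x = (SOME q. q \<in> A \<and> same n q x)"

primrec origin :: "nat \<Rightarrow> 'n heis \<Rightarrow> 'n heis" where
  "origin 0 x = Heis (0, 0)"
| "origin (Suc n) x = origin n x \<cdot> P (base n x) (base (Suc n) x)"

definition approx :: "nat \<Rightarrow> 'n heis \<Rightarrow> 'n heis" where
  "approx n x = origin n x \<cdot> P (base n x) x"

definition glue :: "'n heis \<Rightarrow> 'n heis" where
  "glue x = lim (\<lambda>n. approx n x)"

lemma base: "x \<in> A \<Longrightarrow> base n x \<in> A \<and> same n (base n x) x"
  unfolding base_def by (rule someI[of _ x]) (simp add: same_def)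

lemma base_cong: "same n x y \<Longrightarrow> base n x = base n y"
  unfolding base_def same_def by (intro arg_cong[of _ _ Eps] ext) auto

lemma same_mono: "same n x y \<Longrightarrow> m \<le> n \<Longrightarrow> same m x y"
  by (auto simp: same_def)

lemma origin_cong: "same n x y \<Longrightarrow> origin n x = origin n y"
proof (induction n)
  case (Suc n)
  then show ?case
    using base_cong[OF Suc.prems] base_cong[OF same_mono[OF Suc.prems, of n]] same_mono[OF Suc.prems, of n]
    by simp
qed simp

lemma dist_same: "x \<in> A \<Longrightarrow> y \<in> A \<Longrightarrow> same n x y \<Longrightarrow> dist x y \<le> 4 * scale n"
  unfolding scale_def by (rule cell_diam) (auto simp: same_def)

definition err :: "nat \<Rightarrow> real" where "err n = K * (4 * scale n) powr (1 + \<gamma>)"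

lemma err_nonneg: "0 \<le> err n" using K by (simp add: err_def)

lemma err_add: "err (n + j) \<le> err n * (1/2) ^ j"
proof -
  have "(4 * scale (n + j)) powr (1 + \<gamma>) = ((4 * scale n) * (1/2) ^ j) powr (1 + \<gamma>)"
    by (simp add: scale_def power_add mult_ac)
  also have "\<dots> = (4 * scale n) powr (1 + \<gamma>) * ((1/2) ^ j) powr (1 + \<gamma>)"
    using scale_pos[of n] by (simp add: powr_mult)
  also have "((1/2 :: real) ^ j) powr (1 + \<gamma>) \<le> ((1/2) ^ j) powr 1"
    using \<gamma> by (intro powr_mono') (auto simp: power_le_one)
  also have "((1/2 :: real) ^ j) powr 1 = (1/2) ^ j" by simp
  finally show ?thesis
    using K by (simp add: err_def mult_left_mono mult.assoc)
qed

lemma approx_step: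
  assumes x: "x \<in> A"
  shows "dist (approx n x) (approx (Suc n) x) \<le> err n"
proof -
  have b: "base n x \<in> A" "same n (base n x) x" "base (Suc n) x \<in> A" "same n (base (Suc n) x) x"
    using base[OF x, of n] base[OF x, of "Suc n"] same_mono[of "Suc n" _ _ n] by auto
  have "same n (base n x) (base (Suc n) x)" using b by (simp add: same_def)
  then have "dist (P (base n x) x) (P (base n x) (base (Suc n) x) \<cdot> P (base (Suc n) x) x) \<le> err n"
    unfolding err_def using b x scale_le by (intro compatible dist_same) auto
  then show ?thesis by (simp add: approx_def heis_assoc)
qed

lemma approx_tail:
  assumes x: "x \<in> A"
  shows "dist (approx n x) (approx (n + j) x) \<le> 2 * err n * (1 - (1/2) ^ j)"
proof (induction j)
  case (Suc j)
  have "dist (approx n x) (approx (n + Suc j) x)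
      \<le> dist (approx n x) (approx (n + j) x) + dist (approx (n + j) x) (approx (Suc (n + j)) x)"
    using dist_triangle[of "approx n x" "approx (n + Suc j) x" "approx (n + j) x"] by simp
  also have "\<dots> \<le> 2 * err n * (1 - (1/2) ^ j) + err n * (1/2) ^ j"
    by (intro add_mono Suc.IH order_trans[OF approx_step[OF x] err_add])
  finally show ?case by (simp add: algebra_simps)
qed simp

lemma err_tendsto_0: "err \<longlonglongrightarrow> 0"
proof (rule tendsto_sandwich[of "\<lambda>_. 0" _ _ "\<lambda>j. err 0 * (1/2) ^ j"])
  show "(\<lambda>j. err 0 * (1/2) ^ j) \<longlonglongrightarrow> 0"
    by (intro tendsto_mult_right_zero LIMSEQ_realpow_zero) auto
qed (use err_nonneg err_add[of 0] in auto)

lemma approx_near: "x \<in> A \<Longrightarrow> dist (approx n x) (approx (n + j) x) \<le> 2 * err n"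
proof -
  assume "x \<in> A"
  then have "dist (approx n x) (approx (n + j) x) \<le> 2 * err n * (1 - (1/2) ^ j)" by (rule approx_tail)
  also have "\<dots> \<le> 2 * err n * 1" using err_nonneg[of n] by (intro mult_left_mono) auto
  finally show ?thesis by simp
qed

lemma approx_tendsto: "x \<in> A \<Longrightarrow> (\<lambda>n. approx n x) \<longlonglongrightarrow> glue x"
proof -
  assume x: "x \<in> A"
  have "Cauchy (\<lambda>n. approx n x)"
    unfolding Cauchy_def
  proof (intro allI impI)
    fix e :: real assume "0 < e"
    then have "\<forall>\<^sub>F n in sequentially. err n < e / 4"
      using err_tendsto_0 by (intro order_tendstoD) auto
    then obtain M where M: "err M < e / 4" by (auto simp: eventually_sequentially)
    have half: "dist (approx M x) (approx m x) < e / 2" if "M \<le> m" for m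
      using approx_near[OF x, of M "m - M"] M that by simp
    have "dist (approx m x) (approx n x) < e" if "M \<le> m" "M \<le> n" for m n
      by (rule dist_triangle_half_r[OF half[OF that(1)] half[OF that(2)]])
    then show "\<exists>M. \<forall>m\<ge>M. \<forall>n\<ge>M. dist (approx m x) (approx n x) < e" by blast
  qed
  then have "convergent (\<lambda>n. approx n x)"
    using complete_heis unfolding complete_def convergent_def by blast
  then show ?thesis unfolding glue_def by (rule convergent_LIMSEQ_iff[THEN iffD1])
qed

lemma glue_near: "x \<in> A \<Longrightarrow> dist (approx n x) (glue x) \<le> 2 * err n"
proof -
  assume x: "x \<in> A"
  have "(\<lambda>j. dist (approx n x) (approx (j + n) x)) \<longlonglongrightarrow> dist (approx n x) (glue x)"
    by (intro tendsto_intros LIMSEQ_ignore_initial_segment approx_tendsto x)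
  then show ?thesis
    by (rule LIMSEQ_le_const2) (use approx_near[OF x, of n] in \<open>auto simp: add.commute\<close>)
qed

lemma glue_W: "x \<in> A \<Longrightarrow> glue x \<in> W"
proof -
  assume x: "x \<in> A"
  have "origin n x \<in> W" for n by (induction n) (auto intro: W)
  then have "approx n x \<in> W" for n unfolding approx_def by (intro W)
  then show ?thesis
    using W(1) approx_tendsto[OF x] closed_sequentially[of W "\<lambda>n. approx n x"] by blast
qed

text \<open>Let \<open>n\<close> be the last generation at which \<open>x\<close> and \<open>y\<close> share a cell. Then \<open>approx n\<close> treats both by one map
  \<open>P q\<close>, and all errors are of order \<open>scale n powr (1 + \<gamma>)\<close>, which is small compared with the gap
  of order \<open>scale n powr (1 + \<gamma> / 2)\<close> between cells of the next generation. The bound on \<open>\<rho>0\<close> keeps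
  \<open>(4 * K + 1) * err n\<close> below half of the distance of \<open>x\<close> and \<open>y\<close>.\<close>

lemma glue_bilipschitz:
  assumes x: "x \<in> A" and y: "y \<in> A" and xy: "dist x y < b * \<rho>0 powr (1 + \<gamma> / 2)"
  shows "dist (glue x) (glue y) \<le> (K + 1) * dist x y" "dist x y \<le> 2 * K * dist (glue x) (glue y)"
proof -
  have "dist (glue x) (glue y) \<le> (K + 1) * dist x y \<and> dist x y \<le> 2 * K * dist (glue x) (glue y)"
  proof (cases "x = y")
    case False
    define d where "d = dist x y"
    have d: "0 < d" using False by (simp add: d_def)
    have "\<exists>k. idx k x \<noteq> idx k y"
    proof (rule ccontr)
      assume "\<not> (\<exists>k. idx k x \<noteq> idx k y)"
      then have le: "d \<le> 4 * (\<rho>0 * (1/2) ^ k)" for k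
        unfolding d_def using x y by (intro cell_diam) auto
      have lim: "(\<lambda>k. 4 * (\<rho>0 * (1/2) ^ k)) \<longlonglongrightarrow> 0"
        by (intro tendsto_mult_right_zero LIMSEQ_realpow_zero) auto
      have "d \<le> 0" using LIMSEQ_le_const[OF lim] le by blast
      then show False using d by simp
    qed
    then obtain k where k: "idx k x \<noteq> idx k y" "\<And>j. j < k \<Longrightarrow> idx j x = idx j y"
      using exists_least_iff[of "\<lambda>k. idx k x \<noteq> idx k y"] by auto
    have "k \<noteq> 0"
    proof
      assume "k = 0"
      then show False using cell_gap[OF x y k(1)] xy by simp
    qed
    then obtain n where n: "k = Suc n" by (cases k) auto
    have s: "same n x y" using k(2) n by (simp add: same_def)
    have gap: "b * scale n powr (1 + \<gamma> / 2) \<le> 4 * d"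
    proof -
      have h: "scale n = 2 * scale k" by (simp add: scale_def n)
      have "2 powr (1 + \<gamma> / 2) \<le> 2 powr (2 :: real)" using \<gamma> by (intro powr_mono) auto
      then have four: "2 powr (1 + \<gamma> / 2) \<le> 4" by simp
      have "scale n powr (1 + \<gamma> / 2) = 2 powr (1 + \<gamma> / 2) * scale k powr (1 + \<gamma> / 2)"
        unfolding h using scale_pos[of k] by (simp add: powr_mult)
      also have "\<dots> \<le> 4 * scale k powr (1 + \<gamma> / 2)" using four by (intro mult_right_mono) auto
      finally have "scale n powr (1 + \<gamma> / 2) \<le> 4 * scale k powr (1 + \<gamma> / 2)" .
      from mult_left_mono[OF this less_imp_le[OF b]]
      show ?thesis using cell_gap[OF x y k(1)] by (simp add: scale_def d_def)
    qed
    have err_d: "2 * (4 * K + 1) * err n \<le> d"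
    proof -
      have "(4 * scale n) powr (1 + \<gamma>) \<le> 16 * scale n powr (1 + \<gamma>)"
      proof -
        have "(4 :: real) powr (1 + \<gamma>) \<le> 4 powr 2" using \<gamma> by (intro powr_mono) auto
        then show ?thesis using scale_pos[of n] by (simp add: powr_mult)
      qed
      also have "scale n powr (1 + \<gamma>) = scale n powr (1 + \<gamma> / 2) * scale n powr (\<gamma> / 2)"
      proof -
        have "1 + \<gamma> = (1 + \<gamma> / 2) + \<gamma> / 2" by simp
        then show ?thesis by (metis powr_add)
      qed
      also have "\<dots> \<le> scale n powr (1 + \<gamma> / 2) * \<rho>0 powr (\<gamma> / 2)"
      proof (intro mult_left_mono powr_mono2)
        show "scale n \<le> \<rho>0" using \<rho>0 by (simp add: scale_def mult_left_le power_le_one)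
      qed (use \<gamma> scale_pos[of n] in auto)
      finally have "err n \<le> K * (16 * (scale n powr (1 + \<gamma> / 2) * \<rho>0 powr (\<gamma> / 2)))"
        unfolding err_def using K by (intro mult_left_mono) auto
      then have "2 * (4 * K + 1) * err n \<le> 2 * (4 * K + 1) * (K * (16 * (scale n powr (1 + \<gamma> / 2) * \<rho>0 powr (\<gamma> / 2))))"
        using K by (intro mult_left_mono) auto
      also have "\<dots> = (128 * K * (4 * K + 1) * \<rho>0 powr (\<gamma> / 2)) * scale n powr (1 + \<gamma> / 2) / 4" by (simp add: algebra_simps)
      also have "\<dots> \<le> b * scale n powr (1 + \<gamma> / 2) / 4"
        using small by (intro divide_right_mono mult_right_mono) auto
      finally show ?thesis using gap by simp
    qed
    have q: "base n x \<in> A" "same n (base n x) x" using base[OF x] by auto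
    then have "same n (base n x) y" using s by (simp add: same_def)
    note ab = almost_bilipschitz[OF q(1) x y dist_same[OF q(1) x q(2)] dist_same[OF q(1) y this] scale_le]
    have eq: "dist (approx n x) (approx n y) = dist (P (base n x) x) (P (base n x) y)"
      unfolding approx_def using origin_cong[OF s] base_cong[OF s] by simp
    have up: "dist (approx n x) (approx n y) \<le> K * d + err n" and lo: "d \<le> K * dist (approx n x) (approx n y) + err n"
      using ab unfolding eq d_def err_def by auto
    have near: "dist (glue x) (glue y) \<le> dist (approx n x) (approx n y) + 4 * err n"
      "dist (approx n x) (approx n y) \<le> dist (glue x) (glue y) + 4 * err n"
      using glue_near[OF x, of n] glue_near[OF y, of n]
        dist_triangle[of "glue x" "glue y" "approx n x"] dist_triangle[of "approx n x" "glue y" "approx n y"]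
        dist_triangle[of "approx n x" "approx n y" "glue x"] dist_triangle[of "glue x" "approx n y" "glue y"]
      by (simp_all add: dist_commute)
    have "5 * err n \<le> (2 * (4 * K + 1)) * err n" using K err_nonneg[of n] by (intro mult_right_mono) auto
    then have "5 * err n \<le> d" using err_d by linarith
    then have 1: "dist (glue x) (glue y) \<le> (K + 1) * d" using near up by (simp add: distrib_right)
    have "d \<le> K * (dist (glue x) (glue y) + 4 * err n) + err n"
      using lo mult_left_mono[OF near(2), of K] K by linarith
    also have "\<dots> = K * dist (glue x) (glue y) + (4 * K + 1) * err n" by (simp add: algebra_simps)
    also have "(4 * K + 1) * err n \<le> d / 2"
    proof -
      have "2 * ((4 * K + 1) * err n) \<le> d" using err_d by (simp only: mult.assoc)
      then show ?thesis by linarith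
    qed
    finally have "d \<le> K * dist (glue x) (glue y) + d / 2" by simp
    then have "d \<le> 2 * K * dist (glue x) (glue y)" by simp
    then show ?thesis using 1 by (simp add: d_def)
  qed simp
  then show "dist (glue x) (glue y) \<le> (K + 1) * dist x y" "dist x y \<le> 2 * K * dist (glue x) (glue y)"
    by auto
qed

end

text \<open>Only covering by the image is asked, as in the definition of rectifiability.\<close>

definition LI_piece :: "'n::finite heis set \<Rightarrow> bool" where
  "LI_piece E \<longleftrightarrow> (\<exists>(W :: 'n heis set) F g L. vertical_subgroup_codim1 W \<and> closedin (top_of_set W) F \<and>
     (L-lipschitz_on F g) \<and> E \<subseteq> g ` F)"

lemma (in coding) LI_pieces:
  assumes A: "compact A" and V: "vertical_subgroup_codim1 W"
  obtains \<E> where "finite \<E>" "\<And>E. E \<in> \<E> \<Longrightarrow> LI_piece E" "A \<subseteq> \<Union>\<E>"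
proof -
  define s where "s = b * \<rho>0 powr (1 + \<gamma> / 2)"
  have s: "0 < s" using b \<rho>0 by (simp add: s_def)
  obtain Z where Z: "finite Z" "A \<subseteq> (\<Union>z\<in>Z. ball z (s / 3))"
    using A s unfolding compact_eq_totally_bounded by (metis divide_pos_pos zero_less_numeral)
  have piece: "LI_piece (A \<inter> cball z (s / 3))" for z
  proof -
    let ?E = "A \<inter> cball z (s / 3)"
    have cE: "compact ?E" by (intro compact_Int_closed A closed_cball)
    have bl: "dist (glue x) (glue y) \<le> (K + 1) * dist x y" "dist x y \<le> 2 * K * dist (glue x) (glue y)"
      if "x \<in> ?E" "y \<in> ?E" for x y
    proof -
      have "dist x y < b * \<rho>0 powr (1 + \<gamma> / 2)"
        unfolding s_def[symmetric] using that s dist_triangle3[of x y z] by auto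
      then show "dist (glue x) (glue y) \<le> (K + 1) * dist x y" "dist x y \<le> 2 * K * dist (glue x) (glue y)"
        using that by (auto intro: glue_bilipschitz)
    qed
    have "(K + 1)-lipschitz_on ?E glue" using bl K by (intro lipschitz_onI) auto
    then have "compact (glue ` ?E)"
      using cE by (intro compact_continuous_image lipschitz_on_continuous_on)
    moreover have "glue ` ?E \<subseteq> W" using glue_W by auto
    ultimately have cl: "closedin (top_of_set W) (glue ` ?E)"
      by (intro closed_subset compact_imp_closed)
    have inj: "inj_on glue ?E"
    proof (rule inj_onI)
      fix x y assume "x \<in> ?E" "y \<in> ?E" "glue x = glue y"
      then show "x = y" using bl(2)[of x y] by simp
    qed
    have "(2 * K)-lipschitz_on (glue ` ?E) (inv_into ?E glue)"
    proof (rule lipschitz_onI)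
      fix u v assume uv: "u \<in> glue ` ?E" "v \<in> glue ` ?E"
      have "inv_into ?E glue u \<in> ?E" "inv_into ?E glue v \<in> ?E"
        by (rule inv_into_into[OF uv(1)], rule inv_into_into[OF uv(2)])
      from bl(2)[OF this] show "dist (inv_into ?E glue u) (inv_into ?E glue v) \<le> 2 * K * dist u v"
        using uv by (simp add: f_inv_into_f)
    qed (use K in simp)
    moreover have "?E \<subseteq> inv_into ?E glue ` glue ` ?E"
      using inj by (auto simp: image_iff intro!: bexI inv_into_f_f[symmetric])
    ultimately show ?thesis unfolding LI_piece_def using V cl by blast
  qed
  show thesis
  proof (rule that[of "(\<lambda>z. A \<inter> cball z (s / 3)) ` Z"])
    show "A \<subseteq> \<Union> ((\<lambda>z. A \<inter> cball z (s / 3)) ` Z)"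
    proof
      fix x assume "x \<in> A"
      moreover then obtain z where "z \<in> Z" "x \<in> ball z (s / 3)" using Z(2) by blast
      ultimately show "x \<in> \<Union> ((\<lambda>z. A \<inter> cball z (s / 3)) ` Z)" by (auto intro: less_imp_le)
    qed
  qed (use Z piece in auto)
qed


section \<open>Cells with thin boundaries and rectifiability of a patch\<close>

text \<open>For each centre the shells are disjoint, so \<open>z\<close> lies in at most one of them per centre, and the centres
  are among those whose ball of radius \<open>2 r\<close> contains \<open>z\<close>.\<close>

lemma card_shells_le:
  fixes X :: "'a::metric_space set" and M :: nat
  assumes X: "finite X" and r: "0 < r" and M: "0 < M"
  shows "card {k \<in> {..<M}. \<exists>x\<in>X. \<bar>dist x z - (r + (2 * real k + 1) * (r / (2 * M)))\<bar> < r / (2 * M)}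
    \<le> card {x \<in> X. dist x z < 2 * r}"
proof -
  let ?h = "r / (2 * real M)"
  let ?sh = "\<lambda>x k. \<bar>dist x z - (r + (2 * real k + 1) * ?h)\<bar> < ?h"
  let ?Y = "{x \<in> X. dist x z < 2 * r}"
  have h: "0 < ?h" "2 * real M * ?h = r" using r M by auto
  have "{k \<in> {..<M}. \<exists>x\<in>X. ?sh x k} \<subseteq> (\<Union>x\<in>?Y. {k \<in> {..<M}. ?sh x k})"
  proof
    fix k assume "k \<in> {k \<in> {..<M}. \<exists>x\<in>X. ?sh x k}"
    then obtain x where x: "k < M" "x \<in> X" "?sh x k" by auto
    have "(2 * real k + 2) * ?h \<le> 2 * real M * ?h" using x(1) h by (intro mult_right_mono) auto
    then have "(2 * real k + 1) * ?h + ?h \<le> r" using h(2) by (simp only: distrib_right)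
    then have "dist x z < 2 * r" using x(3) by linarith
    then show "k \<in> (\<Union>x\<in>?Y. {k \<in> {..<M}. ?sh x k})" using x by blast
  qed
  then have "card {k \<in> {..<M}. \<exists>x\<in>X. ?sh x k} \<le> card (\<Union>x\<in>?Y. {k \<in> {..<M}. ?sh x k})"
    using X by (intro card_mono) auto
  also have "\<dots> \<le> (\<Sum>x\<in>?Y. card {k \<in> {..<M}. ?sh x k})" using X by (intro card_UN_le) auto
  also have "\<dots> \<le> (\<Sum>x\<in>?Y. 1)"
  proof (rule sum_mono)
    fix x
    have "k = l" if kl: "?sh x k" "?sh x l" for k l :: nat
    proof (rule ccontr)
      have "\<bar>(2 * real k + 1) * ?h - (2 * real l + 1) * ?h\<bar> < 2 * ?h" using kl by linarith
      moreover have "(2 * a + 1) * h - (2 * b + 1) * h = 2 * h * (a - b)" for a b h :: real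
        by (simp add: algebra_simps)
      moreover have "\<bar>2 * h * t\<bar> = 2 * h * \<bar>t\<bar>" if "0 < h" for h t :: real
        using that by (simp add: abs_mult)
      ultimately have "2 * ?h * \<bar>real k - real l\<bar> < 2 * ?h * 1" using h(1) by (simp only: mult_1_right)
      then have "\<bar>real k - real l\<bar> < 1" using h(1) by (subst (asm) mult_less_cancel_left_pos) auto
      moreover assume "k \<noteq> l"
      ultimately show False by linarith
    qed
    then have "card {k \<in> {..<M}. ?sh x k} \<le> Suc 0" by (subst card_le_Suc0_iff_eq) auto
    then show "card {k \<in> {..<M}. ?sh x k} \<le> 1" by simp
  qed
  finally show ?thesis by simp
qed

text \<open>Among \<open>M\<close> radii whose shells are disjoint for each centre, one has shells that carry at most the
  share \<open>1 / M\<close> of the mass, up to the multiplicity of the balls.\<close>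

lemma thin_shells:
  fixes X :: "'a::metric_space set" and \<mu> :: "'a measure" and M :: nat
  assumes X: "finite X" and r: "0 < r" and M: "0 < M"
    and \<mu>: "space \<mu> = UNIV" "\<And>A. A \<in> sets borel \<Longrightarrow> A \<in> sets \<mu>" and E: "E \<in> sets \<mu>"
    and overlap: "\<And>z. z \<in> E \<Longrightarrow> card {x \<in> X. dist x z < 2 * r} \<le> m"
  obtains \<rho> where "r \<le> \<rho>" "\<rho> \<le> 2 * r"
    "of_nat M * emeasure \<mu> (E \<inter> (\<Union>x\<in>X. {z. \<bar>dist x z - \<rho>\<bar> < r / (2 * M)})) \<le> of_nat m * emeasure \<mu> E"
proof -
  define \<rho> where "\<rho> k = r + (2 * real k + 1) * (r / (2 * M))" for k :: nat
  define B where "B k = E \<inter> (\<Union>x\<in>X. {z. \<bar>dist x z - \<rho> k\<bar> < r / (2 * M)})" for k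
  have "open (\<Union>x\<in>X. {z. \<bar>dist x z - \<rho> k\<bar> < r / (2 * M)})" for k
    by (intro open_UN ballI open_Collect_less continuous_intros)
  then have Bm: "B k \<in> sets \<mu>" for k unfolding B_def by (intro sets.Int E \<mu> borel_open)
  have "(\<Sum>k<M. emeasure \<mu> (B k)) = (\<Sum>k<M. \<integral>\<^sup>+z. indicator (B k) z \<partial>\<mu>)" using Bm by simp
  also have "\<dots> = (\<integral>\<^sup>+z. (\<Sum>k<M. indicator (B k) z) \<partial>\<mu>)" using Bm by (intro nn_integral_sum[symmetric]) auto
  also have "\<dots> \<le> (\<integral>\<^sup>+z. of_nat m * indicator E z \<partial>\<mu>)"
  proof (rule nn_integral_mono)
    fix z
    show "(\<Sum>k<M. indicator (B k) z) \<le> (of_nat m * indicator E z :: ennreal)"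
    proof (cases "z \<in> E")
      case True
      have "(\<Sum>k<M. indicator (B k) z :: ennreal) = of_nat (card {k \<in> {..<M}. z \<in> B k})"
        by (simp add: indicator_def sum.If_cases Int_def)
      also have "{k \<in> {..<M}. z \<in> B k} = {k \<in> {..<M}. \<exists>x\<in>X. \<bar>dist x z - (r + (2 * real k + 1) * (r / (2 * M)))\<bar> < r / (2 * M)}"
        using True by (auto simp: B_def \<rho>_def)
      also have "of_nat (card \<dots>) \<le> (of_nat m :: ennreal)"
        using order_trans[OF card_shells_le[OF X r M, of z] overlap[OF True]] by (simp only: of_nat_le_iff)
      finally show ?thesis using True by simp
    next
      case False
      then show ?thesis by (simp add: B_def)
    qed
  qed
  also have "\<dots> = of_nat m * emeasure \<mu> E" using E by (simp add: nn_integral_cmult)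
  finally have total: "(\<Sum>k<M. emeasure \<mu> (B k)) \<le> of_nat m * emeasure \<mu> E" .
  have "\<exists>k\<in>{..<M}. \<forall>j\<in>{..<M}. emeasure \<mu> (B k) \<le> emeasure \<mu> (B j)"
  proof -
    let ?V = "(\<lambda>k. emeasure \<mu> (B k)) ` {..<M}"
    have ne: "?V \<noteq> {}" "finite ?V" using M by auto
    have "Min ?V \<in> ?V" by (rule Min_in[OF ne(2,1)])
    then obtain k where k: "k < M" "Min ?V = emeasure \<mu> (B k)" by auto
    have "emeasure \<mu> (B k) \<le> emeasure \<mu> (B j)" if "j \<in> {..<M}" for j
      unfolding k(2)[symmetric] using that ne by (intro Min_le) auto
    then show ?thesis using k(1) by auto
  qed
  then obtain k where k: "k < M" "\<And>j. j < M \<Longrightarrow> emeasure \<mu> (B k) \<le> emeasure \<mu> (B j)" by auto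
  have "of_nat M * emeasure \<mu> (B k) = (\<Sum>j<M. emeasure \<mu> (B k))" by simp
  also have "\<dots> \<le> (\<Sum>j<M. emeasure \<mu> (B j))" using k by (intro sum_mono) auto
  also note total
  finally have "of_nat M * emeasure \<mu> (B k) \<le> of_nat m * emeasure \<mu> E" .
  moreover have "r \<le> \<rho> k" "\<rho> k \<le> 2 * r"
  proof -
    show "r \<le> \<rho> k" using r by (simp add: \<rho>_def)
    have "(2 * real k + 1) * (r / (2 * M)) \<le> (2 * real M) * (r / (2 * M))"
      using k r by (intro mult_right_mono) auto
    also have "\<dots> = r" using M by simp
    finally show "\<rho> k \<le> 2 * r" by (simp add: \<rho>_def)
  qed
  ultimately show thesis using that[of "\<rho> k"] unfolding B_def by blast
qed

lemma compact_separated_card: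
  fixes A :: "'a::metric_space set"
  assumes "compact A" "0 < r"
  shows "\<exists>M. \<forall>X. finite X \<longrightarrow> X \<subseteq> A \<longrightarrow> (\<forall>x\<in>X. \<forall>y\<in>X. x \<noteq> y \<longrightarrow> r \<le> dist x y) \<longrightarrow> card X \<le> M"
proof -
  have "0 < r / 2" using assms by simp
  then obtain Z where Z: "finite Z" "A \<subseteq> (\<Union>z\<in>Z. ball z (r / 2))"
    using assms(1) unfolding compact_eq_totally_bounded by metis
  show ?thesis
  proof (intro exI[of _ "card Z"] allI impI)
    fix X assume X: "finite X" "X \<subseteq> A" and sep: "\<forall>x\<in>X. \<forall>y\<in>X. x \<noteq> y \<longrightarrow> r \<le> dist x y"
    have "\<forall>x\<in>X. \<exists>z\<in>Z. dist z x < r / 2" using X Z by fastforce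
    then obtain c where c: "\<And>x. x \<in> X \<Longrightarrow> c x \<in> Z \<and> dist (c x) x < r / 2" by metis
    have "inj_on c X"
    proof (rule inj_onI, rule ccontr)
      fix x y assume xy: "x \<in> X" "y \<in> X" "c x = c y" "x \<noteq> y"
      then show False
        using sep c[of x] c[of y] dist_triangle3[of x y "c x"] by force
    qed
    then show "card X \<le> card Z" using c Z(1) by (intro card_inj_on_le[of c]) auto
  qed
qed

lemma half_power_powr: "((1/2 :: real) ^ n) powr s = ((1/2) powr s) ^ n"
  by (simp add: powr_powr powr_realpow[symmetric] mult.commute)

context graded_patch begin

lemma compact_surface:
  assumes "\<rho> \<le> R / 8"
  shows "compact (S \<inter> cball p \<rho>)"
proof -
  have "(3 * L)-lipschitz_on (cball p \<rho>) f"
  proof (rule lipschitz_onI)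
    fix x y assume xy: "x \<in> cball p \<rho>" "y \<in> cball p \<rho>"
    then have "dist p x + 3 * dist x y < R"
      using assms R dist_triangle3[of x y p] by simp
    from lipschitz_f[OF this] show "dist (f x) (f y) \<le> 3 * L * dist x y"
      by (simp add: dist_real_def abs_minus_commute)
  qed (use L in simp)
  then have "closed (cball p \<rho> \<inter> f -` {0})"
    by (intro continuous_closed_preimage lipschitz_on_continuous_on) auto
  moreover have "S \<inter> cball p \<rho> = cball p \<rho> \<inter> f -` {0}"
  proof (rule set_eqI)
    fix x
    have "x \<in> ball p R" if "x \<in> cball p \<rho>" using that assms R by simp
    then show "x \<in> S \<inter> cball p \<rho> \<longleftrightarrow> x \<in> cball p \<rho> \<inter> f -` {0}" using S_zero by auto
  qed
  ultimately have "closed (S \<inter> cball p \<rho>)" by simp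
  then show ?thesis
    using compact_Int_closed[OF compact_cball_heis[of p \<rho>]] by (metis inf.right_idem inf_commute)
qed

text \<open>At each scale a maximal separated set of centres and a radius with thin shells are fixed, and a
  point is assigned to the first ball that contains it. By the Borel-Cantelli lemma almost every
  point avoids the shells of all fine scales; the points that do so from a given scale on form
  a compact set to which the coding criterion applies.\<close>

lemma patch_rectifiable:
  obtains \<rho> \<E> Z where "0 < \<rho>" "compact (S \<inter> cball p \<rho>)" "countable \<E>" "\<And>E. E \<in> \<E> \<Longrightarrow> LI_piece E"
    "hausdorff_outer (2 * CARD('n) + 1) Z = 0" "S \<inter> cball p \<rho> \<subseteq> \<Union>\<E> \<union> Z"
proof (rule proj_estimates, rule separated_card_le[where 'n = 'n])
  fix K0 \<rho> :: real and m :: nat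
  let ?Q = "S \<inter> cball p \<rho>"
  assume K0: "0 < K0" and \<rho>: "0 < \<rho>" "\<rho> \<le> R / 8"
    and bl0: "\<And>q x y r. q \<in> ?Q \<Longrightarrow> x \<in> ?Q \<Longrightarrow> y \<in> ?Q \<Longrightarrow> dist q x \<le> r \<Longrightarrow> dist q y \<le> r \<Longrightarrow> r \<le> 1 \<Longrightarrow>
      dist (proj q x) (proj q y) \<le> K0 * dist x y + K0 * r powr (1 + \<gamma>) \<and>
      dist x y \<le> K0 * dist (proj q x) (proj q y) + K0 * r powr (1 + \<gamma>)"
    and comp0: "\<And>q q' x r. q \<in> ?Q \<Longrightarrow> q' \<in> ?Q \<Longrightarrow> x \<in> ?Q \<Longrightarrow>
      dist q q' \<le> r \<Longrightarrow> dist q x \<le> r \<Longrightarrow> dist q' x \<le> r \<Longrightarrow> r \<le> 1 \<Longrightarrow>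
      dist (proj q x) (proj q q' \<cdot> proj q' x) \<le> K0 * r powr (1 + \<gamma>)"
    and m: "\<And>(X :: 'n heis set) z r. finite X \<Longrightarrow> 0 < r \<Longrightarrow>
       (\<And>x y. x \<in> X \<Longrightarrow> y \<in> X \<Longrightarrow> x \<noteq> y \<Longrightarrow> r \<le> dist x y) \<Longrightarrow>
       (\<And>x. x \<in> X \<Longrightarrow> dist z x < 2 * r) \<Longrightarrow> card X \<le> m"
  define K where "K = max K0 1"
  have K: "1 \<le> K" "K0 \<le> K" by (auto simp: K_def)
  have Qc: "compact ?Q" by (rule compact_surface[OF \<rho>(2)])
  define \<mu> where "\<mu> = (hmeas (real (2 * CARD('n) + 1)) :: 'n heis measure)"
  have dim: "0 < real (2 * CARD('n) + 1)" by simp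
  have \<mu>: "space \<mu> = UNIV" "\<And>A. A \<in> sets borel \<Longrightarrow> A \<in> sets \<mu>"
    using borel_subset_hmeas[OF dim] by (auto simp: \<mu>_def)
  have Qm: "?Q \<in> sets \<mu>" using Qc by (intro \<mu> borel_closed compact_imp_closed)
  have Qfin: "emeasure \<mu> ?Q < top"
  proof -
    have "emeasure \<mu> ?Q = hausdorff_outer (2 * CARD('n) + 1) ?Q"
      using Qm unfolding \<mu>_def by (rule emeasure_hmeas)
    also have "\<dots> \<le> hausdorff_outer (2 * CARD('n) + 1) (S \<inter> cball p (R / 8))"
      using \<rho> by (intro hausdorff_outer_mono) auto
    also have "\<dots> < top" by (rule hausdorff_outer_surface_finite)
    finally show ?thesis .
  qed
  define r :: "nat \<Rightarrow> real" where "r n = (1/2) ^ n" for n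
  have r: "0 < r n" "r n \<le> 1" for n by (auto simp: r_def power_le_one)
  \<comment> \<open>The relative thickness \<open>1 / M n\<close> of the shells is of order \<open>r n powr (\<gamma> / 2)\<close>: summable over the scales, yet
     large compared with the relative error \<open>r n powr \<gamma>\<close> of the projections.\<close>
  define M where "M n = nat \<lceil>r n powr (- (\<gamma> / 2))\<rceil>" for n
  have M: "0 < M n" "r n powr (- (\<gamma> / 2)) \<le> real (M n)" "real (M n) \<le> 2 * r n powr (- (\<gamma> / 2))" for n
  proof -
    have "1 \<le> r n powr (- (\<gamma> / 2))"
      using r[of n] \<gamma> powr_mono'[of "- (\<gamma> / 2)" 0 "r n"] by simp
    then show "0 < M n" "r n powr (- (\<gamma> / 2)) \<le> real (M n)" "real (M n) \<le> 2 * r n powr (- (\<gamma> / 2))"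
      unfolding M_def by linarith+
  qed
  have "\<exists>xs s. set xs \<subseteq> ?Q \<and> ?Q \<subseteq> (\<Union>x\<in>set xs. ball x (r n)) \<and> r n \<le> s \<and> s \<le> 2 * r n \<and>
      of_nat (M n) * emeasure \<mu> (?Q \<inter> (\<Union>x\<in>set xs. {z. \<bar>dist x z - s\<bar> < r n / (2 * M n)})) \<le> of_nat m * emeasure \<mu> ?Q" for n
  proof -
    obtain B where "\<And>X. finite X \<Longrightarrow> X \<subseteq> ?Q \<Longrightarrow> (\<And>x y. x \<in> X \<Longrightarrow> y \<in> X \<Longrightarrow> x \<noteq> y \<Longrightarrow> r n \<le> dist x y) \<Longrightarrow> card X \<le> B"
      using compact_separated_card[OF Qc r(1)[of n]] by metis
    then obtain X where X: "finite X" "X \<subseteq> ?Q" "\<And>x y. x \<in> X \<Longrightarrow> y \<in> X \<Longrightarrow> x \<noteq> y \<Longrightarrow> r n \<le> dist x y"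
      "?Q \<subseteq> (\<Union>x\<in>X. ball x (r n))"
      using maximal_separated_exists[OF r(1)[of n], of ?Q] by metis
    have ov: "card {x \<in> X. dist x z < 2 * r n} \<le> m" for z
      using X(1,3) by (intro m[of _ "r n" z]) (auto simp: r dist_commute)
    obtain s where s: "r n \<le> s" "s \<le> 2 * r n"
      "of_nat (M n) * emeasure \<mu> (?Q \<inter> (\<Union>x\<in>X. {z. \<bar>dist x z - s\<bar> < r n / (2 * M n)})) \<le> of_nat m * emeasure \<mu> ?Q"
      by (rule thin_shells[OF X(1) r(1)[of n] M(1)[of n] \<mu> Qm ov]) (assumption, rule that)
    obtain xs where xs: "set xs = X" using finite_list[OF X(1)] by blast
    show ?thesis
      by (rule exI[of _ xs], rule exI[of _ s], unfold xs, intro conjI X s)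
  qed
  then obtain xs s where xs: "\<And>n. set (xs n) \<subseteq> ?Q" "\<And>n. ?Q \<subseteq> (\<Union>x\<in>set (xs n). ball x (r n))"
    and s: "\<And>n. r n \<le> s n" "\<And>n. s n \<le> 2 * r n"
    and thin: "\<And>n. of_nat (M n) * emeasure \<mu> (?Q \<inter> (\<Union>x\<in>set (xs n). {z. \<bar>dist x z - s n\<bar> < r n / (2 * M n)})) \<le> of_nat m * emeasure \<mu> ?Q"
    by metis
  define V where "V n = (\<Union>x\<in>set (xs n). {z. \<bar>dist x z - s n\<bar> < r n / (2 * M n)})" for n
  have openV: "open (V n)" for n
    unfolding V_def by (intro open_UN ballI open_Collect_less continuous_intros)
  have bad_meas: "?Q \<inter> V n \<in> sets \<mu>" for n using openV by (intro sets.Int Qm \<mu> borel_open)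
  have bad_fin: "emeasure \<mu> (?Q \<inter> V n) < top" for n
    using emeasure_mono[of "?Q \<inter> V n" ?Q \<mu>] Qm Qfin by (auto intro: le_less_trans)
  define \<theta> :: real where "\<theta> = (1/2) powr (\<gamma> / 2)"
  have \<theta>: "0 < \<theta>" "\<theta> < 1" using \<gamma> powr_less_mono2[of "\<gamma> / 2" "1/2" 1] by (auto simp: \<theta>_def)
  have r\<theta>: "r n powr (\<gamma> / 2) = \<theta> ^ n" for n unfolding r_def \<theta>_def by (rule half_power_powr)
  have bad_bound: "measure \<mu> (?Q \<inter> V n) \<le> real m * measure \<mu> ?Q * \<theta> ^ n" for n
  proof -
    have "ennreal (real (M n) * measure \<mu> (?Q \<inter> V n)) \<le> ennreal (real m * measure \<mu> ?Q)"
      using thin[of n] bad_fin[of n] Qfin unfolding V_def[symmetric]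
      by (simp add: emeasure_eq_ennreal_measure ennreal_mult ennreal_of_nat_eq_real_of_nat)
    then have 1: "real (M n) * measure \<mu> (?Q \<inter> V n) \<le> real m * measure \<mu> ?Q"
      by (subst (asm) ennreal_le_iff) auto
    have "1 = \<theta> ^ n * r n powr (- (\<gamma> / 2))"
      unfolding r\<theta>[symmetric] using r(1)[of n] by (simp add: powr_add[symmetric])
    also have "\<dots> \<le> \<theta> ^ n * real (M n)" using M(2)[of n] \<theta> by (intro mult_left_mono) auto
    finally have "1 * measure \<mu> (?Q \<inter> V n) \<le> \<theta> ^ n * real (M n) * measure \<mu> (?Q \<inter> V n)"
      by (intro mult_right_mono) auto
    also have "\<dots> \<le> \<theta> ^ n * (real m * measure \<mu> ?Q)"
      using 1 \<theta> by (simp add: mult.assoc)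
    finally show ?thesis by (simp add: mult_ac)
  qed
  have null: "limsup (\<lambda>n. ?Q \<inter> V n) \<in> null_sets \<mu>"
  proof (rule borel_cantelli_limsup1[OF bad_meas])
    show "emeasure \<mu> (?Q \<inter> V n) < \<infinity>" for n using bad_fin by simp
    show "summable (\<lambda>n. measure \<mu> (?Q \<inter> V n))"
    proof (rule summable_comparison_test')
      show "summable (\<lambda>n. real m * measure \<mu> ?Q * \<theta> ^ n)"
        using \<theta> by (intro summable_mult summable_geometric) simp
      show "norm (measure \<mu> (?Q \<inter> V n)) \<le> real m * measure \<mu> ?Q * \<theta> ^ n" if "0 \<le> n" for n
        using bad_bound[of n] by simp
    qed
  qed
  have "(\<lambda>n. 128 * K * (4 * K + 1) * \<theta> ^ n) \<longlonglongrightarrow> 0"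
    using \<theta> by (intro tendsto_mult_right_zero LIMSEQ_realpow_zero) auto
  then have "\<forall>\<^sub>F n in sequentially. 128 * K * (4 * K + 1) * \<theta> ^ n < 1 / 4"
    by (rule order_tendstoD) simp
  moreover have "\<forall>\<^sub>F n in sequentially. 2 \<le> n" by (rule eventually_ge_at_top)
  ultimately have "\<forall>\<^sub>F n in sequentially. 128 * K * (4 * K + 1) * \<theta> ^ n < 1 / 4 \<and> 2 \<le> n"
    by (rule eventually_conj)
  then obtain N0 where N0: "\<And>n. N0 \<le> n \<Longrightarrow> 128 * K * (4 * K + 1) * \<theta> ^ n < 1 / 4 \<and> 2 \<le> n"
    by (auto simp: eventually_sequentially)
  define A where "A n = ?Q \<inter> (\<Inter>k\<in>{n..}. - V k)" for n
  have "\<exists>\<E>. finite \<E> \<and> (\<forall>E\<in>\<E>. LI_piece E) \<and> A n \<subseteq> \<Union>\<E>" if n: "N0 \<le> n" for n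
  proof -
    have cA: "compact (A n)" unfolding A_def by (intro compact_Int_closed Qc) (auto intro!: closed_INT closed_Compl openV)
    define idx where "idx k z = (LEAST i. i < length (xs (n + k)) \<and> dist (xs (n + k) ! i) z < s (n + k))" for k z
    have idx: "idx k z < length (xs (n + k))" "dist (xs (n + k) ! idx k z) z < s (n + k)" if "z \<in> A n" for k z
    proof -
      have "z \<in> ?Q" using that by (simp add: A_def)
      then have "z \<in> (\<Union>x\<in>set (xs (n + k)). ball x (r (n + k)))" by (rule subsetD[OF xs(2)])
      then have "\<exists>x\<in>set (xs (n + k)). dist x z < r (n + k)" by auto
      then obtain i where "i < length (xs (n + k)) \<and> dist (xs (n + k) ! i) z < s (n + k)"
        using s(1)[of "n + k"] by (fastforce simp: in_set_conv_nth)
      then have "idx k z < length (xs (n + k)) \<and> dist (xs (n + k) ! idx k z) z < s (n + k)"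
        unfolding idx_def by (rule LeastI)
      then show "idx k z < length (xs (n + k))" "dist (xs (n + k) ! idx k z) z < s (n + k)" by auto
    qed
    have rk: "r n * (1/2) ^ k = r (n + k)" for k by (simp add: r_def power_add)
    have gap_less: "1/4 * r (n + k) powr (1 + \<gamma> / 2) \<le> dist x y"
      if xy: "x \<in> A n" "y \<in> A n" "idx k x < idx k y" for x y k
    proof -
      let ?j = "n + k"
      let ?c = "xs ?j ! idx k x"
      have lx: "idx k x < length (xs ?j)" by (rule idx(1)[OF xy(1)])
      have "\<not> dist ?c y < s ?j"
      proof
        assume "dist ?c y < s ?j"
        then have "idx k y \<le> idx k x" unfolding idx_def[of k y] using lx by (intro Least_le) simp
        then show False using xy(3) by simp
      qed
      moreover have "dist ?c x \<le> s ?j - r ?j / (2 * M ?j)"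
      proof -
        have "?c \<in> set (xs ?j)" using lx by simp
        moreover have "x \<notin> V ?j" using xy(1) by (auto simp: A_def)
        ultimately have "r ?j / (2 * M ?j) \<le> \<bar>dist ?c x - s ?j\<bar>" unfolding V_def by (auto simp: not_less)
        then show ?thesis using idx(2)[OF xy(1), of k] by linarith
      qed
      ultimately have d: "r ?j / (2 * M ?j) \<le> dist x y"
        using dist_triangle[of ?c y x] by linarith
      have "1/4 * r ?j powr (1 + \<gamma> / 2) = r ?j / (4 * r ?j powr (- (\<gamma> / 2)))"
      proof -
        have eq: "r ?j powr (1 + \<gamma> / 2) = r ?j * r ?j powr (\<gamma> / 2)"
          using powr_add[of "r ?j" 1 "\<gamma> / 2"] r(1)[of ?j] by simp
        show ?thesis unfolding eq by (simp add: powr_minus field_simps)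
      qed
      also have "\<dots> \<le> r ?j / (2 * M ?j)"
        using r(1)[of ?j] M[of ?j] by (intro divide_left_mono) auto
      finally show ?thesis using d by linarith
    qed
    interpret coding "A n" "vplane e" proj idx "r n" K \<gamma> "1/4"
    proof
      show "4 * r n \<le> 1"
      proof -
        have "2 \<le> n" using N0[OF n] by simp
        then have "(1/2 :: real) ^ n \<le> (1/2) ^ 2" by (intro power_decreasing) auto
        then show ?thesis by (simp add: r_def power2_eq_square)
      qed
      show "dist x y \<le> 4 * (r n * (1/2) ^ k)" if "x \<in> A n" "y \<in> A n" "idx k x = idx k y" for k x y
        using idx(2)[OF that(1), of k] idx(2)[OF that(2), of k] s(2)[of "n + k"]
          dist_triangle3[of x y "xs (n + k) ! idx k x"] unfolding that(3) rk by linarith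
      show "1/4 * (r n * (1/2) ^ k) powr (1 + \<gamma> / 2) \<le> dist x y" if "x \<in> A n" "y \<in> A n" "idx k x \<noteq> idx k y" for k x y
        using gap_less[OF that(1,2), of k] gap_less[OF that(2,1), of k] that(3) unfolding rk
        by (metis dist_commute linorder_neqE_nat)
      show "dist (proj q x) (proj q y) \<le> K * dist x y + K * t powr (1 + \<gamma>) \<and>
          dist x y \<le> K * dist (proj q x) (proj q y) + K * t powr (1 + \<gamma>)"
        if "q \<in> A n" "x \<in> A n" "y \<in> A n" "dist q x \<le> t" "dist q y \<le> t" "t \<le> 1" for q x y t
      proof -
        have mono: "K0 * u + K0 * t powr (1 + \<gamma>) \<le> K * u + K * t powr (1 + \<gamma>)" if "0 \<le> u" for u
          using that K by (intro add_mono mult_right_mono) auto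
        have "dist (proj q x) (proj q y) \<le> K0 * dist x y + K0 * t powr (1 + \<gamma>) \<and>
          dist x y \<le> K0 * dist (proj q x) (proj q y) + K0 * t powr (1 + \<gamma>)"
          by (rule bl0) (use that in \<open>auto simp: A_def\<close>)
        then show ?thesis using mono[of "dist x y"] mono[of "dist (proj q x) (proj q y)"] by force
      qed
      show "dist (proj q x) (proj q q' \<cdot> proj q' x) \<le> K * t powr (1 + \<gamma>)"
        if "q \<in> A n" "q' \<in> A n" "x \<in> A n" "dist q q' \<le> t" "dist q x \<le> t" "dist q' x \<le> t" "t \<le> 1" for q q' x t
      proof -
        have "dist (proj q x) (proj q q' \<cdot> proj q' x) \<le> K0 * t powr (1 + \<gamma>)"
          by (rule comp0) (use that in \<open>auto simp: A_def\<close>)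
        also have "\<dots> \<le> K * t powr (1 + \<gamma>)" using K by (intro mult_right_mono) auto
        finally show ?thesis .
      qed
      show "128 * K * (4 * K + 1) * r n powr (\<gamma> / 2) \<le> 1 / 4"
        unfolding r\<theta> using N0[OF n] by simp
    qed (use r K \<gamma> closed_vplane vplane_subgroup proj_vplane in auto)
    have "e \<noteq> 0" using norm_e by auto
    then have "vertical_subgroup_codim1 (vplane e)" by (rule vertical_vplane)
    from LI_pieces[OF cA this] show ?thesis by metis
  qed
  then obtain \<E> where \<E>: "\<And>n. N0 \<le> n \<Longrightarrow> finite (\<E> n) \<and> (\<forall>E\<in>\<E> n. LI_piece E) \<and> A n \<subseteq> \<Union>(\<E> n)" by metis
  show thesis
  proof (rule that[of \<rho> "\<Union>n\<in>{N0..}. \<E> n" "limsup (\<lambda>n. ?Q \<inter> V n)"])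
    show "countable (\<Union>n\<in>{N0..}. \<E> n)" using \<E> by (intro countable_UN) (auto intro: countable_finite)
    show "hausdorff_outer (2 * CARD('n) + 1) (limsup (\<lambda>n. ?Q \<inter> V n)) = 0"
      using null emeasure_hmeas[of "limsup (\<lambda>n. ?Q \<inter> V n)"] unfolding \<mu>_def by (metis null_setsD1 null_setsD2)
    show "?Q \<subseteq> \<Union>(\<Union>n\<in>{N0..}. \<E> n) \<union> limsup (\<lambda>n. ?Q \<inter> V n)"
    proof
      fix x assume x: "x \<in> ?Q"
      show "x \<in> \<Union>(\<Union>n\<in>{N0..}. \<E> n) \<union> limsup (\<lambda>n. ?Q \<inter> V n)"
      proof (cases "x \<in> limsup (\<lambda>n. ?Q \<inter> V n)")
        case False
        then obtain n where n: "\<And>k. n \<le> k \<Longrightarrow> x \<notin> V k" using x by (auto simp: limsup_INF_SUP)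
        then have "x \<in> A (max n N0)" using x by (auto simp: A_def)
        then have "x \<in> \<Union>(\<E> (max n N0))" using \<E>[of "max n N0"] by auto
        then show ?thesis by (intro UnI1) (auto intro!: exI[of _ "max n N0"])
      qed simp
    qed
  qed (use \<rho> Qc \<E> in auto)
qed

end


section \<open>Rectifiability of surfaces\<close>

text \<open>With \<open>e\<close> the direction of the gradient at \<open>p\<close>, continuity keeps the gradient within half its length of its
  value at \<open>p\<close>, and a quotient of Hoelder continuous functions with denominator bounded below is
  Hoelder continuous.\<close>

lemma graded_patch_exists:
  assumes \<alpha>: "0 < \<alpha>" "\<alpha> \<le> 1" and S: "C1H_surface \<alpha> S" and p: "p \<in> S"
  shows "\<exists>f G e R L c H. graded_patch f G e p R L c H \<alpha> S"
proof -
  obtain r f H where r: "0 < r" and f: "f \<in> C1H (ball p r)" and H: "1 \<le> H"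
    and nz: "hgrad (ball p r) f p \<noteq> 0" and zero: "S \<inter> ball p r = {q \<in> ball p r. f q = 0}"
    and hold: "\<And>q1 q2. q1 \<in> S \<inter> ball p r \<Longrightarrow> q2 \<in> S \<inter> ball p r \<Longrightarrow>
      norm (hgrad (ball p r) f q1 - hgrad (ball p r) f q2) \<le> H * dist q1 q2 powr \<alpha>"
    using S[unfolded C1H_surface_def, rule_format, OF p] by blast
  define U where "U = ball p r"
  define G where "G = hgrad U f"
  have "\<exists>g. continuous_on U g \<and> weak_hgrad U f g" using f by (simp add: C1H_def U_def)
  from someI_ex[OF this] have G: "continuous_on U G" "weak_hgrad U f G"
    unfolding G_def hgrad_def by auto
  have fc: "continuous_on U f" using f by (simp add: C1H_def U_def)
  have U: "open U" "p \<in> U" using r by (auto simp: U_def)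
  define g0 where "g0 = norm (G p)"
  have g0: "0 < g0" using nz by (simp add: g0_def G_def U_def)
  define e where "e = G p /\<^sub>R g0"
  have e: "norm e = 1" "G p \<bullet> e = g0" using g0 by (simp_all add: e_def g0_def dot_square_norm power2_eq_square)
  have "\<forall>\<epsilon>>0. \<exists>d>0. \<forall>x\<in>U. dist x p < d \<longrightarrow> dist (G x) (G p) < \<epsilon>"
    using G(1) U unfolding continuous_on_iff by blast
  then obtain d where d: "0 < d" "\<And>x. x \<in> U \<Longrightarrow> dist x p < d \<Longrightarrow> dist (G x) (G p) < g0 / 2"
    using g0 by (meson half_gt_zero)
  define R where "R = min r d"
  have R: "0 < R" using r d by (simp add: R_def)
  have sub: "ball p R \<subseteq> U" by (auto simp: R_def U_def)
  have near: "norm (G q - G p) < g0 / 2" if "q \<in> ball p R" for q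
    using d(2)[of q] that sub by (auto simp: R_def dist_norm dist_commute)
  define L where "L = 3 / 2 * g0"
  define c where "c = g0 / 2"
  have Lc: "0 < L" "0 < c" using g0 by (auto simp: L_def c_def)
  have GL: "norm (G q) \<le> L" if "q \<in> ball p R" for q
    using near[OF that] norm_triangle_sub[of "G q" "G p"] by (simp add: L_def g0_def)
  have Gc: "c \<le> G q \<bullet> e" if "q \<in> ball p R" for q
  proof -
    have "\<bar>(G q - G p) \<bullet> e\<bar> \<le> norm (G q - G p)" using Cauchy_Schwarz_ineq2[of "G q - G p" e] e by simp
    then show ?thesis using near[OF that] e(2) by (simp add: c_def inner_diff_left)
  qed
  have quot: "norm (G q1 /\<^sub>R (G q1 \<bullet> e) - G q2 /\<^sub>R (G q2 \<bullet> e)) \<le> ((1 / c + L / c\<^sup>2) * H) * dist q1 q2 powr \<alpha>"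
    if q: "q1 \<in> S \<inter> ball p R" "q2 \<in> S \<inter> ball p R" for q1 q2
  proof -
    let ?a = "G q1 \<bullet> e" and ?b = "G q2 \<bullet> e" and ?D = "norm (G q1 - G q2)"
    have ab: "c \<le> ?a" "c \<le> ?b" using Gc q by auto
    have "G q1 /\<^sub>R ?a - G q2 /\<^sub>R ?b = (G q1 - G q2) /\<^sub>R ?a + (inverse ?a - inverse ?b) *\<^sub>R G q2"
      by (simp add: algebra_simps)
    also have "norm \<dots> \<le> norm ((G q1 - G q2) /\<^sub>R ?a) + norm ((inverse ?a - inverse ?b) *\<^sub>R G q2)"
      by (rule norm_triangle_ineq)
    also have "norm ((G q1 - G q2) /\<^sub>R ?a) \<le> ?D / c"
      using ab Lc by (simp add: divide_inverse mult.commute) (intro mult_right_mono le_imp_inverse_le; simp)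
    also have "norm ((inverse ?a - inverse ?b) *\<^sub>R G q2) \<le> (?D / c\<^sup>2) * L"
      unfolding norm_scaleR
    proof (intro mult_mono GL)
      have "inverse ?a - inverse ?b = (?b - ?a) / (?a * ?b)" using ab Lc by (simp add: field_simps)
      also have "\<bar>\<dots>\<bar> = \<bar>?b - ?a\<bar> / (?a * ?b)" using ab Lc by (simp add: abs_mult)
      also have "\<dots> \<le> ?D / c\<^sup>2"
      proof (rule frac_le)
        show "\<bar>?b - ?a\<bar> \<le> ?D"
          using Cauchy_Schwarz_ineq2[of "G q2 - G q1" e] e by (simp add: inner_diff_left norm_minus_commute)
        show "c\<^sup>2 \<le> ?a * ?b" unfolding power2_eq_square using ab Lc by (intro mult_mono) auto
      qed (use Lc in auto)
      finally show "\<bar>inverse ?a - inverse ?b\<bar> \<le> ?D / c\<^sup>2" .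
    qed (use q Lc in auto)
    finally have "norm (G q1 /\<^sub>R ?a - G q2 /\<^sub>R ?b) \<le> (1 / c + L / c\<^sup>2) * ?D" by (simp add: algebra_simps)
    also have "\<dots> \<le> (1 / c + L / c\<^sup>2) * (H * dist q1 q2 powr \<alpha>)"
    proof (rule mult_left_mono)
      have "q1 \<in> S \<inter> ball p r" "q2 \<in> S \<inter> ball p r" using q sub unfolding U_def by blast+
      from hold[OF this] show "?D \<le> H * dist q1 q2 powr \<alpha>" by (simp only: G_def U_def)
    qed (use Lc in simp)
    finally show ?thesis by (simp add: mult.assoc)
  qed
  have "graded_patch f G e p R L c ((1 / c + L / c\<^sup>2) * H) \<alpha> S"
  proof
    show "((\<lambda>s. f (q \<cdot> hexp (s *\<^sub>R v))) has_real_derivative G (q \<cdot> hexp (t *\<^sub>R v)) \<bullet> v) (at t)"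
      if "q \<cdot> hexp (t *\<^sub>R v) \<in> ball p R" for q t v
      using that sub by (intro horizontal_derivative[OF U(1) fc G]) auto
    show "continuous_on (ball p R) G" by (rule continuous_on_subset[OF G(1) sub])
    show "q \<in> S \<longleftrightarrow> f q = 0" if "q \<in> ball p R" for q
      using zero that sub unfolding U_def by blast
  qed (use e R Lc \<alpha> H GL Gc quot in auto)
  then show ?thesis by blast
qed

text \<open>Transported from Euclidean space by the coordinates, which are a homeomorphism.\<close>

lemma heis_Lindelof:
  fixes \<F> :: "'n::finite heis set set"
  assumes "\<And>U. U \<in> \<F> \<Longrightarrow> open U"
  obtains \<F>' where "\<F>' \<subseteq> \<F>" "countable \<F>'" "\<Union>\<F>' = \<Union>\<F>"
proof -
  have "open U" if "U \<in> (`) coords ` \<F>" for U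
    using that assms by (auto simp: open_coords_image)
  then obtain \<G> where \<G>: "\<G> \<subseteq> (`) coords ` \<F>" "countable \<G>" "\<Union>\<G> = \<Union>((`) coords ` \<F>)"
    by (rule Lindelof)
  obtain \<F>' where F': "\<F>' \<subseteq> \<F>" "countable \<F>'" "\<G> = (`) coords ` \<F>'"
    using \<G>(1,2) countable_subset_image[of \<G> "(`) coords" \<F>] by auto
  have "coords ` \<Union>\<F>' = coords ` \<Union>\<F>" using \<G>(3) F'(3) by (simp add: image_Union)
  moreover have "inj (coords :: 'n heis \<Rightarrow> _)" by (intro injI) (simp add: coords_inject)
  ultimately have "\<Union>\<F>' = \<Union>\<F>" by (simp add: inj_image_eq_iff)
  then show thesis using F'(1,2) by (intro that)
qed

lemma LI_piece_empty: "LI_piece ({} :: 'n::finite heis set)"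
proof -
  have "vertical_subgroup_codim1 (vplane (axis (Inl (undefined :: 'n)) 1 :: real ^ ('n + 'n)))"
    by (intro vertical_vplane) (simp add: axis_eq_0_iff)
  moreover have "0-lipschitz_on {} (id :: 'n heis \<Rightarrow> 'n heis)" by (intro lipschitz_onI) auto
  ultimately show ?thesis unfolding LI_piece_def by (metis closedin_empty empty_subsetI)
qed

lemma hausdorff_outer_countable_null:
  assumes "countable I" "\<And>i. i \<in> I \<Longrightarrow> hausdorff_outer s (Z i) = 0"
  shows "hausdorff_outer s (\<Union>i\<in>I. Z i) = 0"
proof (cases "I = {}")
  case False
  then have "(\<Union>i\<in>I. Z i) = (\<Union>n. Z (from_nat_into I n))"
    using range_from_nat_into[OF False assms(1)] by (metis image_image)
  moreover have "hausdorff_outer s (\<Union>n. Z (from_nat_into I n)) \<le> (\<Sum>n. hausdorff_outer s (Z (from_nat_into I n)))"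
    by (rule hausdorff_outer_UN)
  moreover have "hausdorff_outer s (Z (from_nat_into I n)) = 0" for n
    using from_nat_into[OF False, of n] assms(2) by blast
  ultimately show ?thesis by simp
qed simp

theorem theorem1p7:
  fixes S :: "'n::finite heis set" and \<alpha> :: real
  assumes "0 < \<alpha>" and "\<alpha> \<le> 1"
    and "C1H_surface \<alpha> S"
  shows "LI_rectifiable S"
proof -
  let ?s = "real (2 * CARD('n) + 1)"
  have "\<exists>\<rho> \<E> Z. 0 < \<rho> \<and> compact (S \<inter> cball p \<rho>) \<and> countable \<E> \<and> (\<forall>E\<in>\<E>. LI_piece E) \<and>
      hausdorff_outer ?s Z = 0 \<and> S \<inter> cball p \<rho> \<subseteq> \<Union>\<E> \<union> Z" if p: "p \<in> S" for p
  proof -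
    obtain f G e R L c H where "graded_patch f G e p R L c H \<alpha> S"
      using graded_patch_exists[OF assms p] by blast
    then interpret graded_patch f G e p R L c H \<alpha> S .
    show ?thesis by (rule patch_rectifiable) blast
  qed
  then obtain \<rho> \<E> Z where loc: "\<And>p. p \<in> S \<Longrightarrow> 0 < \<rho> p \<and> compact (S \<inter> cball p (\<rho> p)) \<and> countable (\<E> p) \<and>
      (\<forall>E\<in>\<E> p. LI_piece E) \<and> hausdorff_outer ?s (Z p) = 0 \<and> S \<inter> cball p (\<rho> p) \<subseteq> \<Union>(\<E> p) \<union> Z p"
    by metis
  obtain \<F> where \<F>: "\<F> \<subseteq> (\<lambda>p. ball p (\<rho> p)) ` S" "countable \<F>" "\<Union>\<F> = (\<Union>p\<in>S. ball p (\<rho> p))"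
    by (rule heis_Lindelof[of "(\<lambda>p. ball p (\<rho> p)) ` S"]) auto
  obtain T where T: "T \<subseteq> S" "countable T" "\<F> = (\<lambda>p. ball p (\<rho> p)) ` T"
    using \<F>(1,2) by (metis countable_subset_image)
  have cover: "S \<subseteq> (\<Union>p\<in>T. ball p (\<rho> p))"
  proof -
    have "S \<subseteq> (\<Union>p\<in>S. ball p (\<rho> p))" using loc by auto
    then show ?thesis using \<F>(3) T(3) by simp
  qed
  have S_eq: "S = (\<Union>p\<in>T. S \<inter> cball p (\<rho> p))" using cover by force
  have "(\<Union>p\<in>T. S \<inter> cball p (\<rho> p)) \<in> sets borel"
  proof (rule sets.countable_UN'[OF T(2)])
    show "(\<lambda>p. S \<inter> cball p (\<rho> p)) ` T \<subseteq> sets borel" using loc T(1) by (auto intro!: borel_closed compact_imp_closed)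
  qed
  then have "S \<in> sets borel" using S_eq by simp
  then have meas: "hausdorff_measurable ?s S" by (intro hausdorff_measurable_borel) auto
  define \<D> where "\<D> = insert {} (\<Union>p\<in>T. \<E> p)"
  have \<D>: "countable \<D>" "\<D> \<noteq> {}" "\<And>E. E \<in> \<D> \<Longrightarrow> LI_piece E"
    using T loc by (auto simp: \<D>_def LI_piece_empty)
  have "LI_piece (from_nat_into \<D> i)" for i using \<D>(3) from_nat_into[OF \<D>(2)] by blast
  then have "\<forall>i. \<exists>W F g. vertical_subgroup_codim1 (W :: 'n heis set) \<and> closedin (top_of_set W) F \<and>
      (\<exists>L. L-lipschitz_on F g) \<and> from_nat_into \<D> i \<subseteq> g ` F"
    unfolding LI_piece_def by meson
  then obtain W F g where WFg: "\<And>i. vertical_subgroup_codim1 (W i :: 'n heis set) \<and> closedin (top_of_set (W i)) (F i) \<and>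
      (\<exists>L. L-lipschitz_on (F i) (g i)) \<and> from_nat_into \<D> i \<subseteq> g i ` F i"
    by metis
  have img: "\<Union>\<D> \<subseteq> (\<Union>i. g i ` F i)"
  proof
    fix x assume "x \<in> \<Union>\<D>"
    then obtain i where "x \<in> from_nat_into \<D> i"
      using range_from_nat_into[OF \<D>(2,1)] by (metis UnionE imageE)
    then show "x \<in> (\<Union>i. g i ` F i)" using WFg by blast
  qed
  have split: "S \<subseteq> \<Union>\<D> \<union> (\<Union>p\<in>T. Z p)"
  proof
    fix x assume "x \<in> S"
    then obtain p where p: "p \<in> T" "x \<in> S \<inter> cball p (\<rho> p)" using S_eq by blast
    then have "x \<in> \<Union>(\<E> p) \<union> Z p" using loc T(1) by blast
    then show "x \<in> \<Union>\<D> \<union> (\<Union>p\<in>T. Z p)" using p(1) by (auto simp: \<D>_def)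
  qed
  have "S - (\<Union>i. g i ` F i) \<subseteq> (\<Union>p\<in>T. Z p)"
    unfolding Diff_subset_conv by (rule order_trans[OF split Un_mono[OF img order_refl]])
  then have "hausdorff_outer ?s (S - (\<Union>i. g i ` F i)) \<le> hausdorff_outer ?s (\<Union>p\<in>T. Z p)"
    by (rule hausdorff_outer_mono)
  also have "\<dots> = 0" using T loc by (intro hausdorff_outer_countable_null) auto
  finally have "hausdorff_outer ?s (S - (\<Union>i. g i ` F i)) = 0" by simp
  then show ?thesis
    unfolding LI_rectifiable_def
    by (intro conjI meas exI[of _ W] exI[of _ F] exI[of _ g] allI) (use WFg in simp_all)
qed

end
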